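(* Let $\alpha\ge0$, $p>1$ and $\beta>0$. The generalized Cesàro operator $\mathcal{C}_\beta$ is a bounded operator on $\mathcal{T}_p^{(\alpha)}(t^\alpha)$ with $$\|\mathcal{C}_\beta\|=\frac{\Gamma(\beta+1)\Gamma(1-1/p)}{\Gamma(\beta+1-1/p)}.$$ Moreover, for $f\in\mathcal{T}_p^{(\alpha)}(t^\alpha)$, $$\mathcal{C}_\beta f(t)=\beta\int_0^\infty(1-e^{-r})^{\beta-1}e^{-r(1-1/p)}\,T_{r,p}f(t)\,dr,\qquad t\ge0,$$ where $T_{r,p}f(s)=e^{-r/p}f(e^{-r}s)$.
   Context: $\mathcal{S}_+$ denotes the Schwartz class on $[0,\infty)$. For $\alpha>0$ and $f\in\mathcal{S}_+$, the Weyl fractional integral is $W_+^{-\alpha}f(t)=\frac{1}{\Gamma(\alpha)}\int_t^\infty (s-t)^{\alpha-1}f(s)\,ds$, and the Weyl fractional derivative is $W_+^{\alpha}f(t)=(-1)^n\frac{d^n}{dt^n}W_+^{-(n-\alpha)}f(t)$ with $n=[\alpha]+1$. For $\alpha>0$ and $1\le p<\infty$, $\mathcal{T}_p^{(\alpha)}(t^\alpha)$ is the completion of $\mathcal{S}_+$ in the norm $\|f\|_{\alpha,p}=\frac{1}{\Gamma(\alpha+1)}\left(\int_0^\infty |W_+^\alpha f(t)|^p t^{\alpha p}\,dt\right)^{1/p}$; $\mathcal{T}_p^{(0)}(t^0)=L^p(\mathbb{R}^+)$. These spaces embed continuously into $L^p(\mathbb{R}^+)$, so elements are a.e. defined functions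 on $(0,\infty)$. The generalized Cesàro operator is $\mathcal{C}_\beta f(t)=\frac{\beta}{t^\beta}\int_0^t(t-s)^{\beta-1}f(s)\,ds$, $t>0$. The family $(T_{r,p})_{r\in\mathbb{R}}$ is a $C_0$-group of isometries on $\mathcal{T}_p^{(\alpha)}(t^\alpha)$. *)

theory Defs
  imports "HOL-Analysis.Analysis"
begin

fun iter_vderiv :: "nat \<Rightarrow> (real \<Rightarrow> 'a::real_normed_vector) \<Rightarrow> real \<Rightarrow> 'a" where
  "iter_vderiv 0 g = g"
| "iter_vderiv (Suc n) g = (\<lambda>t. vector_derivative (iter_vderiv n g) (at t))"

definition schwartz_plus :: "(real \<Rightarrow> complex) set" where
  "schwartz_plus = {f. \<exists>D::nat \<Rightarrow> real \<Rightarrow> complex.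
      (\<forall>t\<ge>0. D 0 t = f t) \<and>
      (\<forall>n t. t \<ge> 0 \<longrightarrow> (D n has_vector_derivative D (Suc n) t) (at t within {0..})) \<and>
      (\<forall>m n. \<exists>C. \<forall>t\<ge>0. (1 + t) ^ m * norm (D n t) \<le> C)}"

definition weyl_int :: "real \<Rightarrow> (real \<Rightarrow> complex) \<Rightarrow> real \<Rightarrow> complex" where
  "weyl_int a f t = complex_of_real (1 / Gamma a) *
     set_lebesgue_integral lborel {t<..} (\<lambda>s. complex_of_real ((s - t) powr (a - 1)) * f s)"

definition weyl_deriv :: "real \<Rightarrow> (real \<Rightarrow> complex) \<Rightarrow> real \<Rightarrow> complex" where
  "weyl_deriv \<alpha> f t = (let n = nat \<lfloor>\<alpha>\<rfloor> + 1 in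
     (-1) ^ n * iter_vderiv n (weyl_int (real n - \<alpha>) f) t)"

definition schwartz_norm :: "real \<Rightarrow> real \<Rightarrow> (real \<Rightarrow> complex) \<Rightarrow> real" where
  "schwartz_norm \<alpha> p f = 1 / Gamma (\<alpha> + 1) *
     (set_lebesgue_integral lborel {0<..} (\<lambda>t. norm (weyl_deriv \<alpha> f t) powr p * t powr (\<alpha> * p))) powr (1 / p)"

definition Lp_plus :: "real \<Rightarrow> (real \<Rightarrow> complex) set" where
  "Lp_plus p = {f. set_borel_measurable lborel {0<..} f \<and>
                   set_integrable lborel {0<..} (\<lambda>t. norm (f t) powr p)}"

definition Lp_norm :: "real \<Rightarrow> (real \<Rightarrow> complex) \<Rightarrow> real" where
  "Lp_norm p f = (set_lebesgue_integral lborel {0<..} (\<lambda>t. norm (f t) powr p)) powr (1 / p)"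

text \<open>phi is a sequence in S_+ which is Cauchy for the norm of T_p^(alpha) and
  converges to f in L^p (via the continuous embedding of the completion).\<close>
definition approx_seq :: "real \<Rightarrow> real \<Rightarrow> (real \<Rightarrow> complex) \<Rightarrow> (nat \<Rightarrow> real \<Rightarrow> complex) \<Rightarrow> bool" where
  "approx_seq \<alpha> p f \<phi> \<longleftrightarrow> (\<forall>n. \<phi> n \<in> schwartz_plus) \<and>
     (\<forall>e>0. \<exists>N. \<forall>m\<ge>N. \<forall>n\<ge>N. schwartz_norm \<alpha> p (\<lambda>t. \<phi> m t - \<phi> n t) < e) \<and>
     ((\<lambda>n. Lp_norm p (\<lambda>t. \<phi> n t - f t)) \<longlonglongrightarrow> 0)"

definition Tspace :: "real \<Rightarrow> real \<Rightarrow> (real \<Rightarrow> complex) set" where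
  "Tspace \<alpha> p = (if \<alpha> = 0 then Lp_plus p
                  else {f \<in> Lp_plus p. \<exists>\<phi>. approx_seq \<alpha> p f \<phi>})"

definition Tnorm :: "real \<Rightarrow> real \<Rightarrow> (real \<Rightarrow> complex) \<Rightarrow> real" where
  "Tnorm \<alpha> p f = (if \<alpha> = 0 then Lp_norm p f
     else (SOME L. \<exists>\<phi>. approx_seq \<alpha> p f \<phi> \<and> (\<lambda>n. schwartz_norm \<alpha> p (\<phi> n)) \<longlonglongrightarrow> L))"

definition cesaro :: "real \<Rightarrow> (real \<Rightarrow> complex) \<Rightarrow> real \<Rightarrow> complex" where
  "cesaro \<beta> f t = complex_of_real (\<beta> / t powr \<beta>) *
     set_lebesgue_integral lborel {0<..<t} (\<lambda>s. complex_of_real ((t - s) powr (\<beta> - 1)) * f s)"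

definition T_rp :: "real \<Rightarrow> real \<Rightarrow> (real \<Rightarrow> complex) \<Rightarrow> real \<Rightarrow> complex" where
  "T_rp r p f s = complex_of_real (exp (- r / p)) * f (exp (- r) * s)"

end

theory Submission
  imports Defs
begin

text \<open>Everything is expressed through averages of dilations
  \<open>dil \<kappa> f t = \<integral>\<^sub>0\<^sup>\<infinity> \<kappa>(u) f(u t) du\<close>, which commute with each other and, by Minkowski's inequality,
  are bounded on \<open>L\<^sup>p\<close> with norm at most \<open>dil_norm p \<kappa> = \<integral> \<bar>\<kappa>(u)\<bar> u\<^sup>-\<^sup>1\<^sup>/\<^sup>p du\<close>. Both the Cesaro operator and
  \<open>f \<mapsto> t\<^sup>\<alpha> W\<^sup>\<alpha> f\<close> (applied to \<open>t\<^sup>n f\<^sup>(\<^sup>n\<^sup>)\<close>) are such averages, so the Cesaro operator acts on the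
  representatives \<open>t\<^sup>\<alpha> W\<^sup>\<alpha> f\<close> exactly as it does on \<open>L\<^sup>p\<close>, and its kernel has norm
  \<open>\<beta> B(\<beta>, 1 - 1/p)\<close>. Since the Cesaro operator does not preserve \<open>S\<^sub>+\<close>, its kernel is truncated away
  from \<open>u = 0\<close>. The constant is sharp because averages of \<open>t\<^sup>\<alpha> e\<^sup>-\<^sup>t\<close> approximate the formal
  eigenfunction \<open>t\<^sup>-\<^sup>1\<^sup>/\<^sup>p\<close>.\<close>

section \<open>The space \<open>L\<^sup>p\<close> on the half-line\<close>

text \<open>In the variable log t these averages are convolutions, once L^p is transported by the
  factor \<open>t powr (1 / p)\<close>; the integral called \<open>dil_norm\<close> is the L^1 norm
  of the convolution kernel, which is where the exponent -1/p comes from. Two obstacles shape the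
  proof. Elements of the space are L^p limits of Cauchy sequences and \<open>Tnorm\<close> is a
  chosen limit of norms, so the norm of an element is a determinate number only after the operator
  sending f to t^\<alpha> W^\<alpha> f has been shown closable in L^p. And sharpness cannot be
  tested on arbitrary L^p functions when \<alpha> > 0, only on those of the form t^\<alpha>
  W^\<alpha> f. The function e^(-t) supplies them: every W^\<alpha> fixes it, and averaging its
  dilates over u in (a, 1) stays inside the Schwartz class. The L^p norms of the resulting test
  functions grow without bound (logarithmically in the p-th power) as a tends to 0, so the
  correction to the eigenvalue relation, which is fixed while a varies, becomes negligible.\<close>

lemma powr_Young:
  fixes x c p :: real
  assumes "x \<ge> 0" "c > 0" "p > 1"
  shows "x \<le> c * (1 - 1 / p) + x powr p * (c powr (1 - p) / p)"
proof -
  have q: "p / (p - 1) > 1" "1 / p + 1 / (p / (p - 1)) = 1"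
    using assms by (auto simp: field_simps)
  have "(x / c) * 1 \<le> (x / c) powr p / p + 1 powr (p / (p - 1)) / (p / (p - 1))"
    using assms q by (intro Youngs_inequality) auto
  also have "\<dots> = x powr p / c powr p / p + (1 - 1 / p)"
    using assms by (simp add: powr_divide field_simps)
  finally have "c * (x / c) \<le> c * (x powr p / c powr p / p + (1 - 1 / p))"
    using assms by (intro mult_left_mono) auto
  also have "\<dots> = c * (1 - 1 / p) + x powr p * (c powr (1 - p) / p)"
    using assms by (simp add: powr_diff field_simps)
  finally show ?thesis using assms by simp
qed

lemma powr_add_le:
  fixes x y p :: real
  assumes "x \<ge> 0" "y \<ge> 0" "p > 0"
  shows "(x + y) powr p \<le> 2 powr p * (x powr p + y powr p)"
proof -
  have "(x + y) powr p \<le> (2 * max x y) powr p"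
    using assms by (intro powr_mono2) auto
  also have "\<dots> = 2 powr p * max x y powr p" using assms by (simp add: powr_mult)
  also have "\<dots> \<le> 2 powr p * (x powr p + y powr p)"
    by (intro mult_left_mono) (auto simp: max_def)
  finally show ?thesis .
qed

text \<open>Convexity of the p-th power at \<open>x / A\<close> and \<open>y / B\<close> with
  weights \<open>A / (A + B)\<close> and \<open>B / (A + B)\<close>. If \<open>A\<close> and
  \<open>B\<close> bound the norms of two functions, integrating this gives
  \<open>(A + B) powr p\<close>, which is Minkowski's inequality.\<close>

lemma powr_convex_combination:
  fixes x y A B p :: real
  assumes "x \<ge> 0" "y \<ge> 0" "A > 0" "B > 0" "p \<ge> 1"
  shows "(x + y) powr p \<le> (A + B) powr (p - 1) * (x powr p / A powr (p - 1) + y powr p / B powr (p - 1))"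
proof -
  have le: "z powr p \<le> (A + B) powr (p - 1) * (z powr p / C powr (p - 1))" if "0 < C" "C \<le> A + B" for z C
  proof -
    have "C powr (p - 1) \<le> (A + B) powr (p - 1)" using that assms by (intro powr_mono2) auto
    then have "z powr p * C powr (p - 1) \<le> z powr p * (A + B) powr (p - 1)"
      by (intro mult_left_mono) auto
    then show ?thesis using that by (simp add: field_simps)
  qed
  consider "x = 0" | "y = 0" | "x > 0" "y > 0" using assms by linarith
  then show ?thesis
  proof cases
    case 1 then show ?thesis using le[of B y] assms by simp
  next
    case 2 then show ?thesis using le[of A x] assms by simp
  next
    case 3
    have "(A / (A + B) * (x / A) + B / (A + B) * (y / B)) powr p
        \<le> A / (A + B) * (x / A) powr p + B / (A + B) * (y / B) powr p"
    proof -
      have "1 - B / (A + B) = A / (A + B)" using assms by (simp add: field_simps)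
      then show ?thesis
        using convex_onD[OF powr_convex[OF \<open>p \<ge> 1\<close>], of "B / (A + B)" "x / A" "y / B"] assms 3
        by simp
    qed
    also have "A / (A + B) * (x / A) + B / (A + B) * (y / B) = (x + y) / (A + B)"
      using assms by (simp add: add_divide_distrib)
    finally have "(A + B) powr p * (((x + y) / (A + B)) powr p) \<le>
        (A + B) powr p * (A / (A + B) * (x / A) powr p + B / (A + B) * (y / B) powr p)"
      by (intro mult_left_mono) auto
    moreover have "(A + B) powr p * (((x + y) / (A + B)) powr p) = (x + y) powr p"
      using assms 3 by (simp add: powr_divide)
    moreover have "(A + B) powr p * (C / (A + B) * (z / C) powr p) = (A + B) powr (p - 1) * (z powr p / C powr (p - 1))"
      if "C > 0" "z > 0" for C z
      using that assms by (simp add: powr_divide powr_diff)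
    ultimately show ?thesis using assms 3 by (simp add: distrib_left)
  qed
qed

lemma Lp_plus_iff:
  "f \<in> Lp_plus p \<longleftrightarrow> (\<lambda>t. indicator {0<..} t *\<^sub>R f t) \<in> borel_measurable borel \<and>
     integrable lborel (\<lambda>t. indicator {0<..} t * norm (f t) powr p)"
  by (auto simp: Lp_plus_def set_borel_measurable_def set_integrable_def)

lemma Lp_norm_eq: "Lp_norm p f = (LINT t|lborel. indicator {0<..} t * norm (f t) powr p) powr (1 / p)"
  by (simp add: Lp_norm_def set_lebesgue_integral_def)

lemma Lp_norm_nonneg [simp]: "Lp_norm p f \<ge> 0"
  by (simp add: Lp_norm_def)

lemma borel_measurable_norm_powr:
  fixes f :: "real \<Rightarrow> complex"
  assumes "(\<lambda>t. indicator {0<..} t *\<^sub>R f t) \<in> borel_measurable borel"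
  shows "(\<lambda>t. indicator {0<..} t * norm (f t) powr p) \<in> borel_measurable borel"
proof -
  have "(\<lambda>t. indicator {0<..} t * norm (indicator {0<..} t *\<^sub>R f t) powr p) \<in> borel_measurable borel"
    using assms[measurable] by measurable
  also have "(\<lambda>t. indicator {0<..} t * norm (indicator {0<..} t *\<^sub>R f t) powr p) =
      (\<lambda>t. indicator {0<..} t * norm (f t) powr p)"
    by (auto simp: indicator_def)
  finally show ?thesis .
qed

lemma Lp_norm_powr:
  assumes "p > 0"
  shows "Lp_norm p f powr p = (LINT t|lborel. indicator {0<..} t * norm (f t) powr p)"
proof -
  have "(LINT t|lborel. indicator {0<..} t * norm (f t) powr p) \<ge> 0"
    by (intro integral_nonneg_AE) (auto simp: indicator_def)
  then show ?thesis using assms by (simp add: Lp_norm_eq powr_powr)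
qed

lemma Lp_bound:
  assumes "g \<in> Lp_plus p" "p > 0"
    and meas: "(\<lambda>t. indicator {0<..} t *\<^sub>R f t) \<in> borel_measurable borel"
    and le: "AE t in lborel. t > 0 \<longrightarrow> norm (f t) \<le> norm (g t)"
  shows "f \<in> Lp_plus p" "Lp_norm p f \<le> Lp_norm p g"
proof -
  have *: "AE t in lborel. indicator {0<..} t * norm (f t) powr p \<le> indicator {0<..} t * norm (g t) powr p"
    using le by eventually_elim (use assms(2) in \<open>auto simp: indicator_def intro!: powr_mono2\<close>)
  have g: "integrable lborel (\<lambda>t. indicator {0<..} t * norm (g t) powr p)"
    using assms by (simp add: Lp_plus_iff)
  have f: "integrable lborel (\<lambda>t. indicator {0<..} t * norm (f t) powr p)"
    by (rule Bochner_Integration.integrable_bound[OF g])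
       (use * borel_measurable_norm_powr[OF meas] in auto)
  show "f \<in> Lp_plus p" using f meas by (simp add: Lp_plus_iff)
  have "(LINT t|lborel. indicator {0<..} t * norm (f t) powr p) \<le>
        (LINT t|lborel. indicator {0<..} t * norm (g t) powr p)"
    using f g * by (rule integral_mono_AE)
  then show "Lp_norm p f \<le> Lp_norm p g"
    unfolding Lp_norm_eq using assms(2)
    by (intro powr_mono2) (auto intro!: integral_nonneg_AE simp: indicator_def)
qed

lemma Lp_norm_cong:
  assumes "\<And>t. t > 0 \<Longrightarrow> norm (f t) = norm (g t)"
  shows "Lp_norm p f = Lp_norm p g"
  unfolding Lp_norm_def by (subst set_lebesgue_integral_cong[of _ _ _ "\<lambda>t. norm (g t) powr p"]) (auto simp: assms)

lemma Lp_plus_cong: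
  assumes "\<And>t. t > 0 \<Longrightarrow> f t = g t"
  shows "f \<in> Lp_plus p \<longleftrightarrow> g \<in> Lp_plus p"
proof -
  have "(\<lambda>t. indicator {0<..} t *\<^sub>R f t) = (\<lambda>t. indicator {0<..} t *\<^sub>R g t)"
    using assms by (auto simp: indicator_def fun_eq_iff)
  moreover have "(\<lambda>t. indicator {0<..} t * norm (f t) powr p) = (\<lambda>t. indicator {0<..} t * norm (g t) powr p)"
    using assms by (auto simp: indicator_def fun_eq_iff)
  ultimately show ?thesis by (simp add: Lp_plus_iff)
qed

lemma Lp_norm_leI:
  assumes "p > 0" "C \<ge> 0" "(LINT t|lborel. indicator {0<..} t * norm (f t) powr p) \<le> C powr p"
  shows "Lp_norm p f \<le> C"
proof -
  have "Lp_norm p f \<le> (C powr p) powr (1 / p)"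
    unfolding Lp_norm_eq using assms
    by (intro powr_mono2) (auto intro!: integral_nonneg_AE simp: indicator_def)
  then show ?thesis using assms by (simp add: powr_powr)
qed

lemma Lp_add:
  assumes f: "f \<in> Lp_plus p" and g: "g \<in> Lp_plus p" and p: "p > 1"
  shows Lp_plus_add: "(\<lambda>t. f t + g t) \<in> Lp_plus p"
    and Lp_norm_triangle: "Lp_norm p (\<lambda>t. f t + g t) \<le> Lp_norm p f + Lp_norm p g"
proof -
  let ?i = "\<lambda>f t. indicator {0<..} t * norm (f t) powr p :: real"
  have meas: "(\<lambda>t. indicator {0<..} t *\<^sub>R (f t + g t)) \<in> borel_measurable borel"
    using f g by (auto simp: Lp_plus_iff scaleR_add_right simp del: borel_measurable_scaleR intro!: borel_measurable_add)
  have fi: "integrable lborel (?i f)" and gi: "integrable lborel (?i g)"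
    using f g by (auto simp: Lp_plus_iff)
  have int: "integrable lborel (?i (\<lambda>t. f t + g t))"
  proof (rule Bochner_Integration.integrable_bound)
    show "integrable lborel (\<lambda>t. 2 powr p * (?i f t + ?i g t))" using fi gi by simp
    have "norm (f t + g t) powr p \<le> 2 powr p * (norm (f t) powr p + norm (g t) powr p)" for t
    proof -
      have "norm (f t + g t) powr p \<le> (norm (f t) + norm (g t)) powr p"
        using p by (intro powr_mono2 norm_triangle_ineq) auto
      also have "\<dots> \<le> 2 powr p * (norm (f t) powr p + norm (g t) powr p)"
        using p by (intro powr_add_le) auto
      finally show ?thesis .
    qed
    then show "AE t in lborel. norm (?i (\<lambda>t. f t + g t) t) \<le> norm (2 powr p * (?i f t + ?i g t))"
      by (auto simp: indicator_def)
  qed (use borel_measurable_norm_powr[OF meas] in simp)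
  then show "(\<lambda>t. f t + g t) \<in> Lp_plus p" using meas by (simp add: Lp_plus_iff)
  \<comment> \<open>Strict upper bounds replace the norms themselves, so that the divisors
    \<open>A\<close> and \<open>B\<close> stay positive when a norm vanishes; the slack is removed
    at the end.\<close>
  have *: "Lp_norm p (\<lambda>t. f t + g t) \<le> A + B" if A: "Lp_norm p f < A" and B: "Lp_norm p g < B" for A B
  proof (rule Lp_norm_leI)
    have pos: "A > 0" "B > 0" using A B Lp_norm_nonneg[of p f] Lp_norm_nonneg[of p g] by linarith+
    then show "A + B \<ge> 0" by simp
    have fA: "integral\<^sup>L lborel (?i f) \<le> A powr p"
      using A p pos unfolding Lp_norm_powr[of p f, symmetric, OF order.strict_trans[OF zero_less_one p]]
      by (intro powr_mono2) auto
    have gB: "integral\<^sup>L lborel (?i g) \<le> B powr p"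
      using B p pos unfolding Lp_norm_powr[of p g, symmetric, OF order.strict_trans[OF zero_less_one p]]
      by (intro powr_mono2) auto
    have "integral\<^sup>L lborel (?i (\<lambda>t. f t + g t)) \<le>
       (LINT t|lborel. (A + B) powr (p - 1) * (?i f t / A powr (p - 1) + ?i g t / B powr (p - 1)))"
    proof (rule integral_mono[OF int])
      fix t
      have "norm (f t + g t) powr p \<le> (norm (f t) + norm (g t)) powr p"
        using p by (intro powr_mono2 norm_triangle_ineq) auto
      also have "\<dots> \<le> (A + B) powr (p - 1) * (norm (f t) powr p / A powr (p - 1) + norm (g t) powr p / B powr (p - 1))"
        using p pos by (intro powr_convex_combination) auto
      finally show "?i (\<lambda>t. f t + g t) t \<le> (A + B) powr (p - 1) * (?i f t / A powr (p - 1) + ?i g t / B powr (p - 1))"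
        by (auto simp: indicator_def)
    qed (use fi gi in auto)
    also have "\<dots> = (A + B) powr (p - 1) * (integral\<^sup>L lborel (?i f) / A powr (p - 1) + integral\<^sup>L lborel (?i g) / B powr (p - 1))"
      using fi gi by simp
    also have "\<dots> \<le> (A + B) powr (p - 1) * (A powr p / A powr (p - 1) + B powr p / B powr (p - 1))"
      using fA gB by (intro mult_left_mono add_mono divide_right_mono) auto
    also have "\<dots> = (A + B) powr p"
      using pos by (simp add: powr_diff)
    finally show "integral\<^sup>L lborel (?i (\<lambda>t. f t + g t)) \<le> (A + B) powr p" .
  qed (use p in simp)
  show "Lp_norm p (\<lambda>t. f t + g t) \<le> Lp_norm p f + Lp_norm p g"
  proof (rule field_le_epsilon)
    fix e :: real assume "e > 0"
    then show "Lp_norm p (\<lambda>t. f t + g t) \<le> Lp_norm p f + Lp_norm p g + e"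
      using *[of "Lp_norm p f + e / 2" "Lp_norm p g + e / 2"] by simp
  qed
qed

lemma Lp_plus_uminus: "f \<in> Lp_plus p \<Longrightarrow> (\<lambda>t. - f t) \<in> Lp_plus p"
  by (simp add: Lp_plus_iff)

lemma Lp_norm_minus_commute: "Lp_norm p (\<lambda>t. f t - g t) = Lp_norm p (\<lambda>t. g t - f t)"
  by (rule Lp_norm_cong) (simp add: norm_minus_commute)

lemma Lp_plus_diff:
  "f \<in> Lp_plus p \<Longrightarrow> g \<in> Lp_plus p \<Longrightarrow> p > 1 \<Longrightarrow> (\<lambda>t. f t - g t) \<in> Lp_plus p"
  using Lp_plus_add[of f p "\<lambda>t. - g t"] Lp_plus_uminus[of g p] by simp

lemma Lp_norm_diff_triangle:
  assumes "f \<in> Lp_plus p" "g \<in> Lp_plus p" "h \<in> Lp_plus p" "p > 1"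
  shows "Lp_norm p (\<lambda>t. f t - h t) \<le> Lp_norm p (\<lambda>t. f t - g t) + Lp_norm p (\<lambda>t. g t - h t)"
  using Lp_norm_triangle[of "\<lambda>t. f t - g t" p "\<lambda>t. g t - h t"] assms by (simp add: Lp_plus_diff)

lemma Lp_norm_le_diff:
  assumes "f \<in> Lp_plus p" "g \<in> Lp_plus p" "p > 1"
  shows "Lp_norm p f \<le> Lp_norm p g + Lp_norm p (\<lambda>t. f t - g t)"
  using Lp_norm_triangle[of g p "\<lambda>t. f t - g t"] assms by (simp add: Lp_plus_diff)

lemma Lp_norm_cmult:
  assumes "p > 0" "c \<ge> 0"
  shows "Lp_norm p (\<lambda>t. c *\<^sub>R f t) = c * Lp_norm p f"
proof -
  have "(\<lambda>t. indicator {0<..} t * norm (c *\<^sub>R f t) powr p) =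
        (\<lambda>t. c powr p * (indicator {0<..} t * norm (f t) powr p))"
    using assms by (auto simp: powr_mult)
  then have "Lp_norm p (\<lambda>t. c *\<^sub>R f t) =
     (c powr p * (LINT t|lborel. indicator {0<..} t * norm (f t) powr p)) powr (1 / p)"
    unfolding Lp_norm_eq by simp
  also have "\<dots> = c * Lp_norm p f"
    unfolding Lp_norm_eq using assms
    by (subst powr_mult) (auto intro!: integral_nonneg_AE simp: indicator_def powr_powr)
  finally show ?thesis .
qed

section \<open>Averages of dilations\<close>

definition dil :: "(real \<Rightarrow> real) \<Rightarrow> (real \<Rightarrow> complex) \<Rightarrow> real \<Rightarrow> complex" where
  "dil \<kappa> f t = (LINT u:{0<..}|lborel. \<kappa> u *\<^sub>R f (u * t))"

text \<open>Dilating the argument by \<open>u\<close> multiplies the L^p norm by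
  \<open>u powr (- 1 / p)\<close>, which explains the weight.\<close>

definition dil_norm :: "real \<Rightarrow> (real \<Rightarrow> real) \<Rightarrow> real" where
  "dil_norm p \<kappa> = (LINT u:{0<..}|lborel. \<bar>\<kappa> u\<bar> * u powr (- 1 / p))"

definition dil_kernel :: "real \<Rightarrow> (real \<Rightarrow> real) \<Rightarrow> bool" where
  "dil_kernel p \<kappa> \<longleftrightarrow> \<kappa> \<in> borel_measurable borel \<and>
     set_integrable lborel {0<..} (\<lambda>u. \<kappa> u * u powr (- 1 / p))"

text \<open>The best \<open>c\<close> balances the two terms. If \<open>K = 0\<close> or
  \<open>J = 0\<close> no minimiser exists and the bound follows by letting \<open>c\<close> tend to
  infinity or to 0.\<close>

lemma Young_optimized:
  fixes X K J p :: real
  assumes "p > 1" "X \<ge> 0" "K \<ge> 0" "J \<ge> 0"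
    and le: "\<And>c. c > 0 \<Longrightarrow> X \<le> c * (1 - 1 / p) * K + J * (c powr (1 - p) / p)"
  shows "X powr p \<le> K powr (p - 1) * J"
proof -
  consider "K = 0" | "J = 0" | "K > 0" "J > 0" using assms by linarith
  then show ?thesis
  proof cases
    case 1
    have "X \<le> 0"
    proof (rule tendsto_lowerbound)
      have "((\<lambda>c::real. c powr (1 - p)) \<longlongrightarrow> 0) at_top"
        using assms by (intro tendsto_neg_powr filterlim_ident) auto
      from tendsto_mult_right[OF this, of "J / p"]
      show "((\<lambda>c. J * (c powr (1 - p) / p)) \<longlongrightarrow> 0) at_top" by (simp add: field_simps)
      show "\<forall>\<^sub>F c in at_top. X \<le> J * (c powr (1 - p) / p)"
        using eventually_gt_at_top[of 0] by eventually_elim (use le 1 in auto)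
    qed simp
    then show ?thesis using assms by simp
  next
    case 2
    have "X \<le> 0"
    proof (rule tendsto_lowerbound)
      show "((\<lambda>c. c * (1 - 1 / p) * K) \<longlongrightarrow> 0) (at_right 0)"
        by (auto intro!: tendsto_eq_intros)
      show "\<forall>\<^sub>F c in at_right 0. X \<le> c * (1 - 1 / p) * K"
        unfolding eventually_at_right_field by (intro exI[of _ 1]) (use le 2 in auto)
    qed simp
    then show ?thesis using assms by simp
  next
    case 3
    \<comment> \<open>The zero of the derivative of the right-hand side in \<open>c\<close>; there
      the two terms add up to \<open>c * K\<close>.\<close>
    define c where "c = (J / K) powr (1 / p)"
    have c: "c > 0" "c powr p = J / K" using 3 assms by (auto simp: c_def powr_powr)
    have "J * (c powr (1 - p) / p) = c * K / p"
      using 3 c by (simp add: powr_diff)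
    then have "X \<le> c * K" using le[OF c(1)] assms by (simp add: field_simps)
    then have "X powr p \<le> (c * K) powr p" using assms by (intro powr_mono2) auto
    also have "\<dots> = J / K * K powr p" using 3 c by (simp add: powr_mult)
    also have "\<dots> = K powr (p - 1) * J" using 3 by (simp add: powr_diff)
    finally show ?thesis .
  qed
qed

text \<open>Elements of \<open>Lp_plus\<close> are measurable only after restriction to the
  half-line. For \<open>t > 0\<close> an average sees positive arguments only, so the restricted
  function may be used instead.\<close>

lemma dil_restrict:
  assumes "t > 0"
  shows "dil \<kappa> (\<lambda>s. indicator {0<..} s *\<^sub>R f s) t = dil \<kappa> f t"
  unfolding dil_def by (rule set_lebesgue_integral_cong) (use assms in \<open>auto simp: indicator_def\<close>)

lemma dil_cong:
  assumes "t > 0" "\<And>s. s > 0 \<Longrightarrow> f s = g s"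
  shows "dil \<kappa> f t = dil \<kappa> g t"
  unfolding dil_def by (rule set_lebesgue_integral_cong) (use assms in \<open>auto simp: indicator_def\<close>)

lemma dil_norm_nonneg: "dil_norm p \<kappa> \<ge> 0"
  unfolding dil_norm_def set_lebesgue_integral_def by (intro integral_nonneg_AE) (auto simp: indicator_def)

lemma borel_measurable_dil:
  assumes [measurable]: "f \<in> borel_measurable borel" "\<kappa> \<in> borel_measurable borel"
  shows "dil \<kappa> f \<in> borel_measurable borel"
  unfolding dil_def[abs_def] set_lebesgue_integral_def by measurable

lemma borel_measurable_dil_restrict:
  assumes "(\<lambda>t. indicator {0<..} t *\<^sub>R f t) \<in> borel_measurable borel" "\<kappa> \<in> borel_measurable borel"
  shows "(\<lambda>t. indicator {0<..} t *\<^sub>R dil \<kappa> f t) \<in> borel_measurable borel"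
proof -
  have "(\<lambda>t. indicator {0<..} t *\<^sub>R dil \<kappa> (\<lambda>s. indicator {0<..} s *\<^sub>R f s) t) \<in> borel_measurable borel"
    using borel_measurable_dil[OF assms, measurable] by measurable
  also have "(\<lambda>t. indicator {0<..} t *\<^sub>R dil \<kappa> (\<lambda>s. indicator {0<..} s *\<^sub>R f s) t) =
             (\<lambda>t. indicator {0<..} t *\<^sub>R dil \<kappa> f t)"
    by (auto simp: fun_eq_iff dil_restrict indicator_def[of "{0<..}" "_::real"] dest: dil_restrict)
  finally show ?thesis .
qed

text \<open>Young's inequality with a free parameter \<open>c\<close> is integrated against the weight
  \<open>\<bar>\<kappa> u\<bar> u\<^sup>-\<^sup>1\<^sup>/\<^sup>p\<close>, and \<open>c\<close> is optimised afterwards.\<close>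

lemma dil_Lp:
  assumes p: "p > 1" and f: "f \<in> Lp_plus p" and k: "dil_kernel p \<kappa>"
  shows Lp_plus_dil: "dil \<kappa> f \<in> Lp_plus p"
    and Lp_norm_dil_le: "Lp_norm p (dil \<kappa> f) \<le> dil_norm p \<kappa> * Lp_norm p f"
    and AE_dil_integrable: "AE t in lborel. t > 0 \<longrightarrow> set_integrable lborel {0<..} (\<lambda>u. \<kappa> u *\<^sub>R f (u * t))"
proof -
  define f0 where "f0 = (\<lambda>t. indicator {0<..} t *\<^sub>R f t)"
  have f0[measurable]: "f0 \<in> borel_measurable borel" using f by (simp add: Lp_plus_iff f0_def)
  have [measurable]: "\<kappa> \<in> borel_measurable borel" using k by (simp add: dil_kernel_def)
  define w where "w = (\<lambda>u. indicator {0<..} u * \<bar>\<kappa> u\<bar> * u powr (- 1 / p))"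
  have w[measurable]: "w \<in> borel_measurable borel" unfolding w_def by measurable
  have w0: "w u \<ge> 0" for u by (simp add: w_def)
  define K where "K = dil_norm p \<kappa>"
  have wint: "integrable lborel w"
    using set_integrable_abs[of lborel "{0<..}" "\<lambda>u. \<kappa> u * u powr (- 1 / p)"] k
    by (simp add: dil_kernel_def w_def abs_mult set_integrable_def mult.assoc)
  have K: "integral\<^sup>L lborel w = K" "K \<ge> 0"
    using dil_norm_nonneg by (simp_all add: K_def dil_norm_def w_def set_lebesgue_integral_def mult.assoc)
  have wn: "(\<integral>\<^sup>+u. ennreal (w u) \<partial>lborel) = ennreal K"
    using nn_integral_eq_integral[OF wint] w0 K by simp
  define N where "N = (\<integral>\<^sup>+s. ennreal (norm (f0 s) powr p) \<partial>lborel)"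
  have N: "N = ennreal (Lp_norm p f powr p)"
  proof -
    have "N = (\<integral>\<^sup>+t. ennreal (indicator {0<..} t * norm (f t) powr p) \<partial>lborel)"
      unfolding N_def by (intro nn_integral_cong) (auto simp: f0_def indicator_def)
    also have "\<dots> = ennreal (LINT t|lborel. indicator {0<..} t * norm (f t) powr p)"
      using f by (intro nn_integral_eq_integral) (auto simp: Lp_plus_iff)
    finally show ?thesis using p by (simp add: Lp_norm_powr)
  qed
  \<comment> \<open>The factor \<open>u\<close> is the p-th power of \<open>u powr (1 / p)\<close>,
    and it cancels the Jacobian of the substitution \<open>s = u * t\<close>. Hence Tonelli gives
    \<open>K * N\<close> for the integral of \<open>J\<close>, so \<open>J t\<close> is finite for
    almost every \<open>t\<close>.\<close>
  define J where "J = (\<lambda>t. \<integral>\<^sup>+u. ennreal (w u * (u * norm (f0 (u * t)) powr p)) \<partial>lborel)"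
  have J[measurable]: "J \<in> borel_measurable borel" unfolding J_def by measurable
  have "(\<integral>\<^sup>+t. J t \<partial>lborel) = (\<integral>\<^sup>+u. (\<integral>\<^sup>+t. ennreal (w u * (u * norm (f0 (u * t)) powr p)) \<partial>lborel) \<partial>lborel)"
    unfolding J_def by (rule lborel_pair.Fubini') measurable
  also have "\<dots> = (\<integral>\<^sup>+u. ennreal (w u) * N \<partial>lborel)"
  proof (rule nn_integral_cong)
    fix u :: real
    show "(\<integral>\<^sup>+t. ennreal (w u * (u * norm (f0 (u * t)) powr p)) \<partial>lborel) = ennreal (w u) * N"
    proof (cases "u > 0")
      case True
      have "(\<integral>\<^sup>+t. ennreal (w u * (u * norm (f0 (u * t)) powr p)) \<partial>lborel) =
            ennreal (w u) * (ennreal \<bar>u\<bar> * (\<integral>\<^sup>+t. ennreal (norm (f0 (0 + u * t)) powr p) \<partial>lborel))"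
        using True w0[of u] by (simp add: ennreal_mult' nn_integral_cmult)
      also have "ennreal \<bar>u\<bar> * (\<integral>\<^sup>+t. ennreal (norm (f0 (0 + u * t)) powr p) \<partial>lborel) = N"
        unfolding N_def using True by (intro nn_integral_real_affine[symmetric]) auto
      finally show ?thesis .
    qed (auto simp: w_def)
  qed
  also have "\<dots> = ennreal K * N" by (simp add: nn_integral_multc wn)
  finally have Jint: "(\<integral>\<^sup>+t. J t \<partial>lborel) = ennreal K * N" .
  have "AE t in lborel. J t \<noteq> \<infinity>"
    by (rule nn_integral_PInf_AE) (auto simp: Jint N ennreal_mult_eq_top_iff)
  have main: "set_integrable lborel {0<..} (\<lambda>u. \<kappa> u *\<^sub>R f (u * t)) \<and>
      ennreal (norm (dil \<kappa> f t) powr p) \<le> ennreal (K powr (p - 1)) * J t" if t: "t > 0" "J t \<noteq> \<infinity>" for t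
  proof -
    define j where "j = enn2real (J t)"
    have j: "J t = ennreal j" "j \<ge> 0" using t by (auto simp: j_def less_top)
    have i1: "integrable lborel (\<lambda>u. w u * (u * norm (f0 (u * t)) powr p))"
    proof (rule integrableI_nonneg)
      show "AE u in lborel. 0 \<le> w u * (u * norm (f0 (u * t)) powr p)" by (auto simp: w_def indicator_def)
      show "(\<integral>\<^sup>+u. ennreal (w u * (u * norm (f0 (u * t)) powr p)) \<partial>lborel) < \<infinity>"
        using t by (simp add: J_def less_top)
    qed measurable
    have i2: "(LINT u|lborel. w u * (u * norm (f0 (u * t)) powr p)) = j"
      using nn_integral_eq_integral[OF i1] j
      by (simp add: J_def w_def indicator_def integral_nonneg_AE)
    let ?g = "\<lambda>u. indicator {0<..} u * \<bar>\<kappa> u\<bar> * norm (f0 (u * t))"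
    have young: "?g u \<le> c * (1 - 1 / p) * w u + (w u * (u * norm (f0 (u * t)) powr p)) * (c powr (1 - p) / p)"
      if "c > 0" for c u
    proof (cases "u > 0")
      case True
      have "u powr (1 / p) * norm (f0 (u * t)) \<le> c * (1 - 1 / p) + (u powr (1 / p) * norm (f0 (u * t))) powr p * (c powr (1 - p) / p)"
        using p that by (intro powr_Young) auto
      also have "(u powr (1 / p) * norm (f0 (u * t))) powr p = u * norm (f0 (u * t)) powr p"
        using p True by (simp add: powr_mult powr_powr)
      finally have "w u * (u powr (1 / p) * norm (f0 (u * t))) \<le> w u * (c * (1 - 1 / p) + u * norm (f0 (u * t)) powr p * (c powr (1 - p) / p))"
        by (rule mult_left_mono[OF _ w0])
      moreover have "w u * (u powr (1 / p) * norm (f0 (u * t))) = ?g u"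
        using True by (simp add: w_def powr_minus)
      ultimately have "?g u \<le> w u * (c * (1 - 1 / p) + u * norm (f0 (u * t)) powr p * (c powr (1 - p) / p))"
        by linarith
      also have "\<dots> = c * (1 - 1 / p) * w u + (w u * (u * norm (f0 (u * t)) powr p)) * (c powr (1 - p) / p)"
        by (simp only: distrib_left mult_ac)
      finally show ?thesis .
    qed (auto simp: w_def)
    \<comment> \<open>For integrability any fixed parameter will do; \<open>c = 1\<close> is
      taken.\<close>
    have gi: "integrable lborel ?g"
    proof (rule Bochner_Integration.integrable_bound)
      show "integrable lborel (\<lambda>u. 1 * (1 - 1 / p) * w u + (w u * (u * norm (f0 (u * t)) powr p)) * (1 powr (1 - p) / p))"
        using wint i1 by (intro Bochner_Integration.integrable_add integrable_mult_right integrable_mult_left)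
      show "AE u in lborel. norm (?g u) \<le> norm (1 * (1 - 1 / p) * w u + (w u * (u * norm (f0 (u * t)) powr p)) * (1 powr (1 - p) / p))"
      proof (rule AE_I2)
        fix u
        have "norm (?g u) = ?g u" by simp
        also have "\<dots> \<le> 1 * (1 - 1 / p) * w u + (w u * (u * norm (f0 (u * t)) powr p)) * (1 powr (1 - p) / p)"
          by (rule young) simp
        finally show "norm (?g u) \<le> norm (1 * (1 - 1 / p) * w u + (w u * (u * norm (f0 (u * t)) powr p)) * (1 powr (1 - p) / p))"
          by simp
      qed
    qed measurable
    have eq: "indicator {0<..} u *\<^sub>R \<kappa> u *\<^sub>R f (u * t) = indicator {0<..} u *\<^sub>R \<kappa> u *\<^sub>R f0 (u * t)" for u
      using t by (simp add: f0_def indicator_def)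
    have int: "integrable lborel (\<lambda>u. indicator {0<..} u *\<^sub>R \<kappa> u *\<^sub>R f (u * t))"
      unfolding eq by (rule Bochner_Integration.integrable_bound[OF gi]) (auto simp: abs_mult)
    have "norm (dil \<kappa> f t) powr p \<le> K powr (p - 1) * j"
    proof (rule Young_optimized)
      fix c :: real assume c: "c > 0"
      have "norm (dil \<kappa> f t) \<le> (LINT u|lborel. norm (indicator {0<..} u *\<^sub>R \<kappa> u *\<^sub>R f (u * t)))"
        unfolding dil_def set_lebesgue_integral_def by (rule integral_norm_bound)
      also have "\<dots> = integral\<^sup>L lborel ?g" unfolding eq by (simp add: abs_mult)
      also have "\<dots> \<le> (LINT u|lborel. c * (1 - 1 / p) * w u + (w u * (u * norm (f0 (u * t)) powr p)) * (c powr (1 - p) / p))"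
        using young[OF c] wint i1
        by (intro integral_mono gi Bochner_Integration.integrable_add integrable_mult_right integrable_mult_left)
      also have "\<dots> = c * (1 - 1 / p) * K + j * (c powr (1 - p) / p)"
        using wint i1 by (subst Bochner_Integration.integral_add) (simp_all add: K i2)
      finally show "norm (dil \<kappa> f t) \<le> c * (1 - 1 / p) * K + j * (c powr (1 - p) / p)" .
    qed (use p K j in auto)
    then have "ennreal (norm (dil \<kappa> f t) powr p) \<le> ennreal (K powr (p - 1)) * J t"
      by (simp add: j ennreal_mult'[symmetric] ennreal_leI)
    with int show ?thesis by (simp add: set_integrable_def)
  qed
  show "AE t in lborel. t > 0 \<longrightarrow> set_integrable lborel {0<..} (\<lambda>u. \<kappa> u *\<^sub>R f (u * t))"
    using \<open>AE t in lborel. J t \<noteq> \<infinity>\<close> by eventually_elim (use main in auto)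
  have meas: "(\<lambda>t. indicator {0<..} t *\<^sub>R dil \<kappa> f t) \<in> borel_measurable borel"
    using f by (intro borel_measurable_dil_restrict) (auto simp: Lp_plus_iff)
  have "(\<integral>\<^sup>+t. ennreal (indicator {0<..} t * norm (dil \<kappa> f t) powr p) \<partial>lborel) \<le>
     (\<integral>\<^sup>+t. ennreal (K powr (p - 1)) * J t \<partial>lborel)"
    by (intro nn_integral_mono_AE, use \<open>AE t in lborel. J t \<noteq> \<infinity>\<close> in eventually_elim)
       (use main in \<open>auto simp: indicator_def\<close>)
  also have "\<dots> = ennreal (K powr (p - 1)) * (ennreal K * N)"
    by (simp add: nn_integral_cmult Jint)
  also have "\<dots> = ennreal ((K * Lp_norm p f) powr p)"
    using K p by (cases "K = 0") (simp_all add: N ennreal_mult'[symmetric] powr_mult powr_diff mult.assoc)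
  finally have nn: "(\<integral>\<^sup>+t. ennreal (indicator {0<..} t * norm (dil \<kappa> f t) powr p) \<partial>lborel) \<le> ennreal ((K * Lp_norm p f) powr p)" .
  have int: "integrable lborel (\<lambda>t. indicator {0<..} t * norm (dil \<kappa> f t) powr p)"
    by (rule integrableI_nonneg) (use nn borel_measurable_norm_powr[OF meas] in \<open>auto simp: indicator_def le_less_trans\<close>)
  show "dil \<kappa> f \<in> Lp_plus p" using int meas by (simp add: Lp_plus_iff)
  show "Lp_norm p (dil \<kappa> f) \<le> dil_norm p \<kappa> * Lp_norm p f"
  proof (rule Lp_norm_leI)
    have "ennreal (LINT t|lborel. indicator {0<..} t * norm (dil \<kappa> f t) powr p) \<le> ennreal ((K * Lp_norm p f) powr p)"
      using nn nn_integral_eq_integral[OF int] by (simp add: indicator_def)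
    then show "(LINT t|lborel. indicator {0<..} t * norm (dil \<kappa> f t) powr p) \<le> (dil_norm p \<kappa> * Lp_norm p f) powr p"
      by (simp add: K_def)
  qed (use p K in \<open>auto simp: K_def dil_norm_nonneg\<close>)
qed

lemma dil_kernel_diff: "dil_kernel p \<kappa> \<Longrightarrow> dil_kernel p \<nu> \<Longrightarrow> dil_kernel p (\<lambda>u. \<kappa> u - \<nu> u)"
  unfolding dil_kernel_def using set_integral_diff(1)[of lborel "{0<..}" "\<lambda>u. \<kappa> u * u powr (- 1 / p)" "\<lambda>u. \<nu> u * u powr (- 1 / p)"]
  by (auto simp: left_diff_distrib)

text \<open>\<open>dil\<close> is additive only where the integrals converge, which is almost
  everywhere by \<open>AE_dil_integrable\<close>; elsewhere a Bochner integral takes the default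
  value 0. The comparison is therefore made almost everywhere.\<close>

lemma Lp_norm_dil_diff_le:
  assumes p: "p > 1" and f: "f \<in> Lp_plus p" and g: "g \<in> Lp_plus p" and k: "dil_kernel p \<kappa>"
  shows "Lp_norm p (\<lambda>t. dil \<kappa> f t - dil \<kappa> g t) \<le> dil_norm p \<kappa> * Lp_norm p (\<lambda>t. f t - g t)"
proof -
  have fg: "(\<lambda>t. f t - g t) \<in> Lp_plus p" using f g p by (rule Lp_plus_diff)
  have "AE t in lborel. t > 0 \<longrightarrow> dil \<kappa> f t - dil \<kappa> g t = dil \<kappa> (\<lambda>t. f t - g t) t"
    using AE_dil_integrable[OF p f k] AE_dil_integrable[OF p g k]
  proof eventually_elim
    case (elim t)
    then show ?case by (auto simp: dil_def scaleR_diff_right set_integral_diff)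
  qed
  then have "Lp_norm p (\<lambda>t. dil \<kappa> f t - dil \<kappa> g t) \<le> Lp_norm p (dil \<kappa> (\<lambda>t. f t - g t))"
    using Lp_plus_diff[OF Lp_plus_dil[OF p f k] Lp_plus_dil[OF p g k] p] p
    by (intro Lp_bound(2)[OF Lp_plus_dil[OF p fg k]]) (auto simp: Lp_plus_iff)
  also have "\<dots> \<le> dil_norm p \<kappa> * Lp_norm p (\<lambda>t. f t - g t)"
    by (rule Lp_norm_dil_le[OF p fg k])
  finally show ?thesis .
qed

lemma Lp_norm_kernel_diff_le:
  assumes p: "p > 1" and f: "f \<in> Lp_plus p" and k: "dil_kernel p \<kappa>" "dil_kernel p \<nu>"
  shows "Lp_norm p (\<lambda>t. dil \<kappa> f t - dil \<nu> f t) \<le> dil_norm p (\<lambda>u. \<kappa> u - \<nu> u) * Lp_norm p f"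
proof -
  have "AE t in lborel. t > 0 \<longrightarrow> dil \<kappa> f t - dil \<nu> f t = dil (\<lambda>u. \<kappa> u - \<nu> u) f t"
    using AE_dil_integrable[OF p f k(1)] AE_dil_integrable[OF p f k(2)]
  proof eventually_elim
    case (elim t)
    then show ?case by (auto simp: dil_def scaleR_diff_left set_integral_diff)
  qed
  then have "Lp_norm p (\<lambda>t. dil \<kappa> f t - dil \<nu> f t) \<le> Lp_norm p (dil (\<lambda>u. \<kappa> u - \<nu> u) f)"
    using Lp_plus_diff[OF Lp_plus_dil[OF p f k(1)] Lp_plus_dil[OF p f k(2)] p] p
    by (intro Lp_bound(2)[OF Lp_plus_dil[OF p f dil_kernel_diff[OF k]]]) (auto simp: Lp_plus_iff)
  also have "\<dots> \<le> dil_norm p (\<lambda>u. \<kappa> u - \<nu> u) * Lp_norm p f"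
    by (rule Lp_norm_dil_le[OF p f dil_kernel_diff[OF k]])
  finally show ?thesis .
qed

text \<open>Fubini for \<open>\<kappa> u * \<nu> v * E (v * u * t)\<close>, where the two averages
  enter symmetrically. Integrable kernels and a bounded \<open>E\<close> give the identity at every
  \<open>t > 0\<close>, not merely almost everywhere.\<close>

lemma dil_commute:
  assumes [measurable]: "\<kappa> \<in> borel_measurable borel" "\<nu> \<in> borel_measurable borel"
    and k: "set_integrable lborel {0<..} \<kappa>" and n: "set_integrable lborel {0<..} \<nu>"
    and E: "(\<lambda>t. indicator {0<..} t *\<^sub>R E t) \<in> borel_measurable borel"
    and bd: "\<And>s. s > 0 \<Longrightarrow> norm (E s) \<le> C" and t: "t > 0"
  shows "dil \<kappa> (dil \<nu> E) t = dil \<nu> (dil \<kappa> E) t"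
proof -
  define E0 where "E0 = (\<lambda>t. indicator {0<..} t *\<^sub>R E t)"
  have [measurable]: "E0 \<in> borel_measurable borel" using E by (simp add: E0_def)
  have C: "C \<ge> 0" using bd[OF zero_less_one] norm_ge_zero[of "E 1"] by linarith
  have E0b: "norm (E0 s) \<le> C" for s using bd[of s] C by (auto simp: E0_def indicator_def)
  define k0 where "k0 = (\<lambda>u. indicator {0<..} u * \<kappa> u)"
  define n0 where "n0 = (\<lambda>u. indicator {0<..} u * \<nu> u)"
  have [measurable]: "k0 \<in> borel_measurable borel" "n0 \<in> borel_measurable borel"
    unfolding k0_def n0_def by measurable
  have ki: "integrable lborel k0" and ni: "integrable lborel n0"
    using k n by (auto simp: k0_def n0_def set_integrable_def)
  have prod: "integrable (lborel \<Otimes>\<^sub>M lborel) (\<lambda>(u, v). k0 u *\<^sub>R n0 v *\<^sub>R E0 (v * (u * t)))"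
  proof (rule Bochner_Integration.integrable_bound)
    show "integrable (lborel \<Otimes>\<^sub>M lborel) (\<lambda>(u, v). \<bar>k0 u\<bar> * (\<bar>n0 v\<bar> * C))"
    proof (rule lborel_pair.Fubini_integrable)
      show "integrable lborel (\<lambda>x. LINT y|lborel. norm (case (x, y) of (u, v) \<Rightarrow> \<bar>k0 u\<bar> * (\<bar>n0 v\<bar> * C)))"
        using ki ni C by (simp add: abs_mult)
      show "AE x in lborel. integrable lborel (\<lambda>y. case (x, y) of (u, v) \<Rightarrow> \<bar>k0 u\<bar> * (\<bar>n0 v\<bar> * C))"
        using ni by simp
    qed measurable
    show "AE x in lborel \<Otimes>\<^sub>M lborel. norm (case x of (u, v) \<Rightarrow> k0 u *\<^sub>R n0 v *\<^sub>R E0 (v * (u * t)))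
       \<le> norm (case x of (u, v) \<Rightarrow> \<bar>k0 u\<bar> * (\<bar>n0 v\<bar> * C))"
      using E0b C by (intro AE_I2) (auto simp: abs_mult mult.assoc intro!: mult_left_mono)
  qed measurable
  have d: "dil \<mu> E s = (LINT v|lborel. (indicator {0<..} v * \<mu> v) *\<^sub>R E0 (v * s))" if "s > 0" for s and \<mu> :: "real \<Rightarrow> real"
    unfolding dil_def set_lebesgue_integral_def using that
    by (intro Bochner_Integration.integral_cong) (auto simp: E0_def indicator_def)
  have "dil \<kappa> (dil \<nu> E) t = (LINT u|lborel. k0 u *\<^sub>R (LINT v|lborel. n0 v *\<^sub>R E0 (v * (u * t))))"
    unfolding dil_def[of \<kappa>] set_lebesgue_integral_def using t
    by (intro Bochner_Integration.integral_cong) (auto simp: k0_def n0_def d indicator_def)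
  also have "\<dots> = (LINT u|lborel. LINT v|lborel. k0 u *\<^sub>R n0 v *\<^sub>R E0 (v * (u * t)))"
    by (simp del: scaleR_scaleR)
  also have "\<dots> = (LINT v|lborel. LINT u|lborel. k0 u *\<^sub>R n0 v *\<^sub>R E0 (v * (u * t)))"
    by (rule lborel_pair.Fubini_integral[symmetric, OF prod])
  also have "\<dots> = (LINT v|lborel. n0 v *\<^sub>R (LINT u|lborel. k0 u *\<^sub>R E0 (u * (v * t))))"
    by (simp add: scaleR_left_commute[of "k0 _"] mult_ac del: scaleR_scaleR)
  also have "\<dots> = dil \<nu> (dil \<kappa> E) t"
    unfolding dil_def[of \<nu>] set_lebesgue_integral_def using t
    by (intro Bochner_Integration.integral_cong) (auto simp: k0_def n0_def d indicator_def)
  finally show ?thesis .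
qed

section \<open>Differentiation under the integral sign\<close>

lemma vector_derivative_bound_convex:
  fixes f :: "real \<Rightarrow> 'a::real_normed_vector"
  assumes "convex S" "\<And>x. x \<in> S \<Longrightarrow> (f has_vector_derivative f' x) (at x within S)"
    and "\<And>x. x \<in> S \<Longrightarrow> norm (f' x) \<le> B" "x \<in> S" "y \<in> S"
  shows "norm (f x - f y) \<le> B * \<bar>x - y\<bar>"
proof -
  have "norm (f x - f y) \<le> B * norm (x - y)"
  proof (rule differentiable_bound[OF assms(1)])
    fix x assume x: "x \<in> S"
    show "(f has_derivative (\<lambda>h. h *\<^sub>R f' x)) (at x within S)"
      using assms(2)[OF x] by (simp add: has_vector_derivative_def)
    show "onorm (\<lambda>h. h *\<^sub>R f' x) \<le> B"
      using assms(3)[OF x] by (intro onorm_le) (simp add: mult.commute[of B] mult_left_mono)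
  qed (use assms in auto)
  then show ?thesis by simp
qed

text \<open>Dominated convergence for the remainder quotient of the derivative, which the mean value
  inequality bounds by \<open>2 * B u\<close>. Derivatives are taken within a convex set so that the
  one-sided derivative at 0 is covered.\<close>

lemma has_vector_derivative_lebesgue_integral:
  fixes g :: "'b \<Rightarrow> real \<Rightarrow> 'a::{banach, second_countable_topology}"
  assumes S: "convex S" "t \<in> S"
    and int: "\<And>s. s \<in> S \<Longrightarrow> integrable M (\<lambda>u. g u s)"
    and der: "\<And>u s. u \<in> space M \<Longrightarrow> s \<in> S \<Longrightarrow> (g u has_vector_derivative g' u s) (at s within S)"
    and bd: "\<And>u s. u \<in> space M \<Longrightarrow> s \<in> S \<Longrightarrow> norm (g' u s) \<le> B u" and B: "integrable M B"
    and meas: "(\<lambda>u. g' u t) \<in> borel_measurable M"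
  shows "((\<lambda>s. LINT u|M. g u s) has_vector_derivative (LINT u|M. g' u t)) (at t within S)"
proof -
  have int': "integrable M (\<lambda>u. g' u t)"
    by (rule Bochner_Integration.integrable_bound[OF B meas]) (use bd S in \<open>force intro!: AE_I2\<close>)
  define q where "q = (\<lambda>u y. (1 / norm (y - t)) *\<^sub>R (g u y - (g u t + (y - t) *\<^sub>R g' u t)))"
  have lim: "((\<lambda>y. LINT u|M. q u y) \<longlongrightarrow> 0) (at t within S)"
    unfolding tendsto_at_iff_sequentially comp_def
  proof (intro allI impI)
    fix X :: "nat \<Rightarrow> real" assume X: "\<forall>i. X i \<in> S - {t}" "X \<longlonglongrightarrow> t"
    have "(\<lambda>i. LINT u|M. q u (X i)) \<longlonglongrightarrow> (LINT u|M. 0)"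
    proof (rule integral_dominated_convergence)
      show "integrable M (\<lambda>u. 2 * B u)" using B by simp
      show "(\<lambda>u. q u (X i)) \<in> borel_measurable M" for i
        unfolding q_def using int[of "X i"] int[of t] S X meas
        by (intro borel_measurable_scaleR borel_measurable_diff borel_measurable_add) auto
      show "AE u in M. (\<lambda>i. q u (X i)) \<longlonglongrightarrow> 0"
      proof (rule AE_I2)
        fix u assume u: "u \<in> space M"
        have "((\<lambda>y. q u y) \<longlongrightarrow> 0) (at t within S)"
          using der[OF u S(2)] unfolding has_vector_derivative_def has_derivative_within q_def by simp
        then show "(\<lambda>i. q u (X i)) \<longlonglongrightarrow> 0"
          using X unfolding tendsto_at_iff_sequentially comp_def by blast
      qed
      show "AE u in M. norm (q u (X i)) \<le> 2 * B u" for i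
      proof (rule AE_I2)
        fix u assume u: "u \<in> space M"
        have Xi: "X i \<in> S" "X i \<noteq> t" using X by auto
        have "norm (g u (X i) - (g u t + (X i - t) *\<^sub>R g' u t)) \<le>
              norm (g u (X i) - g u t) + norm ((X i - t) *\<^sub>R g' u t)"
          using norm_triangle_ineq4[of "g u (X i) - g u t" "(X i - t) *\<^sub>R g' u t"] by (simp add: algebra_simps)
        also have "\<dots> \<le> B u * \<bar>X i - t\<bar> + \<bar>X i - t\<bar> * B u"
          using vector_derivative_bound_convex[OF S(1) der[OF u] bd[OF u] Xi(1) S(2)] bd[OF u S(2)]
          by (intro add_mono) (auto intro!: mult_left_mono)
        finally show "norm (q u (X i)) \<le> 2 * B u"
          using Xi unfolding q_def norm_scaleR by (simp add: pos_divide_le_eq mult_ac)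
      qed
    qed simp
    then show "(\<lambda>i. LINT u|M. q u (X i)) \<longlonglongrightarrow> 0" by simp
  qed
  have eq: "(LINT u|M. q u y) = (1 / norm (y - t)) *\<^sub>R ((LINT u|M. g u y) - ((LINT u|M. g u t) + (y - t) *\<^sub>R (LINT u|M. g' u t)))"
    if "y \<in> S" for y
    unfolding q_def using int[OF that] int[OF S(2)] int' by simp
  have "((\<lambda>y. (1 / norm (y - t)) *\<^sub>R ((LINT u|M. g u y) - ((LINT u|M. g u t) + (y - t) *\<^sub>R (LINT u|M. g' u t)))) \<longlongrightarrow> 0) (at t within S)"
    using lim by (rule Lim_transform_within[OF _ zero_less_one]) (simp add: eq)
  then show ?thesis
    unfolding has_vector_derivative_def has_derivative_within
    by (simp add: bounded_linear_scaleR_left)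
qed

section \<open>Schwartz functions with their derivatives\<close>

text \<open>The witness in \<open>schwartz_plus\<close>, kept as explicit data: a function together
  with all its derivatives, one-sided at 0. Averages and differences are then formed on every level
  at once.\<close>

definition tower :: "(nat \<Rightarrow> real \<Rightarrow> complex) \<Rightarrow> bool" where
  "tower D \<longleftrightarrow> (\<forall>n t. t \<ge> 0 \<longrightarrow> (D n has_vector_derivative D (Suc n) t) (at t within {0..})) \<and>
     (\<forall>m n. \<exists>C. \<forall>t\<ge>0. (1 + t) ^ m * norm (D n t) \<le> C)"

lemma schwartz_plus_iff: "f \<in> schwartz_plus \<longleftrightarrow> (\<exists>D. tower D \<and> (\<forall>t\<ge>0. D 0 t = f t))"
  unfolding schwartz_plus_def tower_def by auto

lemma tower_der: "tower D \<Longrightarrow> t \<ge> 0 \<Longrightarrow> (D n has_vector_derivative D (Suc n) t) (at t within {0..})"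
  by (simp add: tower_def)

lemma tower_bound:
  assumes "tower D"
  obtains C where "C \<ge> 0" "\<And>t. t \<ge> 0 \<Longrightarrow> norm (D n t) \<le> C / (1 + t) ^ m"
proof -
  obtain C where C: "\<And>t. t \<ge> 0 \<Longrightarrow> (1 + t) ^ m * norm (D n t) \<le> C"
    using assms unfolding tower_def by blast
  have "C \<ge> 0" using C[of 0] norm_ge_zero[of "D n 0"] by (simp del: norm_ge_zero)
  moreover have "norm (D n t) \<le> C / (1 + t) ^ m" if "t \<ge> 0" for t
    using C[OF that] that by (simp add: field_simps)
  ultimately show thesis using that by blast
qed

lemma tower_continuous_on: "tower D \<Longrightarrow> continuous_on {0..} (D n)"
  by (auto simp: continuous_on_eq_continuous_within intro!: has_vector_derivative_continuous tower_der)

text \<open>\<open>D n\<close> is arbitrary on the negative half-line; composing with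
  \<open>max 0\<close> gives a function that is continuous on the whole line.\<close>

lemma tower_measurable:
  assumes "tower D" shows "(\<lambda>t. D n (max 0 t)) \<in> borel_measurable borel"
proof -
  have "continuous_on UNIV (\<lambda>t. D n (max 0 t))"
    by (intro continuous_on_compose2[OF tower_continuous_on[OF assms]] continuous_intros) auto
  then show ?thesis by (rule borel_measurable_continuous_onI)
qed

lemma tower_diff:
  assumes "tower D" "tower F" shows "tower (\<lambda>n t. D n t - F n t)"
  unfolding tower_def
proof (intro conjI allI impI)
  fix m n
  obtain C where C: "C \<ge> 0" "\<And>t. t \<ge> 0 \<Longrightarrow> norm (D n t) \<le> C / (1 + t) ^ m"
    using tower_bound[OF assms(1)] by blast
  obtain C' where C': "C' \<ge> 0" "\<And>t. t \<ge> 0 \<Longrightarrow> norm (F n t) \<le> C' / (1 + t) ^ m"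
    using tower_bound[OF assms(2)] by blast
  show "\<exists>C. \<forall>t\<ge>0. (1 + t) ^ m * norm (D n t - F n t) \<le> C"
  proof (intro exI allI impI)
    fix t :: real assume t: "t \<ge> 0"
    have "norm (D n t - F n t) \<le> C / (1 + t) ^ m + C' / (1 + t) ^ m"
      using norm_triangle_ineq4[of "D n t" "F n t"] C(2)[OF t] C'(2)[OF t] by linarith
    then show "(1 + t) ^ m * norm (D n t - F n t) \<le> C + C'"
      using t by (simp add: field_simps)
  qed
qed (intro has_vector_derivative_diff tower_der assms)

text \<open>Differentiating \<open>j\<close> times under the integral produces the factor
  \<open>u ^ j\<close>. The support condition secures rapid decay: for \<open>u > \<epsilon>\<close>
  one has \<open>1 + u * t \<ge> \<epsilon> * (1 + t)\<close>, so decay in \<open>u * t\<close> is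
  decay in \<open>t\<close>. With mass near \<open>u = 0\<close> this comparison breaks
  down.\<close>

lemma tower_dil:
  assumes D: "tower D" and k[measurable]: "\<kappa> \<in> borel_measurable borel" and ki: "set_integrable lborel {0<..} \<kappa>"
    and \<epsilon>: "\<epsilon> > 0" and supp: "\<And>u. u \<notin> {\<epsilon><..<1} \<Longrightarrow> \<kappa> u = 0"
  shows "tower (\<lambda>j. dil (\<lambda>u. \<kappa> u * u ^ j) (D j))"
  unfolding tower_def
proof (intro conjI allI impI)
  have k0: "\<kappa> u = 0" if "u \<le> 0" for u using that \<epsilon> by (intro supp) auto
  have ki': "integrable lborel \<kappa>"
  proof -
    have "(\<lambda>u. indicator {0<..} u *\<^sub>R \<kappa> u) = \<kappa>" using k0 by (auto simp: fun_eq_iff indicator_def)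
    then show ?thesis using ki by (simp add: set_integrable_def)
  qed
  have eq: "dil (\<lambda>u. \<kappa> u * u ^ j) (D j) t = (LINT u|lborel. (\<kappa> u * u ^ j) *\<^sub>R D j (u * t))" for j t
    unfolding dil_def set_lebesgue_integral_def
    by (intro Bochner_Integration.integral_cong) (auto simp: indicator_def k0)
  have kle: "\<bar>\<kappa> u * u ^ j\<bar> \<le> \<bar>\<kappa> u\<bar>" for u j
  proof (cases "u \<in> {\<epsilon><..<1}")
    case True
    then have "\<bar>u ^ j\<bar> \<le> 1" using \<epsilon> by (auto simp: power_le_one abs_if)
    then show ?thesis by (simp add: abs_mult mult_left_le)
  qed (simp add: supp)
  have meas: "(\<lambda>u. (\<kappa> u * u ^ j) *\<^sub>R D i (u * t)) \<in> borel_measurable borel" if "t \<ge> 0" for i j t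
  proof -
    note tower_measurable[OF D, measurable]
    have "(\<lambda>u. (\<kappa> u * u ^ j) *\<^sub>R D i (max 0 (u * t))) \<in> borel_measurable borel" by measurable
    also have "(\<lambda>u. (\<kappa> u * u ^ j) *\<^sub>R D i (max 0 (u * t))) = (\<lambda>u. (\<kappa> u * u ^ j) *\<^sub>R D i (u * t))"
    proof
      fix u show "(\<kappa> u * u ^ j) *\<^sub>R D i (max 0 (u * t)) = (\<kappa> u * u ^ j) *\<^sub>R D i (u * t)"
        using that by (cases "u > 0") (auto simp: k0 max_absorb2)
    qed
    finally show ?thesis .
  qed
  have bd: "norm ((\<kappa> u * u ^ j) *\<^sub>R D i (u * t)) \<le> \<bar>\<kappa> u\<bar> * C"
    if "t \<ge> 0" "C \<ge> 0" "\<And>t. t \<ge> 0 \<Longrightarrow> norm (D i t) \<le> C" for i j t u C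
  proof (cases "u > 0")
    case True
    then show ?thesis using that kle[of u j] by (auto intro!: mult_mono)
  qed (auto simp: k0 that)
  fix j and t :: real assume t: "t \<ge> 0"
  obtain C where C: "C \<ge> 0" "\<And>t. t \<ge> 0 \<Longrightarrow> norm (D j t) \<le> C"
    using tower_bound[OF D, of j 0] by auto
  obtain C' where C': "C' \<ge> 0" "\<And>t. t \<ge> 0 \<Longrightarrow> norm (D (Suc j) t) \<le> C'"
    using tower_bound[OF D, of "Suc j" 0] by auto
  have "((\<lambda>s. LINT u|lborel. (\<kappa> u * u ^ j) *\<^sub>R D j (u * s)) has_vector_derivative
         (LINT u|lborel. (\<kappa> u * u ^ Suc j) *\<^sub>R D (Suc j) (u * t))) (at t within {0..})"
  proof (rule has_vector_derivative_lebesgue_integral[where B="\<lambda>u. \<bar>\<kappa> u\<bar> * C'"])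
    show "integrable lborel (\<lambda>u. \<bar>\<kappa> u\<bar> * C')" using ki' by simp
    show "integrable lborel (\<lambda>u. (\<kappa> u * u ^ j) *\<^sub>R D j (u * s))" if "s \<in> {0..}" for s
    proof (rule Bochner_Integration.integrable_bound)
      show "integrable lborel (\<lambda>u. \<bar>\<kappa> u\<bar> * C)" using ki' by simp
      show "AE u in lborel. norm ((\<kappa> u * u ^ j) *\<^sub>R D j (u * s)) \<le> norm (\<bar>\<kappa> u\<bar> * C)"
        using bd[of s C j] that C by (auto simp: abs_mult)
    qed (use meas that in auto)
    show "((\<lambda>s. (\<kappa> u * u ^ j) *\<^sub>R D j (u * s)) has_vector_derivative (\<kappa> u * u ^ Suc j) *\<^sub>R D (Suc j) (u * s)) (at s within {0..})"
      if s: "s \<in> {0..}" for u s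
    proof (cases "u > 0")
      case True
      have "(D j has_vector_derivative D (Suc j) (u * s)) (at (u * s) within (\<lambda>s. u * s) ` {0..})"
        by (rule has_vector_derivative_within_subset[OF tower_der[OF D]]) (use True s in auto)
      then have "((D j \<circ> (\<lambda>s. u * s)) has_vector_derivative u *\<^sub>R D (Suc j) (u * s)) (at s within {0..})"
        by (intro vector_diff_chain_within) (auto intro!: derivative_eq_intros simp flip: has_real_derivative_iff_has_vector_derivative)
      then have "((\<lambda>s. (\<kappa> u * u ^ j) *\<^sub>R D j (u * s)) has_vector_derivative (\<kappa> u * u ^ j) *\<^sub>R u *\<^sub>R D (Suc j) (u * s)) (at s within {0..})"
        unfolding comp_def using has_vector_derivative_scaleR[OF DERIV_const[of "\<kappa> u * u ^ j"]] by fastforce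
      then show ?thesis by (simp add: mult_ac)
    qed (simp add: k0)
    show "norm ((\<kappa> u * u ^ Suc j) *\<^sub>R D (Suc j) (u * s)) \<le> \<bar>\<kappa> u\<bar> * C'" if "s \<in> {0..}" for u s
      using bd[of s C' "Suc j" u "Suc j"] that C' by auto
    show "(\<lambda>u. (\<kappa> u * u ^ Suc j) *\<^sub>R D (Suc j) (u * t)) \<in> borel_measurable lborel"
      using meas[OF t, of "Suc j" "Suc j"] by simp
  qed (use t in auto)
  then show "(dil (\<lambda>u. \<kappa> u * u ^ j) (D j) has_vector_derivative dil (\<lambda>u. \<kappa> u * u ^ Suc j) (D (Suc j)) t) (at t within {0..})"
    unfolding eq[abs_def] .
next
  fix m j
  have k0: "\<kappa> u = 0" if "u \<le> 0" for u using that \<epsilon> by (intro supp) auto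
  obtain C where C: "C \<ge> 0" "\<And>t. t \<ge> 0 \<Longrightarrow> norm (D j t) \<le> C / (1 + t) ^ m"
    using tower_bound[OF D, of j m] by auto
  show "\<exists>C. \<forall>t\<ge>0. (1 + t) ^ m * norm (dil (\<lambda>u. \<kappa> u * u ^ j) (D j) t) \<le> C"
  proof (cases "\<epsilon> < 1")
    case False
    then have "\<kappa> u = 0" for u by (intro supp) auto
    then have "\<kappa> = (\<lambda>_. 0)" by auto
    then show ?thesis by (intro exI[of _ 0]) (simp add: dil_def)
  next
    case e1: True
    let ?I = "LINT u|lborel. indicator {0<..} u * \<bar>\<kappa> u\<bar>"
    have ki2: "integrable lborel (\<lambda>u. indicator {0<..} u * \<bar>\<kappa> u\<bar>)"
      using set_integrable_abs[OF ki] by (simp add: set_integrable_def)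
    show ?thesis
    proof (intro exI allI impI)
      fix t :: real assume t: "t \<ge> 0"
      have b: "norm ((\<kappa> u * u ^ j) *\<^sub>R D j (u * t)) \<le> \<bar>\<kappa> u\<bar> * (C / (\<epsilon> * (1 + t)) ^ m)" for u
      proof (cases "u \<in> {\<epsilon><..<1}")
        case True
        have "\<bar>u ^ j\<bar> \<le> 1" using \<epsilon> True by (auto simp: power_le_one abs_if)
        have "\<epsilon> * t \<le> u * t" using True t by (intro mult_right_mono) auto
        then have le: "\<epsilon> * (1 + t) \<le> 1 + u * t"
          using e1 by (simp add: distrib_left)
        have pos: "0 < \<epsilon> * (1 + t)" using \<epsilon> t by (intro mult_pos_pos) auto
        have "C / (1 + u * t) ^ m \<le> C / (\<epsilon> * (1 + t)) ^ m"
          using C(1) le pos by (intro divide_left_mono power_mono mult_pos_pos zero_less_power) (use \<epsilon> t in linarith)+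
        moreover have "u * t \<ge> 0" using True \<epsilon> t by (intro mult_nonneg_nonneg) auto
        ultimately have "norm (D j (u * t)) \<le> C / (\<epsilon> * (1 + t)) ^ m"
          using C(2)[of "u * t"] by linarith
        then have "\<bar>\<kappa> u\<bar> * (\<bar>u ^ j\<bar> * norm (D j (u * t))) \<le> \<bar>\<kappa> u\<bar> * (1 * (C / (\<epsilon> * (1 + t)) ^ m))"
          using \<open>\<bar>u ^ j\<bar> \<le> 1\<close> by (intro mult_left_mono mult_mono) auto
        then show ?thesis by (simp add: abs_mult mult.assoc)
      qed (simp add: supp)
      have "norm (dil (\<lambda>u. \<kappa> u * u ^ j) (D j) t) \<le> (LINT u|lborel. (indicator {0<..} u * \<bar>\<kappa> u\<bar>) * (C / (\<epsilon> * (1 + t)) ^ m))"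
        unfolding dil_def set_lebesgue_integral_def
      proof (rule Bochner_Integration.integral_norm_bound_integral)
        show ii: "integrable lborel (\<lambda>u. (indicator {0<..} u * \<bar>\<kappa> u\<bar>) * (C / (\<epsilon> * (1 + t)) ^ m))"
          using ki2 by simp
        show b': "norm (indicator {0<..} u *\<^sub>R (\<kappa> u * u ^ j) *\<^sub>R D j (u * t)) \<le> (indicator {0<..} u * \<bar>\<kappa> u\<bar>) * (C / (\<epsilon> * (1 + t)) ^ m)" for u
          using b[of u] by (auto simp: indicator_def)
        note tower_measurable[OF D, measurable]
        have "(\<lambda>u. indicator {0<..} u *\<^sub>R (\<kappa> u * u ^ j) *\<^sub>R D j (max 0 (u * t))) \<in> borel_measurable borel" by measurable
        also have "(\<lambda>u. indicator {0<..} u *\<^sub>R (\<kappa> u * u ^ j) *\<^sub>R D j (max 0 (u * t))) = (\<lambda>u. indicator {0<..} u *\<^sub>R (\<kappa> u * u ^ j) *\<^sub>R D j (u * t))"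
          using t by (intro ext) (auto simp: indicator_def max_absorb2)
        finally show "integrable lborel (\<lambda>u. indicator {0<..} u *\<^sub>R (\<kappa> u * u ^ j) *\<^sub>R D j (u * t))"
          by (intro Bochner_Integration.integrable_bound[OF ii] AE_I2 order.trans[OF b'])
             (simp_all only: real_norm_def abs_ge_self measurable_lborel1 measurable_lborel2)
      qed
      then have "norm (dil (\<lambda>u. \<kappa> u * u ^ j) (D j) t) \<le> ?I * (C / (\<epsilon> * (1 + t)) ^ m)"
        by simp
      then have "(1 + t) ^ m * norm (dil (\<lambda>u. \<kappa> u * u ^ j) (D j) t) \<le> (1 + t) ^ m * (?I * (C / (\<epsilon> * (1 + t)) ^ m))"
        using t by (intro mult_left_mono) auto
      also have "\<dots> = ?I * C / \<epsilon> ^ m" using t \<epsilon> by (simp add: power_mult_distrib)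
      finally show "(1 + t) ^ m * norm (dil (\<lambda>u. \<kappa> u * u ^ j) (D j) t) \<le> ?I * C / \<epsilon> ^ m" .
    qed
  qed
qed

section \<open>Weyl derivatives as averages of dilations\<close>

lemma set_integrable_lborel_iff:
  fixes f :: "real \<Rightarrow> 'a::{banach, second_countable_topology}"
  assumes "set_borel_measurable lborel S f"
  shows "set_integrable lborel S f \<longleftrightarrow> set_integrable lebesgue S f"
  using assms unfolding set_integrable_def set_borel_measurable_def
  by (simp add: integrable_completion)

text \<open>The inversion \<open>v = 1 / x\<close> gives the integrand of the Beta integral with
  parameters \<open>m - a\<close> and \<open>a\<close>: \<open>a > 0\<close> is convergence at
  \<open>v = 1\<close>, and \<open>m > a\<close> convergence at infinity.\<close>

lemma set_integrable_powr_at_1: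
  fixes a m :: real
  assumes "a > 0" "m > a"
  shows "set_integrable lborel {1<..} (\<lambda>v. (v - 1) powr (a - 1) * v powr (- m))"
proof -
  let ?f = "\<lambda>v::real. (v - 1) powr (a - 1) * v powr (- m)"
  have img: "inverse ` {0<..<1::real} = {1<..}"
  proof safe
    fix y :: real assume y: "1 < y"
    then have "inverse (inverse y) = y" "inverse y \<in> {0<..<1}" by (auto simp: inverse_less_1_iff)
    then show "y \<in> inverse ` {0<..<1}" by (metis imageI)
  qed (auto simp: one_less_inverse)
  have "set_integrable lborel {0..1} (\<lambda>t. t powr (m - a - 1) * (1 - t) powr (a - 1))"
    using assms by (intro integrable_Beta) auto
  then have "set_integrable lborel {0<..<1} (\<lambda>t. t powr (m - a - 1) * (1 - t) powr (a - 1))"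
    by (rule set_integrable_subset) auto
  then have "set_integrable lebesgue {0<..<1} (\<lambda>t. t powr (m - a - 1) * (1 - t) powr (a - 1))"
    by (subst set_integrable_lborel_iff[symmetric]) (auto simp: set_borel_measurable_def)
  also have "?this \<longleftrightarrow> set_integrable lebesgue {0<..<1} (\<lambda>x. \<bar>- inverse (x ^ 2)\<bar> *\<^sub>R ?f (inverse x))"
  proof (rule set_integrable_cong)
    fix x :: real assume x: "x \<in> {0<..<1}"
    have "inverse x - 1 = (1 - x) / x" using x by (simp add: field_simps)
    then have "\<bar>- inverse (x ^ 2)\<bar> *\<^sub>R ?f (inverse x) = x powr (-2) * ((1 - x) powr (a - 1) * x powr (1 - a) * x powr m)"
      using x by (simp add: powr_divide powr_minus_divide powr_diff powr_numeral inverse_eq_divide)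
    also have "\<dots> = (1 - x) powr (a - 1) * x powr (- 2 + (1 - a) + m)"
      using x by (simp only: powr_add mult_ac)
    also have "- 2 + (1 - a) + m = m - a - 1" by simp
    finally show "x powr (m - a - 1) * (1 - x) powr (a - 1) = \<bar>- inverse (x ^ 2)\<bar> *\<^sub>R ?f (inverse x)"
      by (simp add: mult_ac)
  qed simp_all
  also have "\<dots> \<longleftrightarrow> set_integrable lebesgue (inverse ` {0<..<1}) ?f"
  proof (rule absolutely_integrable_change_of_variables_real[symmetric])
    show "(inverse has_field_derivative - inverse (x ^ 2)) (at x within {0<..<1})" if "x \<in> {0<..<1}" for x :: real
      using DERIV_inverse[of x "{0<..<1}"] that by (simp add: numeral_2_eq_2)
  qed (auto simp: inj_on_def)
  finally show ?thesis
    unfolding img by (subst set_integrable_lborel_iff) (auto simp: set_borel_measurable_def)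
qed

lemma set_integrable_powr_shift:
  fixes a m :: real
  assumes "a > 0" "m > a"
  shows "set_integrable lborel {0<..} (\<lambda>u. u powr (a - 1) * (1 + u) powr (- m))"
proof -
  have "integrable lborel (\<lambda>v. indicator {1<..} v *\<^sub>R ((v - 1) powr (a - 1) * v powr (- m)))"
    using set_integrable_powr_at_1[OF assms] by (simp add: set_integrable_def)
  from lborel_integrable_real_affine[OF this, of 1 1]
  show ?thesis unfolding set_integrable_def
    by (rule Bochner_Integration.integrable_cong[THEN iffD1, rotated 2]) (auto simp: indicator_def)
qed

definition weyl_order :: "real \<Rightarrow> nat" where "weyl_order \<alpha> = nat \<lfloor>\<alpha>\<rfloor> + 1"

lemma weyl_order:
  assumes "\<alpha> > 0" shows "0 < real (weyl_order \<alpha>) - \<alpha>" "real (weyl_order \<alpha>) - \<alpha> \<le> 1"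
  using assms unfolding weyl_order_def by linarith+

text \<open>On functions \<open>f\<close> of class \<open>S\<^sub>+\<close>, \<open>t\<^sup>\<alpha> W\<^sup>\<alpha> f(t)\<close> is the average of the dilates of
  \<open>s\<^sup>n f\<^sup>(\<^sup>n\<^sup>) (s)\<close> with respect to this kernel; the sign \<open>(-1)\<^sup>n\<close> is absorbed.\<close>

definition weyl_kernel :: "real \<Rightarrow> real \<Rightarrow> real" where
  "weyl_kernel \<alpha> v = (- 1) ^ weyl_order \<alpha> / Gamma (real (weyl_order \<alpha>) - \<alpha>) *
     (indicator {1<..} v * ((v - 1) powr (real (weyl_order \<alpha>) - \<alpha> - 1) * v powr (- real (weyl_order \<alpha>))))"

definition scaled_deriv :: "real \<Rightarrow> (nat \<Rightarrow> real \<Rightarrow> complex) \<Rightarrow> real \<Rightarrow> complex" where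
  "scaled_deriv \<alpha> D s = s ^ weyl_order \<alpha> *\<^sub>R D (weyl_order \<alpha>) s"

text \<open>Up to the factor \<open>Gamma (\<alpha> + 1)\<close> this is an isometric picture of the
  Schwartz class inside L^p: the norm of the space becomes the plain L^p norm of this function. It
  is defined from the tower, so that it is visibly an average.\<close>

definition weyl_tower :: "real \<Rightarrow> (nat \<Rightarrow> real \<Rightarrow> complex) \<Rightarrow> real \<Rightarrow> complex" where
  "weyl_tower \<alpha> D = dil (weyl_kernel \<alpha>) (scaled_deriv \<alpha> D)"

lemma weyl_kernel_measurable [measurable]: "weyl_kernel \<alpha> \<in> borel_measurable borel"
  unfolding weyl_kernel_def[abs_def] by measurable

lemma weyl_kernel_integrable:
  assumes "\<alpha> > 0" shows "set_integrable lborel {0<..} (weyl_kernel \<alpha>)"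
proof -
  have "integrable lborel (\<lambda>v. indicator {1<..} v * ((v - 1) powr (real (weyl_order \<alpha>) - \<alpha> - 1) * v powr (- real (weyl_order \<alpha>))))"
    using set_integrable_powr_at_1[of "real (weyl_order \<alpha>) - \<alpha>" "real (weyl_order \<alpha>)"] weyl_order[OF assms] assms
    by (simp add: set_integrable_def)
  then have "integrable lborel (weyl_kernel \<alpha>)" unfolding weyl_kernel_def[abs_def] by (rule integrable_mult_right)
  then show ?thesis unfolding set_integrable_def by (rule integrable_mult_indicator[rotated]) simp
qed

text \<open>The kernel lives on \<open>u > 1\<close>, where the weight
  \<open>u powr (- 1 / p)\<close> is at most 1.\<close>

lemma dil_kernel_weyl:
  assumes "\<alpha> > 0" "p > 0" shows "dil_kernel p (weyl_kernel \<alpha>)"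
  unfolding dil_kernel_def
proof
  show "set_integrable lborel {0<..} (\<lambda>u. weyl_kernel \<alpha> u * u powr (- 1 / p))"
  proof (rule set_integrable_bound[OF weyl_kernel_integrable[OF assms(1)]])
    have "norm (weyl_kernel \<alpha> u * u powr (- 1 / p)) \<le> norm (weyl_kernel \<alpha> u)" if "u > 0" for u
    proof (cases "u > 1")
      case True
      then have "u powr (- 1 / p) \<le> u powr 0" using assms by (intro powr_mono) auto
      then show ?thesis using True by (simp add: abs_mult mult_left_le)
    qed (simp add: weyl_kernel_def)
    then show "AE u in lborel. u \<in> {0<..} \<longrightarrow> norm (weyl_kernel \<alpha> u * u powr (- 1 / p)) \<le> norm (weyl_kernel \<alpha> u)" by auto
  qed (auto simp: set_borel_measurable_def)
qed simp

section \<open>Decay estimates, and the representatives of averages\<close>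

lemma Lp_plus_decay:
  assumes p: "p > 1" and meas: "(\<lambda>t. indicator {0<..} t *\<^sub>R f t) \<in> borel_measurable borel"
    and bd: "\<And>t. t > 0 \<Longrightarrow> norm (f t) \<le> C / (1 + t) ^ 2"
  shows "f \<in> Lp_plus p"
proof -
  have C: "C \<ge> 0" using order.trans[OF norm_ge_zero bd[of 1]] by simp
  have "integrable lborel (\<lambda>t. C powr p * (indicator {0<..} t * (t powr (1 - 1) * (1 + t) powr (- 2))))"
    using set_integrable_powr_shift[of 1 2] unfolding set_integrable_def real_scaleR_def
    by (intro integrable_mult_right) simp
  then have "integrable lborel (\<lambda>t. indicator {0<..} t * norm (f t) powr p)"
  proof (rule Bochner_Integration.integrable_bound)
    show "AE t in lborel. norm (indicator {0<..} t * norm (f t) powr p) \<le>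
        norm (C powr p * (indicator {0<..} t * (t powr (1 - 1) * (1 + t) powr (- 2))))"
    proof (rule AE_I2)
      fix t :: real
      show "norm (indicator {0<..} t * norm (f t) powr p) \<le>
        norm (C powr p * (indicator {0<..} t * (t powr (1 - 1) * (1 + t) powr (- 2))))"
      proof (cases "t > 0")
        case True
        have "norm (f t) powr p \<le> (C / (1 + t) ^ 2) powr p"
          using bd[OF True] p by (intro powr_mono2) auto
        also have "\<dots> = C powr p * ((1 + t) powr (- 2)) powr p"
          using C True by (simp add: powr_divide powr_minus_divide powr_numeral)
        also have "((1 + t) powr (- 2)) powr p = (1 + t) powr (- 2 * p)"
          using True by (simp add: powr_powr)
        also have "\<dots> \<le> (1 + t) powr (- 2)" using p True by (intro powr_mono) auto
        finally have "norm (f t) powr p \<le> C powr p * (1 + t) powr (- 2)" by (simp add: mult_left_mono)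
        then show ?thesis using True by simp
      qed simp
    qed
  qed (use borel_measurable_norm_powr[OF meas] in simp)
  then show ?thesis using meas by (simp add: Lp_plus_iff)
qed

lemma tower_restrict_measurable:
  assumes "tower D" shows "(\<lambda>t. indicator {0<..} t *\<^sub>R D n t) \<in> borel_measurable borel"
proof -
  have "(\<lambda>t. indicator {0<..} t *\<^sub>R D n (max 0 t)) \<in> borel_measurable borel"
    using tower_measurable[OF assms, measurable] by measurable
  also have "(\<lambda>t. indicator {0<..} t *\<^sub>R D n (max 0 t)) = (\<lambda>t. indicator {0<..} t *\<^sub>R D n t)"
    by (intro ext) (auto simp: indicator_def max_absorb2)
  finally show ?thesis .
qed

lemma tower_Lp: "tower D \<Longrightarrow> p > 1 \<Longrightarrow> D n \<in> Lp_plus p"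
proof -
  assume D: "tower D" and p: "p > 1"
  obtain C where "\<And>t. t \<ge> 0 \<Longrightarrow> norm (D n t) \<le> C / (1 + t) ^ 2" using tower_bound[OF D, of n 2] by metis
  then show ?thesis using p by (intro Lp_plus_decay[where C=C] tower_restrict_measurable D) auto
qed

lemma scaled_deriv_measurable:
  assumes "tower D" shows "(\<lambda>t. indicator {0<..} t *\<^sub>R scaled_deriv \<alpha> D t) \<in> borel_measurable borel"
proof -
  have "(\<lambda>t. t ^ weyl_order \<alpha> *\<^sub>R (indicator {0<..} t *\<^sub>R D (weyl_order \<alpha>) t)) \<in> borel_measurable borel"
    by (intro borel_measurable_scaleR tower_restrict_measurable assms) measurable
  then show ?thesis by (simp add: scaled_deriv_def mult_ac)
qed

lemma scaled_deriv_bound: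
  assumes D: "tower D"
  obtains C where "C \<ge> 0" "\<And>t. t > 0 \<Longrightarrow> norm (scaled_deriv \<alpha> D t) \<le> C / (1 + t) ^ 2"
    "\<And>t. t > 0 \<Longrightarrow> norm (scaled_deriv \<alpha> D t) \<le> C"
proof -
  let ?n = "weyl_order \<alpha>"
  \<comment> \<open>Of the \<open>?n + 2\<close> powers of decay, \<open>?n\<close> compensate the
    factor \<open>t ^ ?n\<close>, and two remain for integrability.\<close>
  obtain C where C: "C \<ge> 0" "\<And>t. t \<ge> 0 \<Longrightarrow> norm (D ?n t) \<le> C / (1 + t) ^ (?n + 2)"
    using tower_bound[OF D, of ?n "?n + 2"] by metis
  have *: "norm (scaled_deriv \<alpha> D t) \<le> C / (1 + t) ^ 2" if t: "t > 0" for t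
  proof -
    have "norm (scaled_deriv \<alpha> D t) = t ^ ?n * norm (D ?n t)" using t by (simp add: scaled_deriv_def)
    also have "\<dots> \<le> (1 + t) ^ ?n * (C / (1 + t) ^ (?n + 2))"
      using t C by (intro mult_mono power_mono) auto
    also have "\<dots> = C / (1 + t) ^ 2" using t by (simp add: power_add power2_eq_square)
    finally show ?thesis .
  qed
  have "C / (1 + t) ^ 2 \<le> C" if "t > 0" for t
    using that C by (simp add: divide_le_eq mult_left_le self_le_power mult_le_cancel_left1 one_le_power)
  with * C that show thesis by (metis order.trans)
qed

lemma scaled_deriv_Lp:
  assumes "tower D" "p > 1" shows "scaled_deriv \<alpha> D \<in> Lp_plus p"
proof -
  obtain C where "\<And>t. t > 0 \<Longrightarrow> norm (scaled_deriv \<alpha> D t) \<le> C / (1 + t) ^ 2"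
    using scaled_deriv_bound[OF assms(1)] by metis
  then show ?thesis by (intro Lp_plus_decay[where C=C] scaled_deriv_measurable assms)
qed

lemma weyl_tower_Lp:
  assumes "tower D" "p > 1" "\<alpha> > 0" shows "weyl_tower \<alpha> D \<in> Lp_plus p"
  unfolding weyl_tower_def using assms by (intro Lp_plus_dil scaled_deriv_Lp dil_kernel_weyl) auto

lemma dil_integrable_bounded:
  fixes E :: "real \<Rightarrow> complex"
  assumes [measurable]: "\<kappa> \<in> borel_measurable borel" and k: "set_integrable lborel {0<..} \<kappa>"
    and E: "(\<lambda>t. indicator {0<..} t *\<^sub>R E t) \<in> borel_measurable borel"
    and bd: "\<And>s. s > 0 \<Longrightarrow> norm (E s) \<le> C" and t: "t > 0"
  shows "set_integrable lborel {0<..} (\<lambda>u. \<kappa> u *\<^sub>R E (u * t))"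
proof -
  have C: "C \<ge> 0" using order.trans[OF norm_ge_zero bd[of 1]] by simp
  define E0 where "E0 = (\<lambda>t. indicator {0<..} t *\<^sub>R E t)"
  have [measurable]: "E0 \<in> borel_measurable borel" using E by (simp add: E0_def)
  have "(\<lambda>u. indicator {0<..} u *\<^sub>R \<kappa> u *\<^sub>R E0 (u * t)) \<in> borel_measurable borel" by measurable
  also have "(\<lambda>u. indicator {0<..} u *\<^sub>R \<kappa> u *\<^sub>R E0 (u * t)) = (\<lambda>u. indicator {0<..} u *\<^sub>R \<kappa> u *\<^sub>R E (u * t))"
    using t by (intro ext) (auto simp: E0_def indicator_def)
  finally have meas: "set_borel_measurable lborel {0<..} (\<lambda>u. \<kappa> u *\<^sub>R E (u * t))"
    by (simp add: set_borel_measurable_def)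
  have "set_integrable lborel {0<..} (\<lambda>u. C * \<kappa> u)" using k by simp
  then show ?thesis
  proof (rule set_integrable_bound[OF _ meas])
    show "AE u in lborel. u \<in> {0<..} \<longrightarrow> norm (\<kappa> u *\<^sub>R E (u * t)) \<le> norm (C * \<kappa> u)"
      using bd t C by (intro AE_I2) (auto simp: abs_mult mult.commute[of C] intro!: mult_left_mono)
  qed
qed

lemma weyl_tower_diff:
  assumes D: "tower D" and F: "tower F" and "\<alpha> > 0" "t > 0"
  shows "weyl_tower \<alpha> (\<lambda>n t. D n t - F n t) t = weyl_tower \<alpha> D t - weyl_tower \<alpha> F t"
proof -
  obtain C where C: "\<And>t. t > 0 \<Longrightarrow> norm (scaled_deriv \<alpha> D t) \<le> C" using scaled_deriv_bound[OF D] by metis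
  obtain C' where C': "\<And>t. t > 0 \<Longrightarrow> norm (scaled_deriv \<alpha> F t) \<le> C'" using scaled_deriv_bound[OF F] by metis
  have 1: "set_integrable lborel {0<..} (\<lambda>u. weyl_kernel \<alpha> u *\<^sub>R scaled_deriv \<alpha> D (u * t))"
    by (rule dil_integrable_bounded[OF _ weyl_kernel_integrable scaled_deriv_measurable C]) (use assms in auto)
  have 2: "set_integrable lborel {0<..} (\<lambda>u. weyl_kernel \<alpha> u *\<^sub>R scaled_deriv \<alpha> F (u * t))"
    by (rule dil_integrable_bounded[OF _ weyl_kernel_integrable scaled_deriv_measurable C']) (use assms in auto)
  have "scaled_deriv \<alpha> (\<lambda>n t. D n t - F n t) = (\<lambda>t. scaled_deriv \<alpha> D t - scaled_deriv \<alpha> F t)"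
    by (simp add: scaled_deriv_def fun_eq_iff scaleR_diff_right)
  then show ?thesis
    unfolding weyl_tower_def dil_def using set_integral_diff(2)[OF 1 2] by (simp add: scaleR_diff_right)
qed

text \<open>The factor \<open>u ^ n\<close> created by differentiating the average merges with
  \<open>s ^ n\<close> into \<open>(u * s) ^ n\<close>, so averaging passes through
  \<open>scaled_deriv\<close>; then it commutes with the Weyl kernel. Through this relation
  estimates in L^p carry over to every \<alpha> > 0.\<close>

lemma weyl_tower_dil:
  assumes D: "tower D" and k: "\<kappa> \<in> borel_measurable borel" "set_integrable lborel {0<..} \<kappa>"
    and \<alpha>: "\<alpha> > 0" and t: "t > 0"
  shows "weyl_tower \<alpha> (\<lambda>j. dil (\<lambda>u. \<kappa> u * u ^ j) (D j)) t = dil \<kappa> (weyl_tower \<alpha> D) t"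
proof -
  obtain C where C: "\<And>t. t > 0 \<Longrightarrow> norm (scaled_deriv \<alpha> D t) \<le> C" using scaled_deriv_bound[OF D] by metis
  have "scaled_deriv \<alpha> (\<lambda>j. dil (\<lambda>u. \<kappa> u * u ^ j) (D j)) s = dil \<kappa> (scaled_deriv \<alpha> D) s" for s
    unfolding scaled_deriv_def dil_def set_integral_scaleR_right[symmetric]
    by (rule set_lebesgue_integral_cong) (auto simp: power_mult_distrib mult_ac)
  then have "weyl_tower \<alpha> (\<lambda>j. dil (\<lambda>u. \<kappa> u * u ^ j) (D j)) t = dil (weyl_kernel \<alpha>) (dil \<kappa> (scaled_deriv \<alpha> D)) t"
    unfolding weyl_tower_def by presburger
  also have "\<dots> = dil \<kappa> (dil (weyl_kernel \<alpha>) (scaled_deriv \<alpha> D)) t"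
    by (rule dil_commute[OF _ k(1) weyl_kernel_integrable[OF \<alpha>] k(2) scaled_deriv_measurable[OF D] C t]) auto
  finally show ?thesis by (simp add: weyl_tower_def)
qed

section \<open>Identification with the Weyl derivative\<close>

lemma weyl_int_shift:
  "weyl_int a g t = complex_of_real (1 / Gamma a) * (LINT u|lborel. indicator {0<..} u *\<^sub>R u powr (a - 1) *\<^sub>R g (u + t))"
proof -
  have "set_lebesgue_integral lborel {t<..} (\<lambda>s. complex_of_real ((s - t) powr (a - 1)) * g s) =
    \<bar>1\<bar> *\<^sub>R (LINT u|lborel. indicator {t<..} (t + 1 * u) *\<^sub>R (complex_of_real ((t + 1 * u - t) powr (a - 1)) * g (t + 1 * u)))"
    unfolding set_lebesgue_integral_def by (rule lborel_integral_real_affine) simp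
  also have "\<dots> = (LINT u|lborel. indicator {0<..} u *\<^sub>R u powr (a - 1) *\<^sub>R g (u + t))"
    by (simp add: scaleR_conv_of_real add.commute mult.assoc) 
       (intro Bochner_Integration.integral_cong, auto simp: indicator_def)
  finally show ?thesis by (simp add: weyl_int_def)
qed

text \<open>After the substitution \<open>s = u + t\<close> the singular factor
  \<open>u powr (a - 1)\<close> is free of \<open>t\<close>, so the derivative falls on
  \<open>D k\<close> alone. The integrands are dominated by a multiple of
  \<open>u powr (a - 1) * (1 + u) powr (- 2)\<close>.\<close>

lemma weyl_int_has_vector_derivative:
  assumes D: "tower D" and a: "0 < a" "a \<le> 1" and t: "t > 0"
  shows "(weyl_int a (D k) has_vector_derivative weyl_int a (D (Suc k)) t) (at t)"
proof -
  let ?g = "\<lambda>k u s. indicator {0<..} u *\<^sub>R u powr (a - 1) *\<^sub>R D k (u + s)"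
  have meas: "(\<lambda>u. ?g k u s) \<in> borel_measurable borel" if "s > 0" for s k
  proof -
    note tower_measurable[OF D, measurable]
    have "(\<lambda>u. indicator {0<..} u *\<^sub>R u powr (a - 1) *\<^sub>R D k (max 0 (u + s))) \<in> borel_measurable borel" by measurable
    also have "(\<lambda>u. indicator {0<..} u *\<^sub>R u powr (a - 1) *\<^sub>R D k (max 0 (u + s))) = (\<lambda>u. ?g k u s)"
      using that by (intro ext) (auto simp: indicator_def max_absorb2)
    finally show ?thesis .
  qed
  have bi: "integrable lborel (\<lambda>u. C * (indicator {0<..} u * (u powr (a - 1) * (1 + u) powr (- 2))))" for C
    using set_integrable_powr_shift[of a 2] a by (intro integrable_mult_right) (auto simp: set_integrable_def)
  have bd: "norm (?g k u s) \<le> C * (indicator {0<..} u * (u powr (a - 1) * (1 + u) powr (- 2)))"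
    if C: "C \<ge> 0" "\<And>t. t \<ge> 0 \<Longrightarrow> norm (D k t) \<le> C / (1 + t) ^ 2" and s: "s > 0" for C k u s
  proof (cases "u > 0")
    case True
    have "norm (D k (u + s)) \<le> C / (1 + (u + s)) ^ 2" using C True s by auto
    also have "\<dots> \<le> C / (1 + u) ^ 2" using C True s by (intro divide_left_mono power_mono mult_pos_pos) auto
    also have "\<dots> = C * (1 + u) powr (- 2)" using True by (simp add: powr_minus_divide powr_numeral)
    finally have "u powr (a - 1) * norm (D k (u + s)) \<le> u powr (a - 1) * (C * (1 + u) powr (- 2))"
      by (rule mult_left_mono) simp
    then show ?thesis using True by (simp add: mult_ac)
  qed simp
  obtain C where C: "C \<ge> 0" "\<And>t. t \<ge> 0 \<Longrightarrow> norm (D k t) \<le> C / (1 + t) ^ 2" using tower_bound[OF D, of k 2] by metis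
  obtain C' where C': "C' \<ge> 0" "\<And>t. t \<ge> 0 \<Longrightarrow> norm (D (Suc k) t) \<le> C' / (1 + t) ^ 2" using tower_bound[OF D, of "Suc k" 2] by metis
  have "((\<lambda>s. LINT u|lborel. ?g k u s) has_vector_derivative (LINT u|lborel. ?g (Suc k) u t)) (at t within {0<..})"
  proof (rule has_vector_derivative_lebesgue_integral[where B="\<lambda>u. C' * (indicator {0<..} u * (u powr (a - 1) * (1 + u) powr (- 2)))"])
    show "norm (?g (Suc k) u s) \<le> C' * (indicator {0<..} u * (u powr (a - 1) * (1 + u) powr (- 2)))" if "s \<in> {0<..}" for u s
      using that bd[OF C'] by auto
    show "integrable lborel (\<lambda>u. ?g k u s)" if "s \<in> {0<..}" for s
      using that bd[OF C, of s] meas[of s k]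
      by (intro Bochner_Integration.integrable_bound[OF bi[of C]] AE_I2 order.trans[OF bd[OF C, of s]])
         (simp_all only: real_norm_def abs_ge_self measurable_lborel1 measurable_lborel2 greaterThan_iff)
    show "((\<lambda>s. ?g k u s) has_vector_derivative ?g (Suc k) u s) (at s within {0<..})" if s: "s \<in> {0<..}" for u s
    proof (cases "u > 0")
      case True
      have "(D k has_vector_derivative D (Suc k) (u + s)) (at (u + s) within (\<lambda>s. u + s) ` {0<..})"
        by (rule has_vector_derivative_within_subset[OF tower_der[OF D]]) (use True s in auto)
      then have "((D k \<circ> (\<lambda>s. u + s)) has_vector_derivative 1 *\<^sub>R D (Suc k) (u + s)) (at s within {0<..})"
        by (intro vector_diff_chain_within) (auto intro!: derivative_eq_intros simp flip: has_real_derivative_iff_has_vector_derivative)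
      then have "((\<lambda>s. (u powr (a - 1)) *\<^sub>R D k (u + s)) has_vector_derivative (u powr (a - 1)) *\<^sub>R D (Suc k) (u + s)) (at s within {0<..})"
        unfolding comp_def using has_vector_derivative_scaleR[OF DERIV_const[of "u powr (a - 1)"]] by fastforce
      then show ?thesis using True by simp
    qed simp
    show "(\<lambda>u. ?g (Suc k) u t) \<in> borel_measurable lborel" using meas[OF t] by simp
  qed (use t bi in auto)
  then have "((\<lambda>s. LINT u|lborel. ?g k u s) has_vector_derivative (LINT u|lborel. ?g (Suc k) u t)) (at t)"
    using t by (simp add: at_within_open[of t "{0<..}"])
  then show ?thesis
    unfolding weyl_int_shift[abs_def] by (rule has_vector_derivative_mult_right)
qed

lemma iter_vderiv_weyl_int:
  assumes D: "tower D" and f: "\<And>t. t \<ge> 0 \<Longrightarrow> D 0 t = f t" and a: "0 < a" "a \<le> 1" and t: "t > 0"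
  shows "iter_vderiv k (weyl_int a f) t = weyl_int a (D k) t"
  using t
proof (induction k arbitrary: t)
  case 0
  then show ?case unfolding iter_vderiv.simps weyl_int_def
    by (intro arg_cong2[where f="(*)"] refl set_lebesgue_integral_cong) (auto simp: f)
next
  case (Suc k)
  have "(iter_vderiv k (weyl_int a f) has_vector_derivative weyl_int a (D (Suc k)) t) (at t)"
    by (rule has_vector_derivative_transform_within_open[OF weyl_int_has_vector_derivative[OF D a Suc.prems], of "{0<..}"])
       (use Suc in auto)
  then show ?case by (simp add: vector_derivative_at)
qed

text \<open>All \<open>n\<close> derivatives are moved onto \<open>f\<close> under the Weyl
  integral, and the substitution \<open>s = t * v\<close> makes the integral homogeneous in
  \<open>t\<close>.\<close>

lemma weyl_deriv_eq_weyl_tower: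
  assumes D: "tower D" and f: "\<And>t. t \<ge> 0 \<Longrightarrow> D 0 t = f t" and \<alpha>: "\<alpha> > 0" and t: "t > 0"
  shows "(t powr \<alpha>) *\<^sub>R weyl_deriv \<alpha> f t = weyl_tower \<alpha> D t"
proof -
  define n where "n = weyl_order \<alpha>"
  define a where "a = real n - \<alpha>"
  have a: "0 < a" "a \<le> 1" using weyl_order[OF \<alpha>] by (auto simp: a_def n_def)
  have "weyl_deriv \<alpha> f t = (- 1) ^ n * weyl_int a (D n) t"
    using iter_vderiv_weyl_int[OF D f a t, of n]
    by (simp add: weyl_deriv_def Let_def a_def n_def weyl_order_def)
  also have "weyl_int a (D n) t = complex_of_real (1 / Gamma a) *
      (\<bar>t\<bar> *\<^sub>R (LINT v|lborel. indicator {t<..} (0 + t * v) *\<^sub>R (complex_of_real ((0 + t * v - t) powr (a - 1)) * D n (0 + t * v))))"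
    unfolding weyl_int_def set_lebesgue_integral_def
    by (subst lborel_integral_real_affine[of t _ 0]) (use t in auto)
  finally have "(t powr \<alpha>) *\<^sub>R weyl_deriv \<alpha> f t = ((- 1) ^ n / Gamma a * (t powr \<alpha> * t)) *\<^sub>R
      (LINT v|lborel. indicator {t<..} (t * v) *\<^sub>R (complex_of_real ((t * v - t) powr (a - 1)) * D n (t * v)))"
    using t by (simp add: scaleR_conv_of_real)
  also have "\<dots> = (LINT v|lborel. ((- 1) ^ n / Gamma a * (t powr \<alpha> * t)) *\<^sub>R
      (indicator {t<..} (t * v) *\<^sub>R (complex_of_real ((t * v - t) powr (a - 1)) * D n (t * v))))"
    by (rule integral_scaleR_right[symmetric])
  also have "\<dots> = weyl_tower \<alpha> D t"
    unfolding weyl_tower_def dil_def set_lebesgue_integral_def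
  proof (intro Bochner_Integration.integral_cong refl)
    fix v :: real
    show "((- 1) ^ n / Gamma a * (t powr \<alpha> * t)) *\<^sub>R (indicator {t<..} (t * v) *\<^sub>R (complex_of_real ((t * v - t) powr (a - 1)) * D n (t * v)))
      = indicator {0<..} v *\<^sub>R weyl_kernel \<alpha> v *\<^sub>R scaled_deriv \<alpha> D (v * t)"
    proof (cases "v > 1")
      case True
      \<comment> \<open>The exponents of \<open>t\<close> add up:
        \<open>\<alpha> + 1 + (a - 1) = n\<close>, because \<open>a = n - \<alpha>\<close>.\<close>
      have e1: "t powr \<alpha> * t * (t * v - t) powr (a - 1) = (v - 1) powr (a - 1) * t ^ n"
      proof -
        have "t * v - t = t * (v - 1)" by (simp add: algebra_simps)
        then have "t powr \<alpha> * t * (t * v - t) powr (a - 1) = (v - 1) powr (a - 1) * (t powr \<alpha> * t powr 1 * t powr (a - 1))"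
          using t True by (simp add: powr_mult)
        also have "t powr \<alpha> * t powr 1 * t powr (a - 1) = t powr real n"
          by (simp only: powr_add[symmetric]) (simp add: a_def)
        finally show ?thesis using t by (simp add: powr_realpow)
      qed
      \<comment> \<open>The factor \<open>v powr - real n\<close> in \<open>weyl_kernel\<close> is
        there to turn the \<open>t ^ n\<close> just found into the \<open>(v * t) ^ n\<close> of
        \<open>scaled_deriv\<close>.\<close>
      have e2: "v powr - real n * (v * t) ^ n = t ^ n"
        using True by (simp add: powr_minus powr_realpow power_mult_distrib)
      have "indicator {t<..} (t * v) = (1::real)" using True t by (simp add: indicator_def)
      then have "((- 1) ^ n / Gamma a * (t powr \<alpha> * t)) *\<^sub>R (indicator {t<..} (t * v) *\<^sub>R (complex_of_real ((t * v - t) powr (a - 1)) * D n (t * v)))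
        = ((- 1) ^ n / Gamma a * (t powr \<alpha> * t * (t * v - t) powr (a - 1))) *\<^sub>R D n (t * v)"
        by (simp add: scaleR_conv_of_real)
      also have "\<dots> = ((- 1) ^ n / Gamma a * ((v - 1) powr (a - 1) * (v powr - real n * (v * t) ^ n))) *\<^sub>R D n (t * v)"
        by (simp only: e1 e2)
      also have "\<dots> = indicator {0<..} v *\<^sub>R weyl_kernel \<alpha> v *\<^sub>R scaled_deriv \<alpha> D (v * t)"
        using True unfolding weyl_kernel_def scaled_deriv_def n_def[symmetric] a_def[symmetric]
        by (simp add: mult.commute[of v t])
      finally show ?thesis .
    next
      case False
      then show ?thesis using t by (auto simp: weyl_kernel_def indicator_def)
    qed
  qed
  finally show ?thesis .
qed

lemma schwartz_norm_eq:
  assumes D: "tower D" and f: "\<And>t. t \<ge> 0 \<Longrightarrow> D 0 t = f t" and \<alpha>: "\<alpha> > 0" and p: "p > 0"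
  shows "schwartz_norm \<alpha> p f = Lp_norm p (weyl_tower \<alpha> D) / Gamma (\<alpha> + 1)"
proof -
  have "(LINT t:{0<..}|lborel. norm (weyl_deriv \<alpha> f t) powr p * t powr (\<alpha> * p)) =
        (LINT t:{0<..}|lborel. norm (weyl_tower \<alpha> D t) powr p)"
  proof (rule set_lebesgue_integral_cong)
    show "\<forall>t. t \<in> {0<..} \<longrightarrow> norm (weyl_deriv \<alpha> f t) powr p * t powr (\<alpha> * p) = norm (weyl_tower \<alpha> D t) powr p"
      using p by (auto simp: weyl_deriv_eq_weyl_tower[OF D f \<alpha>, symmetric] powr_mult powr_powr)
  qed simp
  then show ?thesis by (simp add: schwartz_norm_def Lp_norm_def)
qed

section \<open>Closability\<close>

lemma dvd_pderiv_power:
  fixes r q :: "'a::idom poly"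
  assumes "r ^ Suc k dvd q" shows "r ^ k dvd pderiv q"
proof -
  obtain s where q: "q = r ^ Suc k * s" using assms by blast
  have "pderiv q = r ^ k * (r * pderiv s + s * smult (of_nat (Suc k)) (pderiv r))"
    unfolding q pderiv_mult pderiv_power_Suc by (simp add: algebra_simps)
  then show ?thesis by simp
qed

text \<open>Each derivative in \<open>u\<close> of \<open>D j (u * t)\<close> brings out one factor
  \<open>t\<close>. Since \<open>q\<close> vanishes to order \<open>k\<close> at \<open>b\<close>
  and at 1, no boundary terms arise. With a polynomial weight the vanishing order is a divisibility
  statement, which \<open>pderiv\<close> lowers by one at a time.\<close>

lemma tower_integration_by_parts:
  assumes D: "tower D" and t: "t > 0" and b: "0 < b" "b < 1"
    and q: "([:- b, 1:] * [:1, - 1:]) ^ k dvd q"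
  shows "integral {b..1} (\<lambda>u. poly q u *\<^sub>R t ^ k *\<^sub>R D k (u * t)) =
         (- 1) ^ k *\<^sub>R integral {b..1} (\<lambda>u. poly ((pderiv ^^ k) q) u *\<^sub>R D 0 (u * t))"
  using q
proof (induction k arbitrary: q)
  case 0
  then show ?case by simp
next
  case (Suc k)
  let ?r = "[:- b, 1:] * [:1, - 1:]"
  have cont: "continuous_on {b..1} (\<lambda>u. D j (u * t))" for j
    by (intro continuous_on_compose2[OF tower_continuous_on[OF D]] continuous_intros) (use t b in auto)
  have int: "(\<lambda>u. poly q u *\<^sub>R t ^ i *\<^sub>R D j (u * t)) integrable_on {b..1}" for q i j
    by (intro integrable_continuous_interval continuous_intros cont)
  have root: "poly q x = 0" if "x = b \<or> x = 1" for x
  proof -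
    have "?r dvd q" using Suc.prems dvd_trans[OF dvd_power[of "Suc k" ?r]] by blast
    then have "poly ?r x dvd poly q x" by (auto simp: dvd_def poly_mult simp del: mult_pCons_left mult_pCons_right)
    moreover have "poly ?r x = 0" using that by (auto simp: algebra_simps)
    ultimately show ?thesis by simp
  qed
  have "((\<lambda>u. poly q u *\<^sub>R (t ^ k *\<^sub>R t *\<^sub>R D (Suc k) (u * t)) + poly (pderiv q) u *\<^sub>R (t ^ k *\<^sub>R D k (u * t))) has_integral
        poly q 1 *\<^sub>R (t ^ k *\<^sub>R D k (1 * t)) - poly q b *\<^sub>R (t ^ k *\<^sub>R D k (b * t))) {b..1}"
  proof (rule fundamental_theorem_of_calculus)
    fix u assume u: "u \<in> {b..1}"
    have "(D k has_vector_derivative D (Suc k) (u * t)) (at (u * t) within (\<lambda>u. u * t) ` {b..1})"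
      by (rule has_vector_derivative_within_subset[OF tower_der[OF D]]) (use u t b in auto)
    then have "((D k \<circ> (\<lambda>u. u * t)) has_vector_derivative t *\<^sub>R D (Suc k) (u * t)) (at u within {b..1})"
      by (intro vector_diff_chain_within) (auto intro!: derivative_eq_intros simp flip: has_real_derivative_iff_has_vector_derivative)
    then have "((\<lambda>u. t ^ k *\<^sub>R D k (u * t)) has_vector_derivative t ^ k *\<^sub>R t *\<^sub>R D (Suc k) (u * t)) (at u within {b..1})"
      unfolding comp_def using has_vector_derivative_scaleR[OF DERIV_const[of "t ^ k"]] by fastforce
    then show "((\<lambda>u. poly q u *\<^sub>R (t ^ k *\<^sub>R D k (u * t))) has_vector_derivative
      poly q u *\<^sub>R (t ^ k *\<^sub>R t *\<^sub>R D (Suc k) (u * t)) + poly (pderiv q) u *\<^sub>R (t ^ k *\<^sub>R D k (u * t))) (at u within {b..1})"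
      by (intro has_vector_derivative_scaleR) (auto intro: DERIV_subset[OF poly_DERIV])
  qed (use b in simp)
  then have "((\<lambda>u. poly q u *\<^sub>R t ^ Suc k *\<^sub>R D (Suc k) (u * t) + poly (pderiv q) u *\<^sub>R t ^ k *\<^sub>R D k (u * t)) has_integral 0) {b..1}"
    by (simp add: root mult_ac)
  then have "integral {b..1} (\<lambda>u. poly q u *\<^sub>R t ^ Suc k *\<^sub>R D (Suc k) (u * t) + poly (pderiv q) u *\<^sub>R t ^ k *\<^sub>R D k (u * t)) = 0"
    by (rule integral_unique)
  then have "integral {b..1} (\<lambda>u. poly q u *\<^sub>R t ^ Suc k *\<^sub>R D (Suc k) (u * t)) =
     - integral {b..1} (\<lambda>u. poly (pderiv q) u *\<^sub>R t ^ k *\<^sub>R D k (u * t))"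
    using Henstock_Kurzweil_Integration.integral_add[OF int[of q "Suc k" "Suc k"] int[of "pderiv q" k k]]
    by (simp add: add_eq_0_iff)
  also have "\<dots> = - ((- 1) ^ k *\<^sub>R integral {b..1} (\<lambda>u. poly ((pderiv ^^ k) (pderiv q)) u *\<^sub>R D 0 (u * t)))"
    using Suc.IH[OF dvd_pderiv_power[OF Suc.prems]] by simp
  finally show ?case by (simp add: funpow_swap1)
qed

lemma dil_indicator_eq_integral:
  assumes D: "continuous_on {0..} E" and g: "continuous_on UNIV g" and b: "0 < b" and t: "t > 0"
  shows "dil (\<lambda>u. indicator {b..1} u * g u) E t = integral {b..1} (\<lambda>u. g u *\<^sub>R E (u * t))"
proof -
  have "continuous_on {b..1} (\<lambda>u. E (u * t))"
    by (intro continuous_on_compose2[OF D] continuous_intros) (use t b in auto)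
  then have c: "continuous_on {b..1} (\<lambda>u. g u *\<^sub>R E (u * t))"
    by (intro continuous_intros continuous_on_subset[OF g]) auto
  have "dil (\<lambda>u. indicator {b..1} u * g u) E t = (LINT u:{b..1}|lborel. g u *\<^sub>R E (u * t))"
    unfolding dil_def set_lebesgue_integral_def
    by (intro Bochner_Integration.integral_cong) (use b in \<open>auto simp: indicator_def\<close>)
  also have "\<dots> = integral {b..1} (\<lambda>u. g u *\<^sub>R E (u * t))"
    using c by (intro set_borel_integral_eq_integral(2) borel_integrable_atLeastAtMost')
  finally show ?thesis .
qed

lemma indicator_kernel:
  assumes g: "continuous_on UNIV g" and b: "0 < b"
  shows "(\<lambda>u. indicator {b..1} u * g u) \<in> borel_measurable borel"
    "set_integrable lborel {0<..} (\<lambda>u. indicator {b..1} u * g u)"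
    "dil_kernel p (\<lambda>u. indicator {b..1} u * g u)"
proof -
  note borel_measurable_continuous_onI[OF g, measurable]
  show m: "(\<lambda>u. indicator {b..1} u * g u) \<in> borel_measurable borel" by measurable
  have *: "set_integrable lborel {0<..} (\<lambda>u. indicator {b..1} u * h u)" if "continuous_on {b..1} h" for h :: "real \<Rightarrow> real"
  proof -
    have "set_integrable lborel {b..1} h" using that by (rule borel_integrable_atLeastAtMost')
    then show ?thesis unfolding set_integrable_def
      by (rule Bochner_Integration.integrable_cong[THEN iffD1, rotated 2]) (use b in \<open>auto simp: indicator_def\<close>)
  qed
  show "set_integrable lborel {0<..} (\<lambda>u. indicator {b..1} u * g u)"
    by (rule *[OF continuous_on_subset[OF g]]) simp
  have "set_integrable lborel {0<..} (\<lambda>u. indicator {b..1} u * (g u * u powr (- 1 / p)))"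
    by (intro * continuous_intros continuous_on_subset[OF g]) (use b in auto)
  then show "dil_kernel p (\<lambda>u. indicator {b..1} u * g u)" using m by (simp add: dil_kernel_def mult.assoc)
qed

section \<open>Mollifiers concentrating at \<open>u = 1\<close>\<close>

definition bump_mass :: "nat \<Rightarrow> real \<Rightarrow> real" where
  "bump_mass n b = integral {b..1} (\<lambda>u. ((u - b) * (1 - u)) ^ n)"

text \<open>A probability density on \<open>{b..1}\<close>, approximating the unit mass at 1 as
  \<open>b\<close> tends to 1. The exponent \<open>n\<close> provides zeros of order
  \<open>n\<close> at both ends, which is what \<open>n\<close> integrations by parts
  consume.\<close>

definition bump :: "nat \<Rightarrow> real \<Rightarrow> real \<Rightarrow> real" where
  "bump n b u = indicator {b..1} u * (((u - b) * (1 - u)) ^ n / bump_mass n b)"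

lemma bump_mass_pos:
  assumes "b < 1" shows "bump_mass n b > 0"
proof -
  let ?f = "\<lambda>u::real. ((u - b) * (1 - u)) ^ n"
  have c: "continuous_on (cbox b 1) ?f" by (intro continuous_intros)
  have "integral (cbox b 1) ?f \<ge> 0"
    by (rule integral_nonneg[OF integrable_continuous[OF c]]) auto
  moreover have "integral (cbox b 1) ?f \<noteq> 0"
  proof
    assume "integral (cbox b 1) ?f = 0"
    moreover have "(?f has_integral integral (cbox b 1) ?f) (cbox b 1)"
      using integrable_continuous[OF c] by (rule integrable_integral)
    ultimately have "?f ((b + 1) / 2) = 0"
      using assms by (intro has_integral_0_cbox_imp_0[OF c]) auto
    moreover have "?f ((b + 1) / 2) > 0" using assms by (intro zero_less_power mult_pos_pos) auto
    ultimately show False by (metis less_irrefl)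
  qed
  ultimately show ?thesis unfolding bump_mass_def by simp
qed

lemma continuous_on_bump: "b < 1 \<Longrightarrow> continuous_on UNIV (\<lambda>u::real. ((u - b) * (1 - u)) ^ n / bump_mass n b)"
  using bump_mass_pos[of b n] by (intro continuous_intros) auto

lemma bump_kernel:
  assumes "0 < b" "b < 1"
  shows "bump n b \<in> borel_measurable borel" "set_integrable lborel {0<..} (bump n b)" "dil_kernel p (bump n b)"
  unfolding bump_def[abs_def] using indicator_kernel[OF continuous_on_bump[OF assms(2), of n] assms(1)] by auto

lemma bump_nonneg: "b < 1 \<Longrightarrow> bump n b u \<ge> 0"
  using bump_mass_pos[of b n] by (auto simp: bump_def indicator_def)

lemma bump_integral:
  assumes "0 < b" "b < 1" shows "(LINT u:{0<..}|lborel. bump n b u) = 1"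
proof -
  have "(LINT u:{0<..}|lborel. bump n b u) = (LINT u:{b..1}|lborel. ((u - b) * (1 - u)) ^ n / bump_mass n b)"
    unfolding bump_def set_lebesgue_integral_def
    by (intro Bochner_Integration.integral_cong) (use assms in \<open>auto simp: indicator_def\<close>)
  also have "\<dots> = integral {b..1} (\<lambda>u. ((u - b) * (1 - u)) ^ n / bump_mass n b)"
    by (intro set_borel_integral_eq_integral(2) borel_integrable_atLeastAtMost' continuous_on_subset[OF continuous_on_bump[OF assms(2)]]) auto
  also have "\<dots> = 1" using bump_mass_pos[OF assms(2), of n] by (simp add: bump_mass_def)
  finally show ?thesis .
qed

text \<open>On the support \<open>u \<ge> 1 / 2\<close> the weight is at most
  \<open>2 powr (1 / p) \<le> 2\<close>. The bound does not depend on \<open>b\<close>, so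
  mollification stays stable as \<open>b\<close> tends to 1.\<close>

lemma dil_norm_bump:
  assumes b: "1 / 2 \<le> b" "b < 1" and p: "p > 1" shows "dil_norm p (bump n b) \<le> 2"
proof -
  have b0: "0 < b" using b by simp
  have le: "\<bar>bump n b u\<bar> * u powr (- 1 / p) \<le> 2 * bump n b u" for u
  proof (cases "u \<in> {b..1}")
    case True
    have "u powr (- 1 / p) \<le> (1 / 2) powr (- 1 / p)"
      using True b p by (intro powr_mono2') auto
    also have "\<dots> = 2 powr (1 / p)" by (simp add: powr_minus_divide powr_divide)
    also have "\<dots> \<le> 2 powr 1" using p by (intro powr_mono) auto
    finally show ?thesis using bump_nonneg[OF b(2), of n u] by (simp add: mult.commute[of 2] mult_left_mono)
  qed (simp add: bump_def)
  have "set_integrable lborel {0<..} (\<lambda>u. \<bar>bump n b u * u powr (- 1 / p)\<bar>)"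
    using bump_kernel(3)[OF b0 b(2)] by (auto simp: dil_kernel_def intro: set_integrable_abs)
  then have "dil_norm p (bump n b) \<le> (LINT u:{0<..}|lborel. 2 * bump n b u)"
    unfolding dil_norm_def using le bump_kernel(2)[OF b0 b(2), of n]
    by (intro set_integral_mono) (auto simp: abs_mult)
  then show ?thesis using bump_integral[OF b0 b(2), of n] by simp
qed

text \<open>The point is that one kernel \<open>\<nu>\<close> serves all towers: the mollified
  function is an average of \<open>D 0\<close> itself, with a bound depending on \<open>b\<close>
  but not on \<open>D\<close>.\<close>

lemma bump_scaled_deriv:
  assumes b: "0 < b" "b < 1"
  obtains \<nu> where "dil_kernel p \<nu>"
    "\<And>D t. tower D \<Longrightarrow> t > 0 \<Longrightarrow> dil (bump (weyl_order \<alpha>) b) (scaled_deriv \<alpha> D) t = dil \<nu> (D 0) t"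
proof -
  define n where "n = weyl_order \<alpha>"
  \<comment> \<open>The monomial is the factor \<open>u ^ n\<close> contributed by
    \<open>scaled_deriv\<close> at \<open>u * t\<close>; the other factor \<open>t ^ n\<close> is
    the one used up by integration by parts.\<close>
  define q where "q = smult (1 / bump_mass n b) (([:- b, 1:] * [:1, - 1:]) ^ n * monom 1 n)"
  have dvd: "([:- b, 1:] * [:1, - 1:]) ^ n dvd q" unfolding q_def by (intro dvd_smult dvd_triv_left)
  have q: "poly q u = ((u - b) * (1 - u)) ^ n / bump_mass n b * u ^ n" for u
    by (simp add: q_def poly_monom algebra_simps)
  define g where "g = (\<lambda>u. (- 1) ^ n * poly ((pderiv ^^ n) q) u)"
  have g: "continuous_on UNIV g" unfolding g_def by (intro continuous_intros)
  show thesis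
  proof (rule that)
    show "dil_kernel p (\<lambda>u. indicator {b..1} u * g u)" by (rule indicator_kernel(3)[OF g b(1)])
    fix D t assume D: "tower D" and t: "t > (0::real)"
    have "continuous_on {0..} (scaled_deriv \<alpha> D)"
      unfolding scaled_deriv_def[abs_def] by (intro continuous_intros tower_continuous_on D)
    then have "dil (bump n b) (scaled_deriv \<alpha> D) t =
        integral {b..1} (\<lambda>u. (((u - b) * (1 - u)) ^ n / bump_mass n b) *\<^sub>R scaled_deriv \<alpha> D (u * t))"
      unfolding bump_def[abs_def] by (rule dil_indicator_eq_integral[OF _ continuous_on_bump[OF b(2)] b(1) t])
    also have "\<dots> = integral {b..1} (\<lambda>u. poly q u *\<^sub>R t ^ n *\<^sub>R D n (u * t))"
      unfolding q scaled_deriv_def n_def[symmetric] by (simp add: power_mult_distrib mult_ac)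
    also have "\<dots> = (- 1) ^ n *\<^sub>R integral {b..1} (\<lambda>u. poly ((pderiv ^^ n) q) u *\<^sub>R D 0 (u * t))"
      by (rule tower_integration_by_parts[OF D t b dvd])
    also have "\<dots> = integral {b..1} (\<lambda>u. g u *\<^sub>R D 0 (u * t))"
      unfolding g_def integral_cmul[symmetric] by simp
    also have "\<dots> = dil (\<lambda>u. indicator {b..1} u * g u) (D 0) t"
      by (rule dil_indicator_eq_integral[symmetric, OF tower_continuous_on[OF D] g b(1) t])
    finally show "dil (bump (weyl_order \<alpha>) b) (scaled_deriv \<alpha> D) t = dil (\<lambda>u. indicator {b..1} u * g u) (D 0) t"
      by (simp add: n_def)
  qed
qed

text \<open>The mean value inequality on \<open>{t / 2..t}\<close>, which contains
  \<open>u * t\<close>. The increment \<open>(1 - u) * t\<close> yields the small factor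
  \<open>1 - b\<close> at the price of one power of \<open>t\<close>.\<close>

lemma scaled_deriv_dilation_diff:
  assumes D: "tower D"
  obtains C where "C \<ge> 0" "\<And>b u t. 1 / 2 \<le> b \<Longrightarrow> b \<le> u \<Longrightarrow> u \<le> 1 \<Longrightarrow> t > 0 \<Longrightarrow>
    norm (scaled_deriv \<alpha> D (u * t) - scaled_deriv \<alpha> D t) \<le> (1 - b) * (C / (1 + t) ^ 2)"
proof -
  define n where "n = weyl_order \<alpha>"
  define E' where "E' = (\<lambda>s. s ^ n *\<^sub>R D (Suc n) s + (real n * s ^ (n - 1)) *\<^sub>R D n s)"
  \<comment> \<open>The order \<open>n + 3\<close> splits into \<open>n\<close> powers against
    \<open>s ^ n\<close>, one against the length of the increment, and two for membership in
    L^p.\<close>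
  obtain A where A: "A \<ge> 0" "\<And>t. t \<ge> 0 \<Longrightarrow> norm (D n t) \<le> A / (1 + t) ^ (n + 3)"
    using tower_bound[OF D, of n "n + 3"] by metis
  obtain B where B: "B \<ge> 0" "\<And>t. t \<ge> 0 \<Longrightarrow> norm (D (Suc n) t) \<le> B / (1 + t) ^ (n + 3)"
    using tower_bound[OF D, of "Suc n" "n + 3"] by metis
  define C where "C = B + real n * A"
  have C: "C \<ge> 0" using A B by (simp add: C_def)
  have der: "(scaled_deriv \<alpha> D has_vector_derivative E' s) (at s within {0..})" if "s \<ge> 0" for s
    unfolding scaled_deriv_def[abs_def] E'_def n_def[symmetric]
    by (intro has_vector_derivative_scaleR tower_der[OF D that]) (auto intro!: derivative_eq_intros)
  have bd: "norm (E' s) \<le> C / (1 + s) ^ 3" if s: "s \<ge> 0" for s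
  proof -
    have "norm (E' s) \<le> s ^ n * norm (D (Suc n) s) + (real n * s ^ (n - 1)) * norm (D n s)"
      unfolding E'_def using norm_triangle_ineq[of "s ^ n *\<^sub>R D (Suc n) s" "(real n * s ^ (n - 1)) *\<^sub>R D n s"] s by simp
    also have "\<dots> \<le> (1 + s) ^ n * (B / (1 + s) ^ (n + 3)) + (real n * (1 + s) ^ n) * (A / (1 + s) ^ (n + 3))"
    proof -
      have "s ^ (n - 1) \<le> (1 + s) ^ (n - 1)" using s by (intro power_mono) auto
      also have "\<dots> \<le> (1 + s) ^ n" using s by (intro power_increasing) auto
      finally show ?thesis
        using s A(2)[OF s] B(2)[OF s] by (intro add_mono mult_mono power_mono mult_left_mono mult_nonneg_nonneg) auto
    qed
    also have "\<dots> = C / (1 + s) ^ 3"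
      using s by (simp add: C_def power_add add_divide_distrib)
    finally show ?thesis .
  qed
  \<comment> \<open>The 8 is \<open>2 ^ 3\<close>, from replacing \<open>1 + t / 2\<close> by the
    smaller \<open>(1 + t) / 2\<close> in a cube.\<close>
  have main: "norm (scaled_deriv \<alpha> D (u * t) - scaled_deriv \<alpha> D t) \<le> (1 - b) * (8 * C / (1 + t) ^ 2)"
    if "1 / 2 \<le> b" "b \<le> u" "u \<le> 1" "t > 0" for b u t
  proof -
    have ut: "t / 2 \<le> u * t" "u * t \<le> t" using that mult_right_mono[of "1/2" u t] by auto
    have "norm (scaled_deriv \<alpha> D (u * t) - scaled_deriv \<alpha> D t) \<le> (C / (1 + t / 2) ^ 3) * \<bar>u * t - t\<bar>"
    proof (rule vector_derivative_bound_convex[of "{t / 2..t}"])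
      fix x assume x: "x \<in> {t / 2..t}"
      show "(scaled_deriv \<alpha> D has_vector_derivative E' x) (at x within {t / 2..t})"
        by (rule has_vector_derivative_within_subset[OF der]) (use x that in auto)
      have "norm (E' x) \<le> C / (1 + x) ^ 3" using x that by (intro bd) auto
      also have "\<dots> \<le> C / (1 + t / 2) ^ 3"
        using x that C by (intro divide_left_mono power_mono mult_pos_pos zero_less_power) auto
      finally show "norm (E' x) \<le> C / (1 + t / 2) ^ 3" .
    qed (use ut that in auto)
    also have "\<bar>u * t - t\<bar> = (1 - u) * t" using ut by (simp add: algebra_simps)
    also have "(C / (1 + t / 2) ^ 3) * ((1 - u) * t) \<le> (8 * C / (1 + t) ^ 3) * ((1 - b) * (1 + t))"
    proof (intro mult_mono)
      have "((1 + t) / 2) ^ 3 \<le> (1 + t / 2) ^ 3" using that by (intro power_mono) auto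
      then have "C / (1 + t / 2) ^ 3 \<le> C / ((1 + t) / 2) ^ 3"
        using that C by (intro divide_left_mono mult_pos_pos zero_less_power) auto
      also have "\<dots> = 8 * C / (1 + t) ^ 3" by (simp add: power_divide)
      finally show "C / (1 + t / 2) ^ 3 \<le> 8 * C / (1 + t) ^ 3" .
    qed (use that C in auto)
    also have "\<dots> = (1 - b) * (8 * C / (1 + t) ^ 2)"
      using that by (simp add: power3_eq_cube power2_eq_square)
    finally show ?thesis .
  qed
  show thesis by (rule that[of "8 * C"]) (use C main in auto)
qed

text \<open>The bump has mass 1, so the error of mollification is an average of the differences
  \<open>?E (u * t) - ?E t\<close>. Commutation allows the estimate to be made on
  \<open>scaled_deriv\<close>, where a derivative is at hand; the bounded Weyl average then
  transports it. The constant is uniform in \<open>b\<close> and \<open>n\<close>.\<close>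

lemma bump_approx:
  assumes D: "tower D" and \<alpha>: "\<alpha> > 0" and p: "p > 1"
  obtains A where "A \<ge> 0" "\<And>b n. 1 / 2 \<le> b \<Longrightarrow> b < 1 \<Longrightarrow>
    Lp_norm p (\<lambda>t. dil (bump n b) (weyl_tower \<alpha> D) t - weyl_tower \<alpha> D t) \<le> (1 - b) * A"
proof -
  let ?E = "scaled_deriv \<alpha> D" and ?w = "weyl_kernel \<alpha>"
  obtain C where C: "C \<ge> 0" "\<And>b u t. 1 / 2 \<le> b \<Longrightarrow> b \<le> u \<Longrightarrow> u \<le> 1 \<Longrightarrow> t > 0 \<Longrightarrow>
    norm (?E (u * t) - ?E t) \<le> (1 - b) * (C / (1 + t) ^ 2)"
    using scaled_deriv_dilation_diff[OF D] by metis
  obtain C' where C': "\<And>t. t > 0 \<Longrightarrow> norm (?E t) \<le> C'" using scaled_deriv_bound[OF D] by metis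
  define G where "G = (\<lambda>t::real. complex_of_real (C / (1 + t) ^ 2))"
  have G: "G \<in> Lp_plus p"
    by (rule Lp_plus_decay[OF p, where C=C]) (use C in \<open>auto simp: G_def norm_divide norm_power simp del: of_real_divide of_real_add\<close>)
  have E: "?E \<in> Lp_plus p" by (rule scaled_deriv_Lp[OF D p])
  define A where "A = dil_norm p ?w * Lp_norm p G"
  have "A \<ge> 0" by (simp add: A_def dil_norm_nonneg)
  moreover have "Lp_norm p (\<lambda>t. dil (bump n b) (weyl_tower \<alpha> D) t - weyl_tower \<alpha> D t) \<le> (1 - b) * A"
    if b: "1 / 2 \<le> b" "b < 1" for b n
  proof -
    have b0: "0 < b" using b by simp
    have "norm (dil (bump n b) ?E t - ?E t) \<le> norm ((1 - b) *\<^sub>R G t)" if t: "t > 0" for t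
    proof -
      have i1: "set_integrable lborel {0<..} (\<lambda>u. bump n b u *\<^sub>R ?E (u * t))"
        by (rule dil_integrable_bounded[OF bump_kernel(1,2)[OF b0 b(2)] scaled_deriv_measurable[OF D] C' t]) auto
      have i2: "set_integrable lborel {0<..} (\<lambda>u. bump n b u *\<^sub>R ?E t)"
        using bump_kernel(2)[OF b0 b(2)] by (rule set_integrable_scaleR_left[rotated])
      have "?E t = (LINT u:{0<..}|lborel. bump n b u *\<^sub>R ?E t)"
        using integral_scaleR_left[of "?E t" lborel "\<lambda>u. indicator {0<..} u *\<^sub>R bump n b u"]
          bump_kernel(2)[OF b0 b(2), of n] bump_integral[OF b0 b(2), of n]
        by (simp add: set_integrable_def set_lebesgue_integral_def)
      then have "dil (bump n b) ?E t - ?E t = (LINT u:{0<..}|lborel. bump n b u *\<^sub>R (?E (u * t) - ?E t))"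
        unfolding dil_def using set_integral_diff(2)[OF i1 i2] by (simp add: scaleR_diff_right)
      also have "norm \<dots> \<le> (LINT u:{0<..}|lborel. bump n b u * ((1 - b) * (C / (1 + t) ^ 2)))"
        unfolding set_lebesgue_integral_def
      proof (rule Bochner_Integration.integral_norm_bound_integral)
        show "integrable lborel (\<lambda>u. indicator {0<..} u *\<^sub>R bump n b u *\<^sub>R (?E (u * t) - ?E t))"
          using set_integral_diff(1)[OF i1 i2] by (simp add: set_integrable_def scaleR_diff_right)
        show "integrable lborel (\<lambda>u. indicator {0<..} u *\<^sub>R (bump n b u * ((1 - b) * (C / (1 + t) ^ 2))))"
          using bump_kernel(2)[OF b0 b(2), of n] set_integrable_mult_left[of "(1 - b) * (C / (1 + t) ^ 2)" lborel "{0<..}" "bump n b"]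
          by (simp add: set_integrable_def)
        fix u :: real
        show "norm (indicator {0<..} u *\<^sub>R bump n b u *\<^sub>R (?E (u * t) - ?E t)) \<le> indicator {0<..} u *\<^sub>R (bump n b u * ((1 - b) * (C / (1 + t) ^ 2)))"
        proof (cases "u \<in> {b..1}")
          case True
          then have "bump n b u * norm (?E (u * t) - ?E t) \<le> bump n b u * ((1 - b) * (C / (1 + t) ^ 2))"
            using b bump_nonneg[OF b(2), of n u] C(2)[OF b(1), of u t] t by (intro mult_left_mono) auto
          then show ?thesis using True b0 bump_nonneg[OF b(2), of n u] by simp
        qed (simp add: bump_def)
      qed
      also have "\<dots> = norm ((1 - b) *\<^sub>R G t)"
        using bump_integral[OF b0 b(2)] C b by (simp add: G_def norm_divide norm_power del: of_real_divide)
      finally show ?thesis .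
    qed
    moreover have dE: "dil (bump n b) ?E \<in> Lp_plus p" by (rule Lp_plus_dil[OF p E bump_kernel(3)[OF b0 b(2)]])
    moreover have "(\<lambda>t. (1 - b) *\<^sub>R G t) \<in> Lp_plus p"
      using G by (auto simp: Lp_plus_iff powr_mult abs_mult mult.left_commute[of _ "\<bar>1 - b\<bar> powr p"] scaleR_left_commute[of _ "1 - b"] simp del: scaleR_scaleR)
    ultimately have "Lp_norm p (\<lambda>t. dil (bump n b) ?E t - ?E t) \<le> Lp_norm p (\<lambda>t. (1 - b) *\<^sub>R G t)"
      using Lp_plus_diff[OF dE E p] p by (intro Lp_bound(2)) (auto simp: Lp_plus_iff)
    also have "\<dots> = (1 - b) * Lp_norm p G" using p b by (intro Lp_norm_cmult) auto
    finally have 1: "Lp_norm p (\<lambda>t. dil (bump n b) ?E t - ?E t) \<le> (1 - b) * Lp_norm p G" .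
    have "dil (bump n b) (weyl_tower \<alpha> D) t = dil ?w (dil (bump n b) ?E) t" if t: "t > 0" for t
      unfolding weyl_tower_def
      by (rule dil_commute[OF bump_kernel(1)[OF b0 b(2)] weyl_kernel_measurable bump_kernel(2)[OF b0 b(2)]
            weyl_kernel_integrable[OF \<alpha>] scaled_deriv_measurable[OF D] C' t]) auto
    then have "Lp_norm p (\<lambda>t. dil (bump n b) (weyl_tower \<alpha> D) t - weyl_tower \<alpha> D t) =
       Lp_norm p (\<lambda>t. dil ?w (dil (bump n b) ?E) t - dil ?w ?E t)"
      by (intro Lp_norm_cong) (simp add: weyl_tower_def)
    also have "\<dots> \<le> dil_norm p ?w * Lp_norm p (\<lambda>t. dil (bump n b) ?E t - ?E t)"
      using \<alpha> p by (intro Lp_norm_dil_diff_le dE E dil_kernel_weyl) auto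
    also have "\<dots> \<le> dil_norm p ?w * ((1 - b) * Lp_norm p G)"
      using 1 dil_norm_nonneg by (rule mult_left_mono)
    finally show ?thesis by (simp add: A_def mult_ac)
  qed
  ultimately show thesis by (rule that)
qed

text \<open>The embedding of the completion into \<open>L\<^sup>p\<close> is injective. The mollifier \<open>dil (bump n b)\<close>
  commutes with \<open>t\<^sup>\<alpha> W\<^sup>\<alpha>\<close>, and integration by parts moves all derivatives onto the bump, so that the
  mollified functions are controlled by the \<open>L\<^sup>p\<close> norm alone.\<close>

lemma weyl_tower_closable:
  assumes D: "\<And>k. tower (D k)" and \<alpha>: "\<alpha> > 0" and p: "p > 1"
    and lim: "(\<lambda>k. Lp_norm p (D k 0)) \<longlonglongrightarrow> 0"
    and cauchy: "\<And>e. e > 0 \<Longrightarrow> \<exists>N. \<forall>m\<ge>N. \<forall>n\<ge>N. Lp_norm p (\<lambda>t. weyl_tower \<alpha> (D m) t - weyl_tower \<alpha> (D n) t) < e"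
  shows "(\<lambda>k. Lp_norm p (weyl_tower \<alpha> (D k))) \<longlonglongrightarrow> 0"
proof (rule LIMSEQ_I)
  fix r :: real assume r: "r > 0"
  define e where "e = r / 3"
  have e: "e > 0" using r by (simp add: e_def)
  obtain N where N: "\<And>m n. m \<ge> N \<Longrightarrow> n \<ge> N \<Longrightarrow> Lp_norm p (\<lambda>t. weyl_tower \<alpha> (D m) t - weyl_tower \<alpha> (D n) t) < e"
    using cauchy[OF e] by blast
  let ?h = "\<lambda>k. weyl_tower \<alpha> (D k)"
  have h: "?h k \<in> Lp_plus p" for k by (rule weyl_tower_Lp[OF D p \<alpha>])
  \<comment> \<open>The 2 is the uniform bound on \<open>dil_norm p (bump n b)\<close>, applied to
    the Cauchy difference of \<open>?h m\<close> and \<open>?h k\<close>.\<close>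
  have "Lp_norm p (?h m) \<le> 2 * e" if m: "m \<ge> N" for m
  proof -
    obtain A where A: "A \<ge> 0" "\<And>b n. 1 / 2 \<le> b \<Longrightarrow> b < 1 \<Longrightarrow> Lp_norm p (\<lambda>t. dil (bump n b) (?h m) t - ?h m t) \<le> (1 - b) * A"
      using bump_approx[OF D \<alpha> p] by metis
    \<comment> \<open>The order of limits matters: with \<open>b\<close> fixed, \<open>k\<close>
      goes to infinity and removes the term with \<open>?C\<close>, which depends on
      \<open>b\<close>; only afterwards does \<open>b\<close> tend to 1.\<close>
    have est: "Lp_norm p (?h m) \<le> (1 - b) * A + 2 * e" if b: "1 / 2 \<le> b" "b < 1" for b
    proof -
      have b0: "0 < b" using b by simp
      let ?B = "dil (bump (weyl_order \<alpha>) b)"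
      have ker: "dil_kernel p (bump (weyl_order \<alpha>) b)" by (rule bump_kernel(3)[OF b0 b(2)])
      obtain \<nu> where \<nu>: "dil_kernel p \<nu>"
        "\<And>D t. tower D \<Longrightarrow> t > 0 \<Longrightarrow> ?B (scaled_deriv \<alpha> D) t = dil \<nu> (D 0) t"
        using bump_scaled_deriv[OF b0 b(2)] by metis
      let ?C = "dil_norm p (weyl_kernel \<alpha>) * dil_norm p \<nu>"
      have Bh: "Lp_norm p (?B (?h k)) \<le> ?C * Lp_norm p (D k 0)" for k
      proof -
        obtain C' where C': "\<And>t. t > 0 \<Longrightarrow> norm (scaled_deriv \<alpha> (D k) t) \<le> C'" using scaled_deriv_bound[OF D] by metis
        have "?B (?h k) t = dil (weyl_kernel \<alpha>) (dil \<nu> (D k 0)) t" if t: "t > 0" for t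
        proof -
          have "?B (?h k) t = dil (weyl_kernel \<alpha>) (?B (scaled_deriv \<alpha> (D k))) t"
            unfolding weyl_tower_def
            by (rule dil_commute[OF bump_kernel(1)[OF b0 b(2)] weyl_kernel_measurable bump_kernel(2)[OF b0 b(2)]
                 weyl_kernel_integrable[OF \<alpha>] scaled_deriv_measurable[OF D] C' t]) auto
          also have "\<dots> = dil (weyl_kernel \<alpha>) (dil \<nu> (D k 0)) t"
            by (rule dil_cong[OF t \<nu>(2)[OF D]])
          finally show ?thesis .
        qed
        then have "Lp_norm p (?B (?h k)) = Lp_norm p (dil (weyl_kernel \<alpha>) (dil \<nu> (D k 0)))"
          by (intro Lp_norm_cong) simp
        also have "\<dots> \<le> dil_norm p (weyl_kernel \<alpha>) * Lp_norm p (dil \<nu> (D k 0))"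
          using \<alpha> p by (intro Lp_norm_dil_le Lp_plus_dil tower_Lp D \<nu> dil_kernel_weyl) auto
        also have "\<dots> \<le> dil_norm p (weyl_kernel \<alpha>) * (dil_norm p \<nu> * Lp_norm p (D k 0))"
          using p by (intro mult_left_mono dil_norm_nonneg Lp_norm_dil_le tower_Lp D \<nu>) auto
        finally show ?thesis by (simp add: mult.assoc)
      qed
      have "Lp_norm p (?h m) \<le> (1 - b) * A + 2 * e + ?C * Lp_norm p (D k 0)" if k: "k \<ge> N" for k
      proof -
        have Bm: "?B (?h m) \<in> Lp_plus p" and Bk: "?B (?h k) \<in> Lp_plus p" using p h ker by (auto intro: Lp_plus_dil)
        have "Lp_norm p (?h m) \<le> Lp_norm p (?B (?h m)) + Lp_norm p (\<lambda>t. ?h m t - ?B (?h m) t)"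
          by (rule Lp_norm_le_diff[OF h Bm p])
        also have "Lp_norm p (\<lambda>t. ?h m t - ?B (?h m) t) \<le> (1 - b) * A"
          using A(2)[OF b] by (simp add: Lp_norm_minus_commute[of p "?h m"])
        also have "Lp_norm p (?B (?h m)) \<le> Lp_norm p (?B (?h k)) + Lp_norm p (\<lambda>t. ?B (?h m) t - ?B (?h k) t)"
          by (rule Lp_norm_le_diff[OF Bm Bk p])
        also have "Lp_norm p (\<lambda>t. ?B (?h m) t - ?B (?h k) t) \<le> dil_norm p (bump (weyl_order \<alpha>) b) * Lp_norm p (\<lambda>t. ?h m t - ?h k t)"
          by (rule Lp_norm_dil_diff_le[OF p h h ker])
        also have "\<dots> \<le> 2 * e"
          using dil_norm_bump[OF b p, of "weyl_order \<alpha>"] N[OF m k] by (intro mult_mono) auto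
        also have "Lp_norm p (?B (?h k)) \<le> ?C * Lp_norm p (D k 0)" by (rule Bh)
        finally show ?thesis by simp
      qed
      moreover have "(\<lambda>k. (1 - b) * A + 2 * e + ?C * Lp_norm p (D k 0)) \<longlonglongrightarrow> (1 - b) * A + 2 * e + ?C * 0"
        by (intro tendsto_intros lim)
      ultimately show ?thesis
        by (intro LIMSEQ_le_const[of _ "(1 - b) * A + 2 * e"]) auto
    qed
    have "((\<lambda>b. (1 - b) * A + 2 * e) \<longlongrightarrow> (1 - 1) * A + 2 * e) (at_left 1)"
      by (intro tendsto_intros)
    moreover have "\<forall>\<^sub>F b in at_left 1. Lp_norm p (?h m) \<le> (1 - b) * A + 2 * e"
      unfolding eventually_at_left_field by (intro exI[of _ "1/2"]) (use est in auto)
    ultimately show ?thesis by (auto intro: tendsto_lowerbound)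
  qed
  then show "\<exists>no. \<forall>n\<ge>no. norm (Lp_norm p (?h n) - 0) < r"
    using r by (intro exI[of _ N]) (force simp: e_def)
qed

section \<open>The completed spaces\<close>

text \<open>The counterpart of \<open>approx_seq\<close> for towers, with the Cauchy condition
  expressed in L^p through the representatives.\<close>

definition approx_tower :: "real \<Rightarrow> real \<Rightarrow> (real \<Rightarrow> complex) \<Rightarrow> (nat \<Rightarrow> nat \<Rightarrow> real \<Rightarrow> complex) \<Rightarrow> bool" where
  "approx_tower \<alpha> p f D \<longleftrightarrow> (\<forall>n. tower (D n)) \<and>
     (\<forall>e>0. \<exists>N. \<forall>m\<ge>N. \<forall>n\<ge>N. Lp_norm p (\<lambda>t. weyl_tower \<alpha> (D m) t - weyl_tower \<alpha> (D n) t) < e) \<and>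
     (\<lambda>n. Lp_norm p (\<lambda>t. D n 0 t - f t)) \<longlonglongrightarrow> 0"

lemma schwartz_norm_diff:
  assumes "tower D" "tower F" "\<And>t. t \<ge> 0 \<Longrightarrow> D 0 t = f t" "\<And>t. t \<ge> 0 \<Longrightarrow> F 0 t = g t" "\<alpha> > 0" "p > 0"
  shows "schwartz_norm \<alpha> p (\<lambda>t. f t - g t) = Lp_norm p (\<lambda>t. weyl_tower \<alpha> D t - weyl_tower \<alpha> F t) / Gamma (\<alpha> + 1)"
proof -
  have "schwartz_norm \<alpha> p (\<lambda>t. f t - g t) = Lp_norm p (weyl_tower \<alpha> (\<lambda>n t. D n t - F n t)) / Gamma (\<alpha> + 1)"
    by (rule schwartz_norm_eq[OF tower_diff[OF assms(1,2)] _ assms(5,6)]) (simp add: assms)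
  also have "Lp_norm p (weyl_tower \<alpha> (\<lambda>n t. D n t - F n t)) = Lp_norm p (\<lambda>t. weyl_tower \<alpha> D t - weyl_tower \<alpha> F t)"
    by (rule Lp_norm_cong) (simp add: weyl_tower_diff assms)
  finally show ?thesis .
qed

lemma approx_seq_imp_tower:
  assumes \<phi>: "approx_seq \<alpha> p f \<phi>" and \<alpha>: "\<alpha> > 0" and p: "p > 1"
  obtains D where "approx_tower \<alpha> p f D" "\<And>n. schwartz_norm \<alpha> p (\<phi> n) = Lp_norm p (weyl_tower \<alpha> (D n)) / Gamma (\<alpha> + 1)"
proof -
  have G: "Gamma (\<alpha> + 1) > 0" using \<alpha> by (intro Gamma_real_pos) auto
  have "\<forall>n. \<exists>D. tower D \<and> (\<forall>t\<ge>0. D 0 t = \<phi> n t)"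
    using \<phi> by (simp add: approx_seq_def schwartz_plus_iff)
  then obtain D where D: "\<And>n. tower (D n)" "\<And>n t. t \<ge> 0 \<Longrightarrow> D n 0 t = \<phi> n t" by metis
  have eq: "schwartz_norm \<alpha> p (\<lambda>t. \<phi> m t - \<phi> n t) = Lp_norm p (\<lambda>t. weyl_tower \<alpha> (D m) t - weyl_tower \<alpha> (D n) t) / Gamma (\<alpha> + 1)" for m n
    using schwartz_norm_diff[OF D(1) D(1) D(2) D(2) \<alpha>] p by simp
  have "\<exists>N. \<forall>m\<ge>N. \<forall>n\<ge>N. Lp_norm p (\<lambda>t. weyl_tower \<alpha> (D m) t - weyl_tower \<alpha> (D n) t) < e" if "e > 0" for e
  proof -
    have "e / Gamma (\<alpha> + 1) > 0" using that G by simp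
    then obtain N where "\<forall>m\<ge>N. \<forall>n\<ge>N. schwartz_norm \<alpha> p (\<lambda>t. \<phi> m t - \<phi> n t) < e / Gamma (\<alpha> + 1)"
      using \<phi> unfolding approx_seq_def by meson
    then show ?thesis using G unfolding eq by (auto simp: divide_less_cancel)
  qed
  moreover have "(\<lambda>n. Lp_norm p (\<lambda>t. D n 0 t - f t)) = (\<lambda>n. Lp_norm p (\<lambda>t. \<phi> n t - f t))"
    by (intro ext Lp_norm_cong) (simp add: D)
  ultimately have "approx_tower \<alpha> p f D" using D \<phi> by (simp add: approx_tower_def approx_seq_def)
  moreover have "schwartz_norm \<alpha> p (\<phi> n) = Lp_norm p (weyl_tower \<alpha> (D n)) / Gamma (\<alpha> + 1)" for n
    using schwartz_norm_eq[OF D(1) D(2) \<alpha>] p by simp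
  ultimately show thesis by (rule that)
qed

lemma approx_tower_imp_seq:
  assumes D: "approx_tower \<alpha> p f D" and \<alpha>: "\<alpha> > 0" and p: "p > 1"
  shows "approx_seq \<alpha> p f (\<lambda>n. D n 0)"
    "schwartz_norm \<alpha> p (D n 0) = Lp_norm p (weyl_tower \<alpha> (D n)) / Gamma (\<alpha> + 1)"
proof -
  have G: "Gamma (\<alpha> + 1) > 0" using \<alpha> by (intro Gamma_real_pos) auto
  have T: "tower (D n)" for n using D by (simp add: approx_tower_def)
  show "schwartz_norm \<alpha> p (D n 0) = Lp_norm p (weyl_tower \<alpha> (D n)) / Gamma (\<alpha> + 1)"
    using schwartz_norm_eq[OF T refl \<alpha>] p by simp
  have eq: "schwartz_norm \<alpha> p (\<lambda>t. D m 0 t - D n 0 t) = Lp_norm p (\<lambda>t. weyl_tower \<alpha> (D m) t - weyl_tower \<alpha> (D n) t) / Gamma (\<alpha> + 1)" for m n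
    using schwartz_norm_diff[OF T T refl refl \<alpha>] p by simp
  have "\<exists>N. \<forall>m\<ge>N. \<forall>n\<ge>N. schwartz_norm \<alpha> p (\<lambda>t. D m 0 t - D n 0 t) < e" if "e > 0" for e
  proof -
    have "e * Gamma (\<alpha> + 1) > 0" using that G by simp
    then obtain N where "\<forall>m\<ge>N. \<forall>n\<ge>N. Lp_norm p (\<lambda>t. weyl_tower \<alpha> (D m) t - weyl_tower \<alpha> (D n) t) < e * Gamma (\<alpha> + 1)"
      using D unfolding approx_tower_def by meson
    then show ?thesis using G unfolding eq by (auto simp: pos_divide_less_eq)
  qed
  moreover have "D n 0 \<in> schwartz_plus" for n using T by (auto simp: schwartz_plus_iff)
  ultimately show "approx_seq \<alpha> p f (\<lambda>n. D n 0)" using D by (simp add: approx_seq_def approx_tower_def)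
qed

lemma Tspace_iff:
  assumes "\<alpha> > 0" "p > 1"
  shows "f \<in> Tspace \<alpha> p \<longleftrightarrow> f \<in> Lp_plus p \<and> (\<exists>D. approx_tower \<alpha> p f D)"
  using assms approx_seq_imp_tower[of \<alpha> p f] approx_tower_imp_seq(1)[of \<alpha> p f]
  by (auto simp: Tspace_def) meson+

lemma approx_tower_convergent:
  assumes D: "approx_tower \<alpha> p f D" and \<alpha>: "\<alpha> > 0" and p: "p > 1"
  shows "convergent (\<lambda>n. Lp_norm p (weyl_tower \<alpha> (D n)))"
proof -
  have h: "weyl_tower \<alpha> (D n) \<in> Lp_plus p" for n using D p \<alpha> by (intro weyl_tower_Lp) (auto simp: approx_tower_def)
  have le: "norm (Lp_norm p (weyl_tower \<alpha> (D m)) - Lp_norm p (weyl_tower \<alpha> (D n))) \<le>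
      Lp_norm p (\<lambda>t. weyl_tower \<alpha> (D m) t - weyl_tower \<alpha> (D n) t)" for m n
    using Lp_norm_le_diff[OF h h p, of m n] Lp_norm_le_diff[OF h h p, of n m]
      Lp_norm_minus_commute[of p "weyl_tower \<alpha> (D m)" "weyl_tower \<alpha> (D n)"] by auto
  have "Cauchy (\<lambda>n. Lp_norm p (weyl_tower \<alpha> (D n)))"
  proof (rule CauchyI)
    fix e :: real assume "e > 0"
    then obtain N where "\<forall>m\<ge>N. \<forall>n\<ge>N. Lp_norm p (\<lambda>t. weyl_tower \<alpha> (D m) t - weyl_tower \<alpha> (D n) t) < e"
      using D unfolding approx_tower_def by meson
    then show "\<exists>M. \<forall>m\<ge>M. \<forall>n\<ge>M. norm (Lp_norm p (weyl_tower \<alpha> (D m)) - Lp_norm p (weyl_tower \<alpha> (D n))) < e"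
      using le by (meson le_less_trans)
  qed
  then show ?thesis by (rule Cauchy_convergent)
qed

text \<open>The difference of two approximating families is Cauchy and tends to 0 in L^p, so by
  closability its representatives tend to 0 in norm.\<close>

lemma approx_tower_unique:
  assumes D: "approx_tower \<alpha> p f D" and F: "approx_tower \<alpha> p f F" and f: "f \<in> Lp_plus p"
    and \<alpha>: "\<alpha> > 0" and p: "p > 1"
    and L: "(\<lambda>n. Lp_norm p (weyl_tower \<alpha> (D n))) \<longlonglongrightarrow> L" and L': "(\<lambda>n. Lp_norm p (weyl_tower \<alpha> (F n))) \<longlonglongrightarrow> L'"
  shows "L = L'"
proof -
  have TD: "tower (D n)" and TF: "tower (F n)" for n using D F by (auto simp: approx_tower_def)
  define X where "X = (\<lambda>k n t. D k n t - F k n t)"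
  let ?hD = "\<lambda>k. weyl_tower \<alpha> (D k)" and ?hF = "\<lambda>k. weyl_tower \<alpha> (F k)"
  have hD: "?hD k \<in> Lp_plus p" and hF: "?hF k \<in> Lp_plus p" for k using TD TF p \<alpha> by (auto intro: weyl_tower_Lp)
  have X: "tower (X k)" for k unfolding X_def using TD TF by (rule tower_diff)
  have hX: "weyl_tower \<alpha> (X k) t = ?hD k t - ?hF k t" if "t > 0" for k t
    unfolding X_def by (rule weyl_tower_diff[OF TD TF \<alpha> that])
  have lim: "(\<lambda>k. Lp_norm p (X k 0)) \<longlonglongrightarrow> 0"
  proof (rule tendsto_sandwich[OF _ _ tendsto_const])
    show "(\<lambda>k. Lp_norm p (\<lambda>t. D k 0 t - f t) + Lp_norm p (\<lambda>t. F k 0 t - f t)) \<longlonglongrightarrow> 0"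
      using D F unfolding approx_tower_def by (auto intro!: tendsto_eq_intros)
    have "Lp_norm p (X k 0) \<le> Lp_norm p (\<lambda>t. D k 0 t - f t) + Lp_norm p (\<lambda>t. F k 0 t - f t)" for k
      using Lp_norm_diff_triangle[OF tower_Lp[OF TD p] f tower_Lp[OF TF p] p, of k 0 k 0]
      by (simp add: X_def Lp_norm_minus_commute[of p f])
    then show "\<forall>\<^sub>F k in sequentially. Lp_norm p (X k 0) \<le> Lp_norm p (\<lambda>t. D k 0 t - f t) + Lp_norm p (\<lambda>t. F k 0 t - f t)"
      by simp
  qed simp
  have cauchy: "\<exists>N. \<forall>m\<ge>N. \<forall>n\<ge>N. Lp_norm p (\<lambda>t. weyl_tower \<alpha> (X m) t - weyl_tower \<alpha> (X n) t) < e" if "e > 0" for e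
  proof -
    have "e / 2 > 0" using that by simp
    then obtain N1 N2 where N: "\<forall>m\<ge>N1. \<forall>n\<ge>N1. Lp_norm p (\<lambda>t. ?hD m t - ?hD n t) < e / 2"
        "\<forall>m\<ge>N2. \<forall>n\<ge>N2. Lp_norm p (\<lambda>t. ?hF m t - ?hF n t) < e / 2"
      using D F unfolding approx_tower_def by meson
    have "Lp_norm p (\<lambda>t. weyl_tower \<alpha> (X m) t - weyl_tower \<alpha> (X n) t) < e" if "m \<ge> max N1 N2" "n \<ge> max N1 N2" for m n
    proof -
      have "Lp_norm p (\<lambda>t. weyl_tower \<alpha> (X m) t - weyl_tower \<alpha> (X n) t) =
            Lp_norm p (\<lambda>t. (?hD m t - ?hD n t) + (?hF n t - ?hF m t))"
        by (rule Lp_norm_cong) (simp add: hX algebra_simps)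
      also have "\<dots> \<le> Lp_norm p (\<lambda>t. ?hD m t - ?hD n t) + Lp_norm p (\<lambda>t. ?hF n t - ?hF m t)"
        by (intro Lp_norm_triangle Lp_plus_diff hD hF p)
      also have "\<dots> < e / 2 + e / 2" using N that by (intro add_strict_mono) auto
      finally show ?thesis by simp
    qed
    then show ?thesis by blast
  qed
  have "(\<lambda>k. Lp_norm p (weyl_tower \<alpha> (X k))) \<longlonglongrightarrow> 0"
    by (rule weyl_tower_closable[OF X \<alpha> p lim cauchy])
  then have lim0: "(\<lambda>k. Lp_norm p (\<lambda>t. ?hD k t - ?hF k t)) \<longlonglongrightarrow> 0"
    by (rule Lim_transform_eventually) (auto intro!: eventuallyI Lp_norm_cong simp: hX)
  have "(\<lambda>k. Lp_norm p (?hD k) - Lp_norm p (?hF k)) \<longlonglongrightarrow> 0"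
  proof (rule Lim_null_comparison[OF _ lim0])
    have "norm (Lp_norm p (?hD k) - Lp_norm p (?hF k)) \<le> Lp_norm p (\<lambda>t. ?hD k t - ?hF k t)" for k
      using Lp_norm_le_diff[OF hD hF p, of k k] Lp_norm_le_diff[OF hF hD p, of k k]
        Lp_norm_minus_commute[of p "?hD k" "?hF k"] by auto
    then show "\<forall>\<^sub>F k in sequentially. norm (Lp_norm p (?hD k) - Lp_norm p (?hF k)) \<le> Lp_norm p (\<lambda>t. ?hD k t - ?hF k t)"
      by simp
  qed
  moreover have "(\<lambda>k. Lp_norm p (?hD k) - Lp_norm p (?hF k)) \<longlonglongrightarrow> L - L'"
    by (intro tendsto_diff L L')
  ultimately show ?thesis using LIMSEQ_unique by fastforce
qed

text \<open>Uniqueness of the limit makes the choice in \<open>Tnorm\<close> determinate, and the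
  norm can be computed along any approximating family.\<close>

lemma Tnorm_eq:
  assumes D: "approx_tower \<alpha> p f D" and f: "f \<in> Lp_plus p" and \<alpha>: "\<alpha> > 0" and p: "p > 1"
    and L: "(\<lambda>n. Lp_norm p (weyl_tower \<alpha> (D n))) \<longlonglongrightarrow> L"
  shows "Tnorm \<alpha> p f = L / Gamma (\<alpha> + 1)"
proof -
  have G: "Gamma (\<alpha> + 1) > 0" using \<alpha> by (intro Gamma_real_pos) auto
  have "(SOME L. \<exists>\<phi>. approx_seq \<alpha> p f \<phi> \<and> (\<lambda>n. schwartz_norm \<alpha> p (\<phi> n)) \<longlonglongrightarrow> L) = L / Gamma (\<alpha> + 1)"
  proof (rule some_equality)
    show "\<exists>\<phi>. approx_seq \<alpha> p f \<phi> \<and> (\<lambda>n. schwartz_norm \<alpha> p (\<phi> n)) \<longlonglongrightarrow> L / Gamma (\<alpha> + 1)"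
      using approx_tower_imp_seq[OF D \<alpha> p] G
      by (intro exI[of _ "\<lambda>n. D n 0"]) (auto intro!: tendsto_intros L)
    fix L' assume "\<exists>\<phi>. approx_seq \<alpha> p f \<phi> \<and> (\<lambda>n. schwartz_norm \<alpha> p (\<phi> n)) \<longlonglongrightarrow> L'"
    then obtain \<phi> where \<phi>: "approx_seq \<alpha> p f \<phi>" "(\<lambda>n. schwartz_norm \<alpha> p (\<phi> n)) \<longlonglongrightarrow> L'" by blast
    obtain F where F: "approx_tower \<alpha> p f F" "\<And>n. schwartz_norm \<alpha> p (\<phi> n) = Lp_norm p (weyl_tower \<alpha> (F n)) / Gamma (\<alpha> + 1)"
      using approx_seq_imp_tower[OF \<phi>(1) \<alpha> p] by metis
    have "(\<lambda>n. Gamma (\<alpha> + 1) * schwartz_norm \<alpha> p (\<phi> n)) \<longlonglongrightarrow> Gamma (\<alpha> + 1) * L'"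
      by (intro tendsto_intros \<phi>)
    then have "(\<lambda>n. Lp_norm p (weyl_tower \<alpha> (F n))) \<longlonglongrightarrow> Gamma (\<alpha> + 1) * L'"
      using G by (simp add: F)
    from approx_tower_unique[OF D F(1) f \<alpha> p L this]
    show "L' = L / Gamma (\<alpha> + 1)" using G by simp
  qed
  then show ?thesis using \<alpha> by (simp add: Tnorm_def)
qed

section \<open>Averages of dilations on the completed spaces\<close>

definition trunc_kernel :: "(real \<Rightarrow> real) \<Rightarrow> real \<Rightarrow> real \<Rightarrow> real" where
  "trunc_kernel \<kappa> \<epsilon> u = indicator {\<epsilon><..} u * \<kappa> u"

lemma dil_kernel_trunc:
  assumes "dil_kernel p \<kappa>" shows "dil_kernel p (trunc_kernel \<kappa> \<epsilon>)"
proof -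
  have [measurable]: "\<kappa> \<in> borel_measurable borel" using assms by (simp add: dil_kernel_def)
  have "set_integrable lborel {0<..} (\<lambda>u. trunc_kernel \<kappa> \<epsilon> u * u powr (- 1 / p))"
    by (rule set_integrable_bound[of _ _ "\<lambda>u. \<kappa> u * u powr (- 1 / p)"])
       (use assms in \<open>auto simp: dil_kernel_def trunc_kernel_def set_borel_measurable_def indicator_def\<close>)
  then show ?thesis unfolding dil_kernel_def trunc_kernel_def by auto
qed

text \<open>On (0, 1) the weight \<open>u powr (- 1 / p)\<close> is at least 1, so weighted
  integrability is the stronger condition.\<close>

lemma dil_kernel_integrable:
  assumes k: "dil_kernel p \<kappa>" and p: "p > 1" and supp: "\<And>u. u \<notin> {0<..<1} \<Longrightarrow> \<kappa> u = 0"
  shows "set_integrable lborel {0<..} \<kappa>"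
proof (rule set_integrable_bound[of _ _ "\<lambda>u. \<kappa> u * u powr (- 1 / p)"])
  have "norm (\<kappa> u) \<le> norm (\<kappa> u * u powr (- 1 / p))" for u
  proof (cases "u \<in> {0<..<1}")
    case True
    have "1 powr (- 1 / p) \<le> u powr (- 1 / p)" using True p by (intro powr_mono2') auto
    then show ?thesis by (simp add: abs_mult mult_le_cancel_left1)
  qed (simp add: supp)
  then show "AE u in lborel. u \<in> {0<..} \<longrightarrow> norm (\<kappa> u) \<le> norm (\<kappa> u * u powr (- 1 / p))" by simp
qed (use k in \<open>auto simp: dil_kernel_def set_borel_measurable_def\<close>)

text \<open>Dominated convergence. The \<open>+ 2\<close> keeps every cut-off strictly between 0 and
  1, the range in which truncated kernels are later bounded from above by an operator bound.\<close>

lemma dil_norm_trunc_tendsto: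
  assumes "dil_kernel p \<kappa>"
  shows "(\<lambda>n. dil_norm p (\<lambda>u. trunc_kernel \<kappa> (1 / (real n + 2)) u - \<kappa> u)) \<longlonglongrightarrow> 0"
proof -
  have [measurable]: "\<kappa> \<in> borel_measurable borel" using assms by (simp add: dil_kernel_def)
  have "(\<lambda>n. LINT u|lborel. indicator {0<..} u * (\<bar>trunc_kernel \<kappa> (1 / (real n + 2)) u - \<kappa> u\<bar> * u powr (- 1 / p))) \<longlonglongrightarrow> (LINT u::real|lborel. (0::real))"
  proof (rule integral_dominated_convergence)
    show "integrable lborel (\<lambda>u. indicator {0<..} u * \<bar>\<kappa> u * u powr (- 1 / p)\<bar>)"
      using assms set_integrable_abs[of lborel "{0<..}" "\<lambda>u. \<kappa> u * u powr (- 1 / p)"] by (simp add: dil_kernel_def set_integrable_def)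
    show "(\<lambda>u. indicator {0<..} u * (\<bar>trunc_kernel \<kappa> (1 / (real n + 2)) u - \<kappa> u\<bar> * u powr (- 1 / p))) \<in> borel_measurable lborel" for n
      unfolding trunc_kernel_def by measurable
    show "AE u in lborel. norm (indicator {0<..} u * (\<bar>trunc_kernel \<kappa> (1 / (real n + 2)) u - \<kappa> u\<bar> * u powr (- 1 / p))) \<le> indicator {0<..} u * \<bar>\<kappa> u * u powr (- 1 / p)\<bar>" for n
      by (intro AE_I2) (auto simp: trunc_kernel_def indicator_def abs_mult)
    show "AE u in lborel. (\<lambda>n. indicator {0<..} u * (\<bar>trunc_kernel \<kappa> (1 / (real n + 2)) u - \<kappa> u\<bar> * u powr (- 1 / p))) \<longlonglongrightarrow> 0"
    proof (rule AE_I2)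
      fix u :: real
      show "(\<lambda>n. indicator {0<..} u * (\<bar>trunc_kernel \<kappa> (1 / (real n + 2)) u - \<kappa> u\<bar> * u powr (- 1 / p))) \<longlonglongrightarrow> 0"
      proof (cases "u > 0")
        case True
        obtain N where N: "inverse (real (Suc N)) < u" using reals_Archimedean[OF True] by blast
        have "trunc_kernel \<kappa> (1 / (real n + 2)) u = \<kappa> u" if "n \<ge> N" for n
        proof -
          have "1 / (real n + 2) \<le> inverse (real (Suc N))"
            unfolding inverse_eq_divide using that by (intro divide_left_mono) auto
          then show ?thesis using N by (simp add: trunc_kernel_def)
        qed
        then show ?thesis by (intro tendsto_eventually eventually_sequentiallyI[of N]) simp
      qed simp
    qed
  qed simp
  then show ?thesis by (simp add: dil_norm_def set_lebesgue_integral_def)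
qed

text \<open>The cut-off shrinks along with the approximation index. The error splits into a kernel
  error, which is small against bounded norms, and the action of \<open>\<kappa>\<close> on a
  convergent sequence. The second conclusion says that the representatives of
  \<open>dil \<kappa> f\<close> are, in the limit, \<open>dil \<kappa>\<close> of those of
  \<open>f\<close>.\<close>

lemma approx_tower_dil:
  assumes D: "approx_tower \<alpha> p f D" and f: "f \<in> Lp_plus p" and \<alpha>: "\<alpha> > 0" and p: "p > 1"
    and k: "dil_kernel p \<kappa>" and supp: "\<And>u. u \<notin> {0<..<1} \<Longrightarrow> \<kappa> u = 0"
  defines "F \<equiv> \<lambda>n j. dil (\<lambda>u. trunc_kernel \<kappa> (1 / (real n + 2)) u * u ^ j) (D n j)"
  shows "approx_tower \<alpha> p (dil \<kappa> f) F"
    and "(\<lambda>n. Lp_norm p (\<lambda>t. weyl_tower \<alpha> (F n) t - dil \<kappa> (weyl_tower \<alpha> (D n)) t)) \<longlonglongrightarrow> 0"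
proof -
  define \<kappa>' where "\<kappa>' = (\<lambda>n. trunc_kernel \<kappa> (1 / (real n + 2)))"
  define \<delta> where "\<delta> = (\<lambda>n. dil_norm p (\<lambda>u. \<kappa>' n u - \<kappa> u))"
  have k': "dil_kernel p (\<kappa>' n)" for n unfolding \<kappa>'_def using k by (rule dil_kernel_trunc)
  have m': "\<kappa>' n \<in> borel_measurable borel" for n using k' by (simp add: dil_kernel_def)
  have supp': "\<kappa>' n u = 0" if "u \<notin> {1 / (real n + 2)<..<1}" for n u
    using that supp[of u] by (auto simp: \<kappa>'_def trunc_kernel_def indicator_def)
  have i': "set_integrable lborel {0<..} (\<kappa>' n)" for n
    by (rule dil_kernel_integrable[OF k' p]) (use supp in \<open>auto simp: \<kappa>'_def trunc_kernel_def\<close>)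
  have T: "tower (D n)" for n using D by (simp add: approx_tower_def)
  have TF: "tower (F n)" for n
    unfolding F_def using tower_dil[OF T m' i', of "1 / (real n + 2)" n] supp' by (simp add: \<kappa>'_def)
  let ?h = "\<lambda>n. weyl_tower \<alpha> (D n)" and ?g = "\<lambda>n. weyl_tower \<alpha> (F n)"
  have h: "?h n \<in> Lp_plus p" and g: "?g n \<in> Lp_plus p" for n using T TF p \<alpha> by (auto intro: weyl_tower_Lp)
  have kh: "dil \<kappa> (?h n) \<in> Lp_plus p" for n by (rule Lp_plus_dil[OF p h k])
  have \<delta>: "\<delta> \<longlonglongrightarrow> 0" unfolding \<delta>_def \<kappa>'_def by (rule dil_norm_trunc_tendsto[OF k])
  have "convergent (\<lambda>n. Lp_norm p (?h n))" by (rule approx_tower_convergent[OF D \<alpha> p])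
  then obtain L where L: "(\<lambda>n. Lp_norm p (?h n)) \<longlonglongrightarrow> L" by (auto simp: convergent_def)
  have gt: "?g n t = dil (\<kappa>' n) (?h n) t" if "t > 0" for n t
    unfolding F_def \<kappa>'_def using weyl_tower_dil[OF T m' i' \<alpha> that] by (simp add: \<kappa>'_def)
  have le: "Lp_norm p (\<lambda>t. ?g n t - dil \<kappa> (?h n) t) \<le> \<delta> n * Lp_norm p (?h n)" for n
  proof -
    have "Lp_norm p (\<lambda>t. ?g n t - dil \<kappa> (?h n) t) = Lp_norm p (\<lambda>t. dil (\<kappa>' n) (?h n) t - dil \<kappa> (?h n) t)"
      by (rule Lp_norm_cong) (simp add: gt)
    then show ?thesis using Lp_norm_kernel_diff_le[OF p h k' k] by (simp add: \<delta>_def)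
  qed
  show lim: "(\<lambda>n. Lp_norm p (\<lambda>t. ?g n t - dil \<kappa> (?h n) t)) \<longlonglongrightarrow> 0"
  proof (rule tendsto_sandwich[OF _ _ tendsto_const])
    show "(\<lambda>n. \<delta> n * Lp_norm p (?h n)) \<longlonglongrightarrow> 0" using tendsto_mult[OF \<delta> L] by simp
  qed (use le in auto)
  show "approx_tower \<alpha> p (dil \<kappa> f) F"
    unfolding approx_tower_def
  proof (intro conjI allI impI TF)
    fix e :: real assume e: "e > 0"
    let ?K = "dil_norm p \<kappa>"
    have K: "?K \<ge> 0" by (rule dil_norm_nonneg)
    have "e / (3 * (?K + 1)) > 0" using e K by simp
    then obtain N1 where N1: "\<And>m n. m \<ge> N1 \<Longrightarrow> n \<ge> N1 \<Longrightarrow> Lp_norm p (\<lambda>t. ?h m t - ?h n t) < e / (3 * (?K + 1))"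
      using D unfolding approx_tower_def by meson
    have "e / 3 > 0" using e by simp
    from LIMSEQ_D[OF lim this] obtain N2 where N2: "\<And>n. n \<ge> N2 \<Longrightarrow> Lp_norm p (\<lambda>t. ?g n t - dil \<kappa> (?h n) t) < e / 3"
      by auto
    have "Lp_norm p (\<lambda>t. ?g m t - ?g n t) < e" if mn: "m \<ge> max N1 N2" "n \<ge> max N1 N2" for m n
    proof -
      have "Lp_norm p (\<lambda>t. ?g m t - ?g n t) \<le> Lp_norm p (\<lambda>t. ?g m t - dil \<kappa> (?h m) t) + Lp_norm p (\<lambda>t. dil \<kappa> (?h m) t - ?g n t)"
        by (rule Lp_norm_diff_triangle[OF g kh g p])
      also have "Lp_norm p (\<lambda>t. dil \<kappa> (?h m) t - ?g n t) \<le> Lp_norm p (\<lambda>t. dil \<kappa> (?h m) t - dil \<kappa> (?h n) t) + Lp_norm p (\<lambda>t. dil \<kappa> (?h n) t - ?g n t)"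
        by (rule Lp_norm_diff_triangle[OF kh kh g p])
      also have "Lp_norm p (\<lambda>t. dil \<kappa> (?h m) t - dil \<kappa> (?h n) t) \<le> ?K * Lp_norm p (\<lambda>t. ?h m t - ?h n t)"
        by (rule Lp_norm_dil_diff_le[OF p h h k])
      also have "\<dots> \<le> ?K * (e / (3 * (?K + 1)))"
        using N1[of m n] mn K by (intro mult_left_mono) auto
      also have "\<dots> \<le> e / 3" using K e by (simp add: field_simps)
      also have "Lp_norm p (\<lambda>t. dil \<kappa> (?h n) t - ?g n t) < e / 3"
        using N2[of n] mn by (simp add: Lp_norm_minus_commute[of p "dil \<kappa> (?h n)"])
      finally show ?thesis using N2[of m] mn by simp
    qed
    then show "\<exists>N. \<forall>m\<ge>N. \<forall>n\<ge>N. Lp_norm p (\<lambda>t. ?g m t - ?g n t) < e" by blast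
  next
    have F0: "F n 0 = dil (\<kappa>' n) (D n 0)" for n by (simp add: F_def \<kappa>'_def)
    have d0: "D n 0 \<in> Lp_plus p" for n by (rule tower_Lp[OF T p])
    have lf: "(\<lambda>n. Lp_norm p (\<lambda>t. D n 0 t - f t)) \<longlonglongrightarrow> 0" using D by (simp add: approx_tower_def)
    show "(\<lambda>n. Lp_norm p (\<lambda>t. F n 0 t - dil \<kappa> f t)) \<longlonglongrightarrow> 0"
    proof (rule tendsto_sandwich[OF _ _ tendsto_const])
      show "(\<lambda>n. \<delta> n * (Lp_norm p f + Lp_norm p (\<lambda>t. D n 0 t - f t)) + dil_norm p \<kappa> * Lp_norm p (\<lambda>t. D n 0 t - f t)) \<longlonglongrightarrow> 0"
        by (rule tendsto_eq_intros \<delta> lf refl)+ simp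
      have "Lp_norm p (\<lambda>t. F n 0 t - dil \<kappa> f t) \<le> \<delta> n * (Lp_norm p f + Lp_norm p (\<lambda>t. D n 0 t - f t)) + dil_norm p \<kappa> * Lp_norm p (\<lambda>t. D n 0 t - f t)" for n
      proof -
        have "Lp_norm p (\<lambda>t. F n 0 t - dil \<kappa> f t) \<le> Lp_norm p (\<lambda>t. dil (\<kappa>' n) (D n 0) t - dil \<kappa> (D n 0) t) + Lp_norm p (\<lambda>t. dil \<kappa> (D n 0) t - dil \<kappa> f t)"
          unfolding F0 by (intro Lp_norm_diff_triangle Lp_plus_dil p d0 f k k')
        also have "\<dots> \<le> \<delta> n * Lp_norm p (D n 0) + dil_norm p \<kappa> * Lp_norm p (\<lambda>t. D n 0 t - f t)"
          unfolding \<delta>_def by (intro add_mono Lp_norm_kernel_diff_le Lp_norm_dil_diff_le p d0 f k k')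
        also have "\<dots> \<le> \<delta> n * (Lp_norm p f + Lp_norm p (\<lambda>t. D n 0 t - f t)) + dil_norm p \<kappa> * Lp_norm p (\<lambda>t. D n 0 t - f t)"
          using Lp_norm_le_diff[OF d0 f p, of n] by (intro add_right_mono mult_left_mono) (auto simp: \<delta>_def dil_norm_nonneg)
        finally show ?thesis .
      qed
      then show "\<forall>\<^sub>F n in sequentially. Lp_norm p (\<lambda>t. F n 0 t - dil \<kappa> f t) \<le> \<delta> n * (Lp_norm p f + Lp_norm p (\<lambda>t. D n 0 t - f t)) + dil_norm p \<kappa> * Lp_norm p (\<lambda>t. D n 0 t - f t)"
        by simp
    qed simp
  qed
qed

text \<open>For \<alpha> > 0 the L^p bound holds for the representatives and passes to the limit;
  the factor \<open>Gamma (\<alpha> + 1)\<close> cancels, which is why the constant is the same for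
  all \<alpha>.\<close>

lemma Tspace_dil:
  assumes f: "f \<in> Tspace \<alpha> p" and \<alpha>: "\<alpha> \<ge> 0" and p: "p > 1"
    and k: "dil_kernel p \<kappa>" and supp: "\<And>u. u \<notin> {0<..<1} \<Longrightarrow> \<kappa> u = 0"
  shows "dil \<kappa> f \<in> Tspace \<alpha> p" "Tnorm \<alpha> p (dil \<kappa> f) \<le> dil_norm p \<kappa> * Tnorm \<alpha> p f"
proof -
  have "dil \<kappa> f \<in> Tspace \<alpha> p \<and> Tnorm \<alpha> p (dil \<kappa> f) \<le> dil_norm p \<kappa> * Tnorm \<alpha> p f"
  proof (cases "\<alpha> = 0")
    case True
    then show ?thesis using f Lp_plus_dil[OF p _ k] Lp_norm_dil_le[OF p _ k] by (simp add: Tspace_def Tnorm_def)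
  next
    case False
    then have \<alpha>: "\<alpha> > 0" using \<alpha> by simp
    have G: "Gamma (\<alpha> + 1) > 0" using \<alpha> by (intro Gamma_real_pos) auto
    obtain D where fL: "f \<in> Lp_plus p" and D: "approx_tower \<alpha> p f D" using f Tspace_iff[OF \<alpha> p] by blast
    note F = approx_tower_dil[OF D fL \<alpha> p k supp]
    let ?F = "\<lambda>n j. dil (\<lambda>u. trunc_kernel \<kappa> (1 / (real n + 2)) u * u ^ j) (D n j)"
    obtain L where L: "(\<lambda>n. Lp_norm p (weyl_tower \<alpha> (D n))) \<longlonglongrightarrow> L"
      using approx_tower_convergent[OF D \<alpha> p] by (auto simp: convergent_def)
    obtain L' where L': "(\<lambda>n. Lp_norm p (weyl_tower \<alpha> (?F n))) \<longlonglongrightarrow> L'"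
      using approx_tower_convergent[OF F(1) \<alpha> p] by (auto simp: convergent_def)
    have h: "weyl_tower \<alpha> (D n) \<in> Lp_plus p" "weyl_tower \<alpha> (?F n) \<in> Lp_plus p" for n
      using D F(1) p \<alpha> by (auto simp: approx_tower_def intro!: weyl_tower_Lp)
    have "L' \<le> 0 + dil_norm p \<kappa> * L"
    proof (rule LIMSEQ_le[OF L'])
      show "(\<lambda>n. Lp_norm p (\<lambda>t. weyl_tower \<alpha> (?F n) t - dil \<kappa> (weyl_tower \<alpha> (D n)) t) + dil_norm p \<kappa> * Lp_norm p (weyl_tower \<alpha> (D n))) \<longlonglongrightarrow> 0 + dil_norm p \<kappa> * L"
        by (intro tendsto_intros F L)
      have "Lp_norm p (weyl_tower \<alpha> (?F n)) \<le> Lp_norm p (\<lambda>t. weyl_tower \<alpha> (?F n) t - dil \<kappa> (weyl_tower \<alpha> (D n)) t) + dil_norm p \<kappa> * Lp_norm p (weyl_tower \<alpha> (D n))" for n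
        using Lp_norm_le_diff[OF h(2) Lp_plus_dil[OF p h(1) k] p, of n n] Lp_norm_dil_le[OF p h(1) k, of n] by linarith
      then show "\<exists>N. \<forall>n\<ge>N. Lp_norm p (weyl_tower \<alpha> (?F n)) \<le> Lp_norm p (\<lambda>t. weyl_tower \<alpha> (?F n) t - dil \<kappa> (weyl_tower \<alpha> (D n)) t) + dil_norm p \<kappa> * Lp_norm p (weyl_tower \<alpha> (D n))"
        by blast
    qed
    moreover have "Tnorm \<alpha> p f = L / Gamma (\<alpha> + 1)" by (rule Tnorm_eq[OF D fL \<alpha> p L])
    moreover have kf: "dil \<kappa> f \<in> Lp_plus p" by (rule Lp_plus_dil[OF p fL k])
    moreover have "Tnorm \<alpha> p (dil \<kappa> f) = L' / Gamma (\<alpha> + 1)" by (rule Tnorm_eq[OF F(1) kf \<alpha> p L'])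
    ultimately show ?thesis using F(1) G Tspace_iff[OF \<alpha> p] by (auto simp: divide_le_cancel)
  qed
  then show "dil \<kappa> f \<in> Tspace \<alpha> p" "Tnorm \<alpha> p (dil \<kappa> f) \<le> dil_norm p \<kappa> * Tnorm \<alpha> p f" by auto
qed

text \<open>The lower bound on the operator norm needs exact values, not estimates. The constant
  family approximates \<open>D 0\<close>, but \<open>dil \<kappa> (D 0)\<close> may leave the
  Schwartz class, so its norm is still found through truncated kernels.\<close>

lemma schwartz_Tspace:
  assumes D: "tower D" and \<alpha>: "\<alpha> > 0" and p: "p > 1"
    and k: "dil_kernel p \<kappa>" and supp: "\<And>u. u \<notin> {0<..<1} \<Longrightarrow> \<kappa> u = 0"
  shows "D 0 \<in> Tspace \<alpha> p" "Tnorm \<alpha> p (D 0) = Lp_norm p (weyl_tower \<alpha> D) / Gamma (\<alpha> + 1)"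
    "Tnorm \<alpha> p (dil \<kappa> (D 0)) = Lp_norm p (dil \<kappa> (weyl_tower \<alpha> D)) / Gamma (\<alpha> + 1)"
proof -
  have L: "D 0 \<in> Lp_plus p" by (rule tower_Lp[OF D p])
  have "Lp_norm p (\<lambda>t. g t - g t) = 0" for g by (simp add: Lp_norm_def)
  then have A: "approx_tower \<alpha> p (D 0) (\<lambda>_. D)" using D by (simp add: approx_tower_def)
  then show "D 0 \<in> Tspace \<alpha> p" using L Tspace_iff[OF \<alpha> p] by blast
  show "Tnorm \<alpha> p (D 0) = Lp_norm p (weyl_tower \<alpha> D) / Gamma (\<alpha> + 1)"
    by (rule Tnorm_eq[OF A L \<alpha> p]) simp
  note F = approx_tower_dil[OF A L \<alpha> p k supp]
  let ?F = "\<lambda>n j. dil (\<lambda>u. trunc_kernel \<kappa> (1 / (real n + 2)) u * u ^ j) (D j)"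
  let ?g = "dil \<kappa> (weyl_tower \<alpha> D)"
  have h: "?g \<in> Lp_plus p" "weyl_tower \<alpha> (?F n) \<in> Lp_plus p" for n
    using D F(1) p \<alpha> by (auto simp: approx_tower_def intro!: weyl_tower_Lp Lp_plus_dil k)
  have "(\<lambda>n. Lp_norm p (weyl_tower \<alpha> (?F n)) - Lp_norm p ?g) \<longlonglongrightarrow> 0"
  proof (rule Lim_null_comparison[OF _ F(2)])
    have "norm (Lp_norm p (weyl_tower \<alpha> (?F n)) - Lp_norm p ?g) \<le> Lp_norm p (\<lambda>t. weyl_tower \<alpha> (?F n) t - ?g t)" for n
      using Lp_norm_le_diff[OF h(2) h(1) p, of n] Lp_norm_le_diff[OF h(1) h(2) p, of n]
        Lp_norm_minus_commute[of p "weyl_tower \<alpha> (?F n)" ?g] by auto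
    then show "\<forall>\<^sub>F n in sequentially. norm (Lp_norm p (weyl_tower \<alpha> (?F n)) - Lp_norm p ?g) \<le> Lp_norm p (\<lambda>t. weyl_tower \<alpha> (?F n) t - ?g t)"
      by simp
  qed
  then have "(\<lambda>n. Lp_norm p (weyl_tower \<alpha> (?F n))) \<longlonglongrightarrow> Lp_norm p ?g"
    by (simp add: LIM_zero_iff)
  then show "Tnorm \<alpha> p (dil \<kappa> (D 0)) = Lp_norm p ?g / Gamma (\<alpha> + 1)"
    by (intro Tnorm_eq[OF F(1) Lp_plus_dil[OF p L k] \<alpha> p])
qed

section \<open>The Cesaro operator\<close>

lemma approx_seq_cong:
  assumes "\<And>t. t > 0 \<Longrightarrow> f t = g t" shows "approx_seq \<alpha> p f = approx_seq \<alpha> p g"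
proof -
  have "Lp_norm p (\<lambda>t. \<phi> t - f t) = Lp_norm p (\<lambda>t. \<phi> t - g t)" for \<phi>
    by (rule Lp_norm_cong) (simp add: assms)
  then show ?thesis unfolding approx_seq_def[abs_def] by simp
qed

text \<open>\<open>cesaro\<close> is identified with an average for \<open>t > 0\<close> only,
  whereas elements of the space are functions on all reals.\<close>

lemma Tspace_cong:
  assumes "\<And>t. t > 0 \<Longrightarrow> f t = g t"
  shows "f \<in> Tspace \<alpha> p \<longleftrightarrow> g \<in> Tspace \<alpha> p" "Tnorm \<alpha> p f = Tnorm \<alpha> p g"
proof -
  have "Lp_norm p f = Lp_norm p g" by (rule Lp_norm_cong) (simp add: assms)
  then show "f \<in> Tspace \<alpha> p \<longleftrightarrow> g \<in> Tspace \<alpha> p" "Tnorm \<alpha> p f = Tnorm \<alpha> p g"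
    using approx_seq_cong[of f g, OF assms] Lp_plus_cong[of f g, OF assms] by (auto simp: Tspace_def Tnorm_def)
qed

lemma Tspace_imp_Lp_plus: "f \<in> Tspace \<alpha> p \<Longrightarrow> f \<in> Lp_plus p"
  by (auto simp: Tspace_def split: if_splits)

definition cesaro_kernel :: "real \<Rightarrow> real \<Rightarrow> real" where
  "cesaro_kernel \<beta> u = indicator {0<..<1} u * (\<beta> * (1 - u) powr (\<beta> - 1))"

lemma cesaro_kernel_measurable [measurable]: "cesaro_kernel \<beta> \<in> borel_measurable borel"
  unfolding cesaro_kernel_def[abs_def] by measurable

lemma cesaro_kernel_nonneg: "\<beta> > 0 \<Longrightarrow> cesaro_kernel \<beta> u \<ge> 0"
  by (simp add: cesaro_kernel_def)

lemma cesaro_kernel_support: "u \<notin> {0<..<1} \<Longrightarrow> cesaro_kernel \<beta> u = 0"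
  by (simp add: cesaro_kernel_def)

text \<open>Homogeneity: under \<open>s = t * v\<close> the powers of \<open>t\<close> have
  exponents \<open>- \<beta>\<close>, \<open>1\<close> and \<open>\<beta> - 1\<close>, which sum to
  0.\<close>

lemma cesaro_eq_dil:
  assumes t: "t > 0" shows "cesaro \<beta> f t = dil (cesaro_kernel \<beta>) f t"
proof -
  have "cesaro \<beta> f t = complex_of_real (\<beta> / t powr \<beta>) * (\<bar>t\<bar> *\<^sub>R (LINT v|lborel. indicator {0<..<t} (0 + t * v) *\<^sub>R
      (complex_of_real ((t - (0 + t * v)) powr (\<beta> - 1)) * f (0 + t * v))))"
    unfolding cesaro_def set_lebesgue_integral_def
    by (subst lborel_integral_real_affine[of t _ 0]) (use t in auto)
  also have "\<dots> = (\<beta> / t powr \<beta> * t) *\<^sub>R (LINT v|lborel. indicator {0<..<t} (t * v) *\<^sub>R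
      (complex_of_real ((t - t * v) powr (\<beta> - 1)) * f (t * v)))"
    using t by (simp add: scaleR_conv_of_real)
  also have "\<dots> = (LINT v|lborel. (\<beta> / t powr \<beta> * t) *\<^sub>R indicator {0<..<t} (t * v) *\<^sub>R
      (complex_of_real ((t - t * v) powr (\<beta> - 1)) * f (t * v)))"
    by (rule integral_scaleR_right[symmetric])
  also have "\<dots> = dil (cesaro_kernel \<beta>) f t"
    unfolding dil_def set_lebesgue_integral_def
  proof (intro Bochner_Integration.integral_cong refl)
    fix v :: real
    show "(\<beta> / t powr \<beta> * t) *\<^sub>R indicator {0<..<t} (t * v) *\<^sub>R (complex_of_real ((t - t * v) powr (\<beta> - 1)) * f (t * v))
       = indicator {0<..} v *\<^sub>R cesaro_kernel \<beta> v *\<^sub>R f (v * t)"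
    proof (cases "v \<in> {0<..<1}")
      case True
      have "t - t * v = t * (1 - v)" by (simp add: algebra_simps)
      then have e: "\<beta> / t powr \<beta> * t * (t - t * v) powr (\<beta> - 1) = \<beta> * (1 - v) powr (\<beta> - 1)"
        using t True by (simp add: powr_mult powr_diff)
      have "indicator {0<..<t} (t * v) = (1::real)" using True t by (simp add: indicator_def)
      then have "(\<beta> / t powr \<beta> * t) *\<^sub>R indicator {0<..<t} (t * v) *\<^sub>R (complex_of_real ((t - t * v) powr (\<beta> - 1)) * f (t * v))
        = (\<beta> / t powr \<beta> * t * (t - t * v) powr (\<beta> - 1)) *\<^sub>R f (t * v)"
        by (simp add: scaleR_conv_of_real)
      also have "\<dots> = indicator {0<..} v *\<^sub>R cesaro_kernel \<beta> v *\<^sub>R f (v * t)"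
        unfolding e using True by (simp add: cesaro_kernel_def mult.commute[of v t])
      finally show ?thesis .
    next
      case False
      then show ?thesis using t by (auto simp: cesaro_kernel_def indicator_def zero_less_mult_iff)
    qed
  qed
  finally show ?thesis .
qed

text \<open>The weighted integral is \<open>\<beta> * Beta (1 - 1 / p) \<beta>\<close>, and
  \<open>\<beta> * Gamma \<beta> = Gamma (\<beta> + 1)\<close>. Convergence at \<open>u = 0\<close>
  is exactly \<open>p > 1\<close>.\<close>

lemma cesaro_kernel_norm:
  assumes \<beta>: "\<beta> > 0" and p: "p > 1"
  shows dil_kernel_cesaro: "dil_kernel p (cesaro_kernel \<beta>)"
    and dil_norm_cesaro: "dil_norm p (cesaro_kernel \<beta>) = Gamma (\<beta> + 1) * Gamma (1 - 1 / p) / Gamma (\<beta> + 1 - 1 / p)"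
proof -
  let ?B = "\<lambda>u::real. u powr ((1 - 1 / p) - 1) * (1 - u) powr (\<beta> - 1)"
  have a: "1 - 1 / p > 0" using p by simp
  have B: "set_integrable lborel {0..1} ?B" by (rule integrable_Beta[OF a \<beta>])
  have Bi: "(LINT u:{0..1}|lborel. ?B u) = Beta (1 - 1 / p) \<beta>"
    using set_borel_integral_eq_integral(2)[OF B] has_integral_Beta_real[OF a \<beta>] by (simp add: integral_unique)
  have eq: "AE u in lborel. indicator {0<..} u *\<^sub>R (cesaro_kernel \<beta> u * u powr (- 1 / p)) = \<beta> * (indicator {0..1} u *\<^sub>R ?B u)"
    using AE_lborel_singleton[of 0] AE_lborel_singleton[of 1]
    by eventually_elim (auto simp: cesaro_kernel_def indicator_def)
  have "integrable lborel (\<lambda>u. indicator {0<..} u *\<^sub>R (cesaro_kernel \<beta> u * u powr (- 1 / p)))"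
    using B by (subst integrable_cong_AE[OF _ _ eq]) (auto simp: set_integrable_def)
  then show "dil_kernel p (cesaro_kernel \<beta>)" by (simp add: dil_kernel_def set_integrable_def)
  have "dil_norm p (cesaro_kernel \<beta>) = (LINT u|lborel. indicator {0<..} u *\<^sub>R (cesaro_kernel \<beta> u * u powr (- 1 / p)))"
    using cesaro_kernel_nonneg[OF \<beta>] by (simp add: dil_norm_def set_lebesgue_integral_def)
  also have "\<dots> = (LINT u|lborel. \<beta> * (indicator {0..1} u *\<^sub>R ?B u))"
    by (rule integral_cong_AE[OF _ _ eq]) auto
  also have "\<dots> = \<beta> * Beta (1 - 1 / p) \<beta>"
    using Bi by (simp add: set_lebesgue_integral_def)
  also have "\<dots> = \<beta> * (Gamma (1 - 1 / p) * Gamma \<beta> / Gamma (1 - 1 / p + \<beta>))" by (simp add: Beta_def)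
  also have "\<dots> = Gamma (\<beta> + 1) * Gamma (1 - 1 / p) / Gamma (\<beta> + 1 - 1 / p)"
  proof -
    have "\<beta> \<notin> \<int>\<^sub>\<le>\<^sub>0" using \<beta> by (auto elim!: nonpos_Ints_cases)
    then show ?thesis using Gamma_plus1[of \<beta>] by (simp add: algebra_simps)
  qed
  finally show "dil_norm p (cesaro_kernel \<beta>) = Gamma (\<beta> + 1) * Gamma (1 - 1 / p) / Gamma (\<beta> + 1 - 1 / p)" .
qed

section \<open>The substitution \<open>u = exp (- r)\<close> and the group representation\<close>

lemma set_lebesgue_integral_lborel:
  fixes f :: "real \<Rightarrow> 'a::{banach, second_countable_topology}"
  assumes "set_borel_measurable lborel S f"
  shows "set_lebesgue_integral lborel S f = set_lebesgue_integral lebesgue S f"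
  using assms unfolding set_lebesgue_integral_def set_borel_measurable_def by (simp add: integral_completion)

text \<open>Absolute integrability transfers in both directions, and for a non-integrable
  \<open>F\<close> both integrals take the default value 0. The formula for the Cesaro operator
  therefore holds at every \<open>t > 0\<close>, including points where the integrals
  diverge.\<close>

lemma set_integral_exp_substitution:
  fixes F :: "real \<Rightarrow> complex"
  assumes F: "set_borel_measurable lborel {0<..<1} F"
  shows "(LINT u:{0<..<1}|lborel. F u) = (LINT r:{0<..}|lborel. exp (- r) *\<^sub>R F (exp (- r)))"
proof -
  have img: "(\<lambda>r. exp (- r)) ` {0<..} = {0<..<1::real}"
  proof safe
    fix u :: real assume "u \<in> {0<..<1}"
    then have "exp (- (- ln u)) = u" "- ln u \<in> {0<..}" by auto
    then show "u \<in> (\<lambda>r. exp (- r)) ` {0<..}" by (metis imageI)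
  qed auto
  have m: "set_borel_measurable lborel {0<..} (\<lambda>r. exp (- r) *\<^sub>R F (exp (- r)))"
  proof -
    have [measurable]: "(\<lambda>u. indicator {0<..<1} u *\<^sub>R F u) \<in> borel_measurable borel"
      using F by (simp add: set_borel_measurable_def)
    have "(\<lambda>r. exp (- r) *\<^sub>R (\<lambda>u. indicator {0<..<1} u *\<^sub>R F u) (exp (- r))) \<in> borel_measurable borel" by measurable
    also have "(\<lambda>r. exp (- r) *\<^sub>R (\<lambda>u. indicator {0<..<1} u *\<^sub>R F u) (exp (- r))) = (\<lambda>r. indicator {0<..} r *\<^sub>R exp (- r) *\<^sub>R F (exp (- r)))"
      by (auto simp: fun_eq_iff indicator_def)
    finally show ?thesis by (simp add: set_borel_measurable_def)
  qed
  have cv: "(\<lambda>r. \<bar>- exp (- r)\<bar> *\<^sub>R F (exp (- r))) absolutely_integrable_on {0<..} \<and>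
      integral {0<..} (\<lambda>r. \<bar>- exp (- r)\<bar> *\<^sub>R F (exp (- r))) = b \<longleftrightarrow>
      F absolutely_integrable_on (\<lambda>r. exp (- r)) ` {0<..} \<and> integral ((\<lambda>r. exp (- r)) ` {0<..}) F = b" for b
    by (rule has_absolute_integral_change_of_variables_real) (auto intro!: derivative_eq_intros simp: inj_on_def)
  show ?thesis
  proof (cases "set_integrable lebesgue {0<..<1} F")
    case True
    then have c: "set_integrable lebesgue {0<..} (\<lambda>r. exp (- r) *\<^sub>R F (exp (- r)))"
        "integral {0<..} (\<lambda>r. exp (- r) *\<^sub>R F (exp (- r))) = integral {0<..<1} F"
      using cv[of "integral {0<..<1} F"] by (auto simp: img)
    show ?thesis
      unfolding set_lebesgue_integral_lborel[OF F] set_lebesgue_integral_lborel[OF m]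
      using set_lebesgue_integral_eq_integral(2)[OF True] set_lebesgue_integral_eq_integral(2)[OF c(1)] c(2) by simp
  next
    case False
    then have "\<not> set_integrable lebesgue {0<..} (\<lambda>r. exp (- r) *\<^sub>R F (exp (- r)))"
      using cv by (auto simp: img)
    with False show ?thesis
      unfolding set_lebesgue_integral_lborel[OF F] set_lebesgue_integral_lborel[OF m]
      by (simp add: set_integrable_def set_lebesgue_integral_def not_integrable_integral_eq)
  qed
qed

lemma cesaro_T_rp:
  assumes f: "f \<in> Lp_plus p" and t: "t > 0"
  shows "cesaro \<beta> f t = complex_of_real \<beta> * set_lebesgue_integral lborel {0<..}
           (\<lambda>r. complex_of_real ((1 - exp (- r)) powr (\<beta> - 1) * exp (- r * (1 - 1 / p))) * T_rp r p f t)"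
proof -
  define F where "F = (\<lambda>u. ((1 - u) powr (\<beta> - 1)) *\<^sub>R f (u * t))"
  define f0 where "f0 = (\<lambda>t. indicator {0<..} t *\<^sub>R f t)"
  have [measurable]: "f0 \<in> borel_measurable borel" using f by (simp add: Lp_plus_iff f0_def)
  have "(\<lambda>u. indicator {0<..<1} u *\<^sub>R ((1 - u) powr (\<beta> - 1)) *\<^sub>R f0 (u * t)) \<in> borel_measurable borel" by measurable
  also have "(\<lambda>u. indicator {0<..<1} u *\<^sub>R ((1 - u) powr (\<beta> - 1)) *\<^sub>R f0 (u * t)) = (\<lambda>u. indicator {0<..<1} u *\<^sub>R F u)"
    using t by (intro ext) (auto simp: F_def f0_def indicator_def)
  finally have F: "set_borel_measurable lborel {0<..<1} F" by (simp add: set_borel_measurable_def)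
  have "cesaro \<beta> f t = (LINT u|lborel. \<beta> *\<^sub>R (indicator {0<..<1} u *\<^sub>R F u))"
    unfolding cesaro_eq_dil[OF t] dil_def set_lebesgue_integral_def
    by (intro Bochner_Integration.integral_cong) (auto simp: cesaro_kernel_def F_def indicator_def)
  also have "\<dots> = \<beta> *\<^sub>R (LINT u:{0<..<1}|lborel. F u)"
    unfolding set_lebesgue_integral_def by (rule integral_scaleR_right)
  also have "\<dots> = \<beta> *\<^sub>R (LINT r:{0<..}|lborel. exp (- r) *\<^sub>R F (exp (- r)))"
    by (simp only: set_integral_exp_substitution[OF F])
  also have "(LINT r:{0<..}|lborel. exp (- r) *\<^sub>R F (exp (- r))) = set_lebesgue_integral lborel {0<..}
           (\<lambda>r. complex_of_real ((1 - exp (- r)) powr (\<beta> - 1) * exp (- r * (1 - 1 / p))) * T_rp r p f t)"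
  proof (intro set_lebesgue_integral_cong allI impI)
    fix r :: real
    \<comment> \<open>The Jacobian is split so that \<open>exp (- r / p)\<close> can be absorbed
      into \<open>T_rp\<close>, where it makes the dilation isometric on L^p.\<close>
    have "exp (- r) = exp (- r * (1 - 1 / p)) * exp (- r / p)"
      by (simp flip: exp_add) (simp add: algebra_simps)
    then show "exp (- r) *\<^sub>R F (exp (- r)) = complex_of_real ((1 - exp (- r)) powr (\<beta> - 1) * exp (- r * (1 - 1 / p))) * T_rp r p f t"
      unfolding F_def T_rp_def scaleR_conv_of_real by (simp only: of_real_mult mult_ac)
  qed simp
  finally show ?thesis by (simp add: scaleR_conv_of_real)
qed

section \<open>Sharpness\<close>

definition exp_tower :: "nat \<Rightarrow> real \<Rightarrow> complex" where
  "exp_tower j t = complex_of_real ((- 1) ^ j * exp (- t))"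

lemma one_plus_power_le_exp:
  fixes t :: real
  assumes "t \<ge> 0" shows "(1 + t) ^ m \<le> real m ^ m * exp t"
proof (cases "m = 0")
  case False
  have "1 + t \<le> real m * (1 + t / real m)" using False by (simp add: field_simps)
  also have "\<dots> \<le> real m * exp (t / real m)" by (intro mult_left_mono) auto
  finally have "(1 + t) ^ m \<le> (real m * exp (t / real m)) ^ m" using assms by (intro power_mono) auto
  also have "\<dots> = real m ^ m * exp t" using False by (simp add: power_mult_distrib flip: exp_of_nat_mult)
  finally show ?thesis .
qed (use assms in simp)

lemma tower_exp: "tower exp_tower"
  unfolding tower_def
proof (intro conjI allI impI)
  fix n and t :: real assume "t \<ge> 0"
  have "((\<lambda>t. (- 1) ^ n * exp (- t)) has_real_derivative (- 1) ^ Suc n * exp (- t)) (at t within {0..})"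
    by (auto intro!: derivative_eq_intros)
  then show "(exp_tower n has_vector_derivative exp_tower (Suc n) t) (at t within {0..})"
    unfolding exp_tower_def[abs_def] by (rule has_vector_derivative_of_real)
next
  fix m n
  show "\<exists>C. \<forall>t\<ge>0. (1 + t) ^ m * norm (exp_tower n t) \<le> C"
  proof (intro exI allI impI)
    fix t :: real assume "t \<ge> 0"
    then have "(1 + t) ^ m * exp (- t) \<le> real m ^ m * exp t * exp (- t)"
      by (intro mult_right_mono one_plus_power_le_exp) auto
    also have "\<dots> = real m ^ m" by (simp add: exp_minus)
    finally have "(1 + t) ^ m * exp (- t) \<le> real m ^ m" .
    moreover have "norm (exp_tower n t) = exp (- t)"
      unfolding exp_tower_def norm_of_real by (simp add: abs_mult power_abs)
    ultimately show "(1 + t) ^ m * norm (exp_tower n t) \<le> real m ^ m" by simp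
  qed
qed

definition powr_exp :: "real \<Rightarrow> real \<Rightarrow> real" where
  "powr_exp \<alpha> t = t powr \<alpha> * exp (- t)"

text \<open>The Weyl integral of order \<open>a\<close> fixes e^(-t), since its integral is
  \<open>Gamma a * exp (- t)\<close>. The sign from \<open>n\<close> derivatives cancels the sign in
  the definition of the Weyl derivative, so W^\<alpha> fixes e^(-t) as well.\<close>

lemma weyl_tower_exp:
  assumes \<alpha>: "\<alpha> > 0" and t: "t > 0"
  shows "weyl_tower \<alpha> exp_tower t = complex_of_real (powr_exp \<alpha> t)"
proof -
  define n where "n = weyl_order \<alpha>"
  define a where "a = real n - \<alpha>"
  have a: "0 < a" "a \<le> 1" using weyl_order[OF \<alpha>] by (auto simp: a_def n_def)
  have "(\<integral>\<^sup>+u. ennreal (indicator {0<..} u * (u powr (a - 1) * exp (- u))) \<partial>lborel) = ennreal (Gamma a)"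
    unfolding Gamma_conv_nn_integral_real[OF a(1)]
    by (intro nn_integral_cong) (auto simp: indicator_def exp_minus divide_inverse)
  then have "has_bochner_integral lborel (\<lambda>u. indicator {0<..} u * (u powr (a - 1) * exp (- u))) (Gamma a)"
    using a Gamma_real_pos[OF a(1)] by (intro has_bochner_integral_nn_integral) auto
  then have Gi: "(LINT u|lborel. indicator {0<..} u * (u powr (a - 1) * exp (- u))) = Gamma a"
    by (rule has_bochner_integral_integral_eq)
  have "weyl_tower \<alpha> exp_tower t = (t powr \<alpha>) *\<^sub>R weyl_deriv \<alpha> (exp_tower 0) t"
    by (rule weyl_deriv_eq_weyl_tower[OF tower_exp refl \<alpha> t, symmetric])
  also have "weyl_deriv \<alpha> (exp_tower 0) t = (- 1) ^ n * weyl_int a (exp_tower n) t"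
    using iter_vderiv_weyl_int[OF tower_exp refl a t, of n]
    by (simp add: weyl_deriv_def Let_def a_def n_def weyl_order_def)
  also have "weyl_int a (exp_tower n) t = complex_of_real (1 / Gamma a) *
     (LINT u|lborel. complex_of_real ((- 1) ^ n * exp (- t) * (indicator {0<..} u * (u powr (a - 1) * exp (- u)))))"
    unfolding weyl_int_shift exp_tower_def
    by (intro arg_cong2[where f="(*)"] refl Bochner_Integration.integral_cong)
       (simp add: scaleR_conv_of_real exp_add[symmetric] exp_diff exp_minus divide_inverse flip: of_real_mult; simp add: mult_ac)
  also have "(LINT u|lborel. complex_of_real ((- 1) ^ n * exp (- t) * (indicator {0<..} u * (u powr (a - 1) * exp (- u)))))
     = complex_of_real ((- 1) ^ n * exp (- t) * Gamma a)"
    by (simp only: integral_complex_of_real integral_mult_right_zero Gi)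
  finally have "weyl_tower \<alpha> exp_tower t = complex_of_real (t powr \<alpha> * ((- 1) ^ n * (1 / Gamma a * ((- 1) ^ n * exp (- t) * Gamma a))))"
    by (simp add: scaleR_conv_of_real)
  also have "t powr \<alpha> * ((- 1) ^ n * (1 / Gamma a * ((- 1) ^ n * exp (- t) * Gamma a))) = powr_exp \<alpha> t"
    using Gamma_real_pos[OF a(1)] by (simp add: powr_exp_def flip: power_mult_distrib mult.assoc)
  finally show ?thesis .
qed

lemma powr_exp_measurable [measurable]: "powr_exp \<alpha> \<in> borel_measurable borel"
  unfolding powr_exp_def[abs_def] by measurable

lemma powr_exp_Lp:
  assumes "\<alpha> \<ge> 0" "p > 1" shows "(\<lambda>t. complex_of_real (powr_exp \<alpha> t)) \<in> Lp_plus p"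
proof (cases "\<alpha> = 0")
  case True
  have "exp_tower 0 \<in> Lp_plus p" by (rule tower_Lp[OF tower_exp assms(2)])
  then show ?thesis
    by (rule Lp_plus_cong[THEN iffD1, rotated]) (use True in \<open>simp add: exp_tower_def powr_exp_def\<close>)
next
  case False
  then have "weyl_tower \<alpha> exp_tower \<in> Lp_plus p" using assms by (intro weyl_tower_Lp tower_exp) auto
  then show ?thesis
    by (rule Lp_plus_cong[THEN iffD1, rotated]) (use False assms in \<open>simp add: weyl_tower_exp\<close>)
qed

lemma powr_exp_bounded:
  assumes "\<alpha> \<ge> 0"
  obtains C where "C \<ge> 0" "\<And>t. t > 0 \<Longrightarrow> powr_exp \<alpha> t \<le> C"
proof -
  define m where "m = nat \<lceil>\<alpha>\<rceil>"
  have m: "\<alpha> \<le> real m" using assms by (simp add: m_def)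
  have "powr_exp \<alpha> t \<le> real m ^ m" if "t > 0" for t
  proof -
    have "t powr \<alpha> \<le> (1 + t) powr \<alpha>" using that assms by (intro powr_mono2) auto
    also have "\<dots> \<le> (1 + t) powr real m" using that m by (intro powr_mono) auto
    also have "\<dots> = (1 + t) ^ m" using that by (simp add: powr_realpow)
    also have "\<dots> \<le> real m ^ m * exp t" using that by (intro one_plus_power_le_exp) auto
    finally have "t powr \<alpha> * exp (- t) \<le> real m ^ m * exp t * exp (- t)" by (rule mult_right_mono) simp
    then show ?thesis by (simp add: powr_exp_def exp_minus field_simps)
  qed
  then show thesis by (intro that[of "real m ^ m"]) auto
qed

text \<open>The average of the dilates of \<open>t\<^sup>\<alpha> e\<^sup>-\<^sup>t\<close> with this kernel tends to a multiple of \<open>t\<^sup>-\<^sup>1\<^sup>/\<^sup>p\<close>,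
  the (non-integrable) common eigenfunction of all averages of dilations, as \<open>a \<rightarrow> 0\<close>.\<close>

definition eigen_kernel :: "real \<Rightarrow> real \<Rightarrow> real \<Rightarrow> real" where
  "eigen_kernel p a u = indicator {a<..<1} u * u powr (1 / p - 1)"

lemma eigen_kernel_measurable [measurable]: "eigen_kernel p a \<in> borel_measurable borel"
  unfolding eigen_kernel_def[abs_def] by measurable

lemma dil_kernel_eigen:
  assumes a: "0 < a" shows "dil_kernel p (eigen_kernel p a)"
proof -
  have "set_integrable lborel {a..1} (\<lambda>u. u powr (1 / p - 1) * u powr (- 1 / p))"
    by (intro borel_integrable_atLeastAtMost' continuous_intros) (use a in auto)
  then have "set_integrable lborel {a<..<1} (\<lambda>u. u powr (1 / p - 1) * u powr (- 1 / p))"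
    by (rule set_integrable_subset) auto
  then have "set_integrable lborel {0<..} (\<lambda>u. eigen_kernel p a u * u powr (- 1 / p))"
    unfolding set_integrable_def
    by (rule Bochner_Integration.integrable_cong[THEN iffD1, rotated 2]) (use a in \<open>auto simp: eigen_kernel_def indicator_def\<close>)
  then show ?thesis by (simp add: dil_kernel_def)
qed

text \<open>A real-valued form of the averaged function, so that order and monotonicity in the
  cut-off can be used.\<close>

definition eigen_approx :: "real \<Rightarrow> real \<Rightarrow> real \<Rightarrow> real \<Rightarrow> real" where
  "eigen_approx p \<alpha> a t = (LINT u|lborel. eigen_kernel p a u * powr_exp \<alpha> (u * t))"

lemma eigen_approx_integrable:
  assumes a: "0 < a" and t: "t > 0"
  shows "integrable lborel (\<lambda>u. eigen_kernel p a u * powr_exp \<alpha> (u * t))"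
proof -
  have "set_integrable lborel {a..1} (\<lambda>u. u powr (1 / p - 1) * powr_exp \<alpha> (u * t))"
    unfolding powr_exp_def by (intro borel_integrable_atLeastAtMost' continuous_intros) (use a t in auto)
  then have "set_integrable lborel {a<..<1} (\<lambda>u. u powr (1 / p - 1) * powr_exp \<alpha> (u * t))"
    by (rule set_integrable_subset) auto
  then show ?thesis by (simp add: set_integrable_def eigen_kernel_def mult.assoc)
qed

lemma powr_exp_nonneg: "powr_exp \<alpha> t \<ge> 0"
  by (simp add: powr_exp_def)

lemma eigen_kernel_nonneg: "eigen_kernel p a u \<ge> 0"
  by (simp add: eigen_kernel_def)

lemma eigen_approx_nonneg: "eigen_approx p \<alpha> a t \<ge> 0"
  unfolding eigen_approx_def by (intro integral_nonneg_AE AE_I2 mult_nonneg_nonneg eigen_kernel_nonneg powr_exp_nonneg)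

lemma dil_eigen:
  assumes a: "0 < a"
  shows "dil (eigen_kernel p a) (\<lambda>t. complex_of_real (powr_exp \<alpha> t)) t = complex_of_real (eigen_approx p \<alpha> a t)"
  unfolding dil_def set_lebesgue_integral_def eigen_approx_def integral_complex_of_real[symmetric]
  by (intro Bochner_Integration.integral_cong refl) (use a in \<open>auto simp: eigen_kernel_def indicator_def scaleR_conv_of_real\<close>)

lemma eigen_approx_Lp:
  assumes "0 < a" "\<alpha> \<ge> 0" "p > 1" shows "(\<lambda>t. complex_of_real (eigen_approx p \<alpha> a t)) \<in> Lp_plus p"
  unfolding dil_eigen[OF assms(1), symmetric]
  using Lp_plus_dil[OF assms(3) powr_exp_Lp[OF assms(2,3)] dil_kernel_eigen[OF assms(1), of p]] .

lemma eigen_approx_measurable [measurable]: "eigen_approx p \<alpha> a \<in> borel_measurable borel"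
  unfolding eigen_approx_def[abs_def] by measurable

text \<open>For \<alpha> > 0 the prescribed representative has to come from a Schwartz function:
  averaging \<open>exp_tower\<close> over (a, 1) stays in the Schwartz class, and the representative
  of the result is the same average of \<open>powr_exp \<alpha>\<close>. For \<alpha> = 0 the
  function represents itself and \<open>Gamma 1 = 1\<close>.\<close>

lemma eigen_test_function:
  assumes a: "0 < a" "a < 1" and \<alpha>: "\<alpha> \<ge> 0" and p: "p > 1"
    and k: "dil_kernel p \<kappa>" and supp: "\<And>u. u \<notin> {0<..<1} \<Longrightarrow> \<kappa> u = 0"
  obtains f where "f \<in> Tspace \<alpha> p" "Tnorm \<alpha> p f = Lp_norm p (\<lambda>t. complex_of_real (eigen_approx p \<alpha> a t)) / Gamma (\<alpha> + 1)"
    "Tnorm \<alpha> p (dil \<kappa> f) = Lp_norm p (dil \<kappa> (\<lambda>t. complex_of_real (eigen_approx p \<alpha> a t))) / Gamma (\<alpha> + 1)"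
proof (cases "\<alpha> = 0")
  case True
  show thesis
    by (rule that[of "\<lambda>t. complex_of_real (eigen_approx p \<alpha> a t)"])
       (use True eigen_approx_Lp[OF a(1) \<alpha> p] in \<open>auto simp: Tspace_def Tnorm_def\<close>)
next
  case False
  then have \<alpha>': "\<alpha> > 0" using \<alpha> by simp
  define T where "T = (\<lambda>j. dil (\<lambda>u. eigen_kernel p a u * u ^ j) (exp_tower j))"
  have i: "set_integrable lborel {0<..} (eigen_kernel p a)"
    by (rule dil_kernel_integrable[OF dil_kernel_eigen[OF a(1)] p]) (use a in \<open>auto simp: eigen_kernel_def\<close>)
  have T: "tower T" unfolding T_def
    by (rule tower_dil[OF tower_exp eigen_kernel_measurable i a(1)]) (simp add: eigen_kernel_def)
  have w: "weyl_tower \<alpha> T t = complex_of_real (eigen_approx p \<alpha> a t)" if "t > 0" for t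
  proof -
    have "weyl_tower \<alpha> T t = dil (eigen_kernel p a) (weyl_tower \<alpha> exp_tower) t"
      unfolding T_def by (rule weyl_tower_dil[OF tower_exp eigen_kernel_measurable i \<alpha>' that])
    also have "\<dots> = dil (eigen_kernel p a) (\<lambda>t. complex_of_real (powr_exp \<alpha> t)) t"
      by (rule dil_cong[OF that weyl_tower_exp[OF \<alpha>']])
    finally show ?thesis by (simp add: dil_eigen[OF a(1)])
  qed
  note S = schwartz_Tspace[OF T \<alpha>' p k supp]
  show thesis
  proof (rule that[OF S(1)])
    have "Lp_norm p (weyl_tower \<alpha> T) = Lp_norm p (\<lambda>t. complex_of_real (eigen_approx p \<alpha> a t))"
      by (rule Lp_norm_cong) (simp add: w)
    then show "Tnorm \<alpha> p (T 0) = Lp_norm p (\<lambda>t. complex_of_real (eigen_approx p \<alpha> a t)) / Gamma (\<alpha> + 1)"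
      using S(2) by simp
    have "Lp_norm p (dil \<kappa> (weyl_tower \<alpha> T)) = Lp_norm p (dil \<kappa> (\<lambda>t. complex_of_real (eigen_approx p \<alpha> a t)))"
      by (rule Lp_norm_cong) (simp add: dil_cong[OF _ w])
    then show "Tnorm \<alpha> p (dil \<kappa> (T 0)) = Lp_norm p (dil \<kappa> (\<lambda>t. complex_of_real (eigen_approx p \<alpha> a t))) / Gamma (\<alpha> + 1)"
      using S(3) by simp
  qed
qed

text \<open>An approximate form of the eigenvalue relation for t^(-1/p). Rescaling the integration
  variable by \<open>u\<close> extracts \<open>u powr (- 1 / p)\<close> and turns the range (a, 1)
  into (a u, u). For \<open>\<epsilon> < u < 1\<close> this contains everything between
  \<open>a\<close> and \<open>\<epsilon>\<close>, and the integral over that part is the difference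
  on the right.\<close>

lemma eigen_approx_scale_ge:
  assumes a: "0 < a" "a < \<epsilon>" and u: "\<epsilon> < u" "u < 1" and t: "t > 0"
  shows "eigen_approx p \<alpha> a (u * t) \<ge> u powr (- 1 / p) * (eigen_approx p \<alpha> a t - eigen_approx p \<alpha> \<epsilon> t)"
proof -
  have u0: "u > 0" "\<epsilon> > 0" using a u by auto
  let ?q = "\<lambda>b \<mu>. eigen_kernel p b \<mu> * powr_exp \<alpha> (\<mu> * t)"
  let ?r = "\<lambda>\<mu>. indicator {a * u<..<u} \<mu> * (\<mu> powr (1 / p - 1) * powr_exp \<alpha> (\<mu> * t))"
  have "eigen_approx p \<alpha> a (u * t) = \<bar>1 / u\<bar> *\<^sub>R (LINT \<mu>|lborel. eigen_kernel p a (0 + (1 / u) * \<mu>) * powr_exp \<alpha> ((0 + (1 / u) * \<mu>) * (u * t)))"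
    unfolding eigen_approx_def by (rule lborel_integral_real_affine) (use u0 in simp)
  also have "(LINT \<mu>|lborel. eigen_kernel p a (0 + (1 / u) * \<mu>) * powr_exp \<alpha> ((0 + (1 / u) * \<mu>) * (u * t))) =
      (LINT \<mu>|lborel. u powr (1 - 1 / p) * ?r \<mu>)"
  proof (intro Bochner_Integration.integral_cong refl)
    fix \<mu> :: real
    show "eigen_kernel p a (0 + (1 / u) * \<mu>) * powr_exp \<alpha> ((0 + (1 / u) * \<mu>) * (u * t)) = u powr (1 - 1 / p) * ?r \<mu>"
    proof (cases "\<mu> \<in> {a * u<..<u}")
      case True
      then have "\<mu> > 0" using a u0 by (auto intro: less_trans[of 0 "a * u"])
      moreover have "\<mu> / u \<in> {a<..<1}" using True u0 by (auto simp: field_simps)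
      ultimately show ?thesis using True u0
        by (simp add: eigen_kernel_def powr_divide powr_diff)
    next
      case False
      then have "\<mu> / u \<notin> {a<..<1}" using u0 by (auto simp: field_simps)
      with False show ?thesis by (simp add: eigen_kernel_def)
    qed
  qed
  also have "\<bar>1 / u\<bar> *\<^sub>R (LINT \<mu>|lborel. u powr (1 - 1 / p) * ?r \<mu>) = u powr (- 1 / p) * (LINT \<mu>|lborel. ?r \<mu>)"
  proof -
    have "1 / u * u powr (1 - 1 / p) = u powr (- 1 / p)" using u0 by (simp add: powr_diff powr_minus_divide)
    moreover have "\<bar>1 / u\<bar> *\<^sub>R (LINT \<mu>|lborel. u powr (1 - 1 / p) * ?r \<mu>) = 1 / u * u powr (1 - 1 / p) * (LINT \<mu>|lborel. ?r \<mu>)"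
      unfolding integral_mult_right_zero using u0 by simp
    ultimately show ?thesis by simp
  qed
  finally have eq: "eigen_approx p \<alpha> a (u * t) = u powr (- 1 / p) * (LINT \<mu>|lborel. ?r \<mu>)" .
  have "eigen_approx p \<alpha> a t - eigen_approx p \<alpha> \<epsilon> t = (LINT \<mu>|lborel. ?q a \<mu> - ?q \<epsilon> \<mu>)"
    unfolding eigen_approx_def using eigen_approx_integrable[OF a(1) t] eigen_approx_integrable[OF u0(2) t] by simp
  also have "\<dots> \<le> (LINT \<mu>|lborel. ?r \<mu>)"
  proof (rule integral_mono)
    show "integrable lborel (\<lambda>\<mu>. ?q a \<mu> - ?q \<epsilon> \<mu>)"
      using eigen_approx_integrable[OF a(1) t] eigen_approx_integrable[OF u0(2) t] by simp
    have "integrable lborel (\<lambda>\<mu>. eigen_kernel p (a * u) \<mu> * powr_exp \<alpha> (\<mu> * t))"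
      by (rule eigen_approx_integrable[OF _ t]) (use a u0 in simp)
    then show "integrable lborel ?r"
      by (rule Bochner_Integration.integrable_bound) (use u in \<open>auto simp: eigen_kernel_def indicator_def\<close>)
    fix \<mu> :: real
    have "a * u < a" using a u by simp
    then have "a < \<mu> \<Longrightarrow> a * u < \<mu>" by (rule less_trans)
    then show "?q a \<mu> - ?q \<epsilon> \<mu> \<le> ?r \<mu>"
      using a u by (auto simp: eigen_kernel_def indicator_def powr_exp_nonneg)
  qed
  finally show ?thesis unfolding eq by (intro mult_left_mono) auto
qed

text \<open>The scaling inequality is integrated against the part of \<open>\<kappa>\<close> above
  \<open>\<epsilon>\<close>; the contribution below \<open>\<epsilon>\<close> is nonnegative and is
  dropped.\<close>

lemma dil_eigen_ge:
  assumes a: "0 < a" "a < \<epsilon>" "\<epsilon> < 1" and \<alpha>: "\<alpha> \<ge> 0" and p: "p > 1"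
    and k: "dil_kernel p \<kappa>" and supp: "\<And>u. u \<notin> {0<..<1} \<Longrightarrow> \<kappa> u = 0" and pos: "\<And>u. \<kappa> u \<ge> 0" and t: "t > 0"
  shows "dil_norm p (trunc_kernel \<kappa> \<epsilon>) * (eigen_approx p \<alpha> a t - eigen_approx p \<alpha> \<epsilon> t)
    \<le> norm (dil \<kappa> (\<lambda>t. complex_of_real (eigen_approx p \<alpha> a t)) t)"
proof -
  let ?g = "eigen_approx p \<alpha> a"
  have [measurable]: "\<kappa> \<in> borel_measurable borel" using k by (simp add: dil_kernel_def)
  obtain C where C: "C \<ge> 0" "\<And>t. t > 0 \<Longrightarrow> powr_exp \<alpha> t \<le> C" using powr_exp_bounded[OF \<alpha>] by metis
  have i: "set_integrable lborel {0<..} (eigen_kernel p a)"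
    by (rule dil_kernel_integrable[OF dil_kernel_eigen[OF a(1)] p]) (use a in \<open>auto simp: eigen_kernel_def\<close>)
  have i': "integrable lborel (eigen_kernel p a)"
    using i unfolding set_integrable_def
    by (rule Bochner_Integration.integrable_cong[THEN iffD1, rotated 2]) (use a in \<open>auto simp: eigen_kernel_def indicator_def\<close>)
  \<comment> \<open>Boundedness of the test function makes the average converge at the given
    \<open>t\<close>, so the comparison is pointwise.\<close>
  have bd: "?g s \<le> integral\<^sup>L lborel (eigen_kernel p a) * C" if s: "s > 0" for s
  proof -
    have "?g s \<le> (LINT u|lborel. eigen_kernel p a u * C)"
      unfolding eigen_approx_def
    proof (rule integral_mono[OF eigen_approx_integrable[OF a(1) s]])
      fix u :: real
      show "eigen_kernel p a u * powr_exp \<alpha> (u * s) \<le> eigen_kernel p a u * C"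
        using a s C(2)[of "u * s"] by (cases "u \<in> {a<..<1}") (auto simp: eigen_kernel_def intro!: mult_left_mono)
    qed (use i' in simp)
    then show ?thesis by simp
  qed
  have "set_integrable lborel {0<..} (\<lambda>u. \<kappa> u *\<^sub>R complex_of_real (?g (u * t)))"
  proof (rule dil_integrable_bounded[OF _ dil_kernel_integrable[OF k p supp] _ _ t])
    show "(\<lambda>t. indicator {0<..} t *\<^sub>R complex_of_real (?g t)) \<in> borel_measurable borel" by measurable
    show "norm (complex_of_real (?g s)) \<le> integral\<^sup>L lborel (eigen_kernel p a) * C" if "s > 0" for s
      using bd[OF that] eigen_approx_nonneg[of p \<alpha> a s] by simp
  qed auto
  then have "integrable lborel (\<lambda>u. complex_of_real (indicator {0<..} u * (\<kappa> u * ?g (u * t))))"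
    by (simp add: set_integrable_def scaleR_conv_of_real)
  then have int: "integrable lborel (\<lambda>u. indicator {0<..} u * (\<kappa> u * ?g (u * t)))"
    by (simp only: complex_of_real_integrable_eq)
  let ?d = "?g t - eigen_approx p \<alpha> \<epsilon> t"
  have "dil_norm p (trunc_kernel \<kappa> \<epsilon>) * ?d = (LINT u|lborel. (indicator {0<..} u * (\<bar>trunc_kernel \<kappa> \<epsilon> u\<bar> * u powr (- 1 / p))) * ?d)"
    by (simp add: dil_norm_def set_lebesgue_integral_def)
  also have "\<dots> \<le> (LINT u|lborel. indicator {0<..} u * (\<kappa> u * ?g (u * t)))"
  proof (rule integral_mono[OF _ int])
    have "set_integrable lborel {0<..} (\<lambda>u. \<bar>trunc_kernel \<kappa> \<epsilon> u * u powr (- 1 / p)\<bar>)"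
      using dil_kernel_trunc[OF k] by (intro set_integrable_abs) (simp add: dil_kernel_def)
    then show "integrable lborel (\<lambda>u. (indicator {0<..} u * (\<bar>trunc_kernel \<kappa> \<epsilon> u\<bar> * u powr (- 1 / p))) * ?d)"
      by (intro integrable_mult_left) (simp add: set_integrable_def abs_mult)
    fix u :: real
    show "(indicator {0<..} u * (\<bar>trunc_kernel \<kappa> \<epsilon> u\<bar> * u powr (- 1 / p))) * ?d \<le> indicator {0<..} u * (\<kappa> u * ?g (u * t))"
    proof (cases "u \<in> {\<epsilon><..<1}")
      case True
      then have "\<kappa> u * (u powr (- 1 / p) * ?d) \<le> \<kappa> u * ?g (u * t)"
        using eigen_approx_scale_ge[OF a(1,2) _ _ t, of u p \<alpha>] pos by (intro mult_left_mono) auto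
      then show ?thesis using True a pos[of u] by (simp add: trunc_kernel_def mult.assoc)
    next
      case False
      then have "trunc_kernel \<kappa> \<epsilon> u = 0" using supp[of u] a by (auto simp: trunc_kernel_def indicator_def)
      then show ?thesis using pos[of u] eigen_approx_nonneg[of p \<alpha> a "u * t"] by simp
    qed
  qed
  also have "\<dots> \<le> \<bar>LINT u|lborel. indicator {0<..} u * (\<kappa> u * ?g (u * t))\<bar>" by simp
  also have "\<dots> = norm (complex_of_real (LINT u|lborel. indicator {0<..} u * (\<kappa> u * ?g (u * t))))" by simp
  also have "complex_of_real (LINT u|lborel. indicator {0<..} u * (\<kappa> u * ?g (u * t))) = dil \<kappa> (\<lambda>t. complex_of_real (?g t)) t"
    unfolding dil_def set_lebesgue_integral_def integral_complex_of_real[symmetric] by (simp add: scaleR_conv_of_real)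
  finally show ?thesis .
qed

text \<open>Only \<open>1 / t < u < 2 / t\<close> is kept. There \<open>u * t\<close> lies between 1
  and 2, so the integrand is bounded below, and the interval has length \<open>1 / t\<close>. The
  conditions on \<open>t\<close> say that this interval lies inside (a, 1).\<close>

lemma eigen_approx_ge:
  assumes a: "0 < a" and \<alpha>: "\<alpha> \<ge> 0" and p: "p > 1" and t: "2 \<le> t" "t \<le> 1 / a"
  shows "2 powr (1 / p - 1) * exp (- 2) * t powr (- 1 / p) \<le> eigen_approx p \<alpha> a t"
proof -
  have at: "a \<le> 1 / t" using a t by (simp add: field_simps)
  let ?c = "(2 / t) powr (1 / p - 1) * exp (- 2)"
  have "2 powr (1 / p - 1) * exp (- 2) * t powr (- 1 / p) = ?c * (1 / t)"
    using t by (simp add: powr_divide powr_diff powr_minus_divide)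
  also have "\<dots> = (LINT u|lborel. ?c * indicator {1 / t<..<2 / t} u)"
    using t by (simp add: divide_right_mono diff_divide_distrib[symmetric])
  also have "\<dots> \<le> eigen_approx p \<alpha> a t"
    unfolding eigen_approx_def
  proof (rule integral_mono[OF _ eigen_approx_integrable[OF a]])
    show "integrable lborel (\<lambda>u. ?c * indicator {1 / t<..<2 / t} u)"
      using t by (intro integrable_mult_right integrable_real_indicator) (auto simp: divide_right_mono)
    fix u :: real
    show "?c * indicator {1 / t<..<2 / t} u \<le> eigen_kernel p a u * powr_exp \<alpha> (u * t)"
    proof (cases "u \<in> {1 / t<..<2 / t}")
      case True
      have "2 / t \<le> 1" "0 < 1 / t" using t by simp_all
      then have u: "0 < u" "u < 1" "a < u" using True at unfolding greaterThanLessThan_iff by linarith+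
      have ut: "1 \<le> u * t" "u * t \<le> 2" using True t by (auto simp: field_simps)
      have "(2 / t) powr (1 / p - 1) \<le> u powr (1 / p - 1)"
        using True u p by (intro powr_mono2') auto
      moreover have "1 * exp (- 2) \<le> (u * t) powr \<alpha> * exp (- (u * t))"
        using ut \<alpha> by (intro mult_mono ge_one_powr_ge_zero) auto
      ultimately have "?c \<le> u powr (1 / p - 1) * ((u * t) powr \<alpha> * exp (- (u * t)))"
        by (intro mult_mono) auto
      then show ?thesis using True u by (simp add: eigen_kernel_def powr_exp_def)
    qed (simp add: eigen_kernel_nonneg powr_exp_nonneg)
  qed (use t in auto)
  finally show ?thesis .
qed

text \<open>By the pointwise bound the p-th power of the norm is at least a multiple of the integral
  of \<open>1 / t\<close> over \<open>{2..1 / a}\<close>, which diverges logarithmically as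
  \<open>a\<close> tends to 0.\<close>

lemma eigen_approx_unbounded:
  assumes \<alpha>: "\<alpha> \<ge> 0" and p: "p > 1" and \<epsilon>: "\<epsilon> > 0"
  shows "\<exists>a. 0 < a \<and> a < \<epsilon> \<and> Lp_norm p (\<lambda>t. complex_of_real (eigen_approx p \<alpha> a t)) > B"
proof -
  define c where "c = 2 powr (1 / p - 1) * exp (- 2 :: real)"
  have c: "c > 0" by (simp add: c_def)
  \<comment> \<open>The value that \<open>ln R - ln 2\<close> has to reach for the p-th power of the
    norm to exceed that of \<open>B\<close>.\<close>
  define y where "y = \<bar>B\<bar> powr p / c powr p + 1"
  have y: "y > 0" by (simp add: y_def add_nonneg_pos)
  \<comment> \<open>The first summand makes the logarithm large enough; the second forces
    \<open>a = 1 / R\<close> below \<open>\<epsilon>\<close>.\<close>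
  define R where "R = 2 * exp y + 1 / \<epsilon>"
  have R: "R > 2" "R > 1 / \<epsilon>" "ln R - ln 2 \<ge> y"
  proof -
    have "2 * exp y > 2" "1 / \<epsilon> > 0" using y \<epsilon> by simp_all
    then show "R > 2" unfolding R_def by linarith
    show "R > 1 / \<epsilon>" by (simp add: R_def)
    have "ln (2 * exp y) \<le> ln R" using \<epsilon> by (subst ln_le_cancel_iff) (auto simp: R_def add_pos_pos)
    then show "ln R - ln 2 \<ge> y" by (simp add: ln_mult)
  qed
  define a where "a = 1 / R"
  have a: "0 < a" "a < \<epsilon>" using R \<epsilon> by (auto simp: a_def field_simps)
  let ?G = "\<lambda>t. complex_of_real (eigen_approx p \<alpha> a t)"
  have "((\<lambda>t. 1 / t) has_integral ln R - ln 2) {2..R}"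
    using R by (intro fundamental_theorem_of_calculus)
      (auto intro!: derivative_eq_intros simp flip: has_real_derivative_iff_has_vector_derivative)
  moreover have ci: "set_integrable lborel {2..R} (\<lambda>t::real. 1 / t)"
    by (intro borel_integrable_atLeastAtMost' continuous_intros) auto
  ultimately have ln: "(LINT t:{2..R}|lborel. 1 / t) = ln R - ln 2"
    by (simp add: set_borel_integral_eq_integral(2) integral_unique)
  have "\<bar>B\<bar> powr p < c powr p * y"
    using c by (simp add: y_def field_simps)
  also have "\<dots> \<le> c powr p * (ln R - ln 2)" using R by (intro mult_left_mono) auto
  also have "\<dots> = (LINT t|lborel. c powr p * (indicator {2..R} t * (1 / t)))"
    unfolding ln[symmetric] set_lebesgue_integral_def integral_mult_right_zero by simp
  also have "\<dots> \<le> (LINT t|lborel. indicator {0<..} t * norm (?G t) powr p)"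
  proof (rule integral_mono)
    show "integrable lborel (\<lambda>t. c powr p * (indicator {2..R} t * (1 / t)))"
      using ci by (intro integrable_mult_right) (simp add: set_integrable_def)
    show "integrable lborel (\<lambda>t. indicator {0<..} t * norm (?G t) powr p)"
      using eigen_approx_Lp[OF a(1) \<alpha> p] by (simp add: Lp_plus_iff)
    fix t :: real
    show "c powr p * (indicator {2..R} t * (1 / t)) \<le> indicator {0<..} t * norm (?G t) powr p"
    proof (cases "t \<in> {2..R}")
      case True
      have "c * t powr (- 1 / p) \<le> eigen_approx p \<alpha> a t"
        unfolding c_def using True by (intro eigen_approx_ge a \<alpha> p) (auto simp: a_def)
      then have "(c * t powr (- 1 / p)) powr p \<le> norm (?G t) powr p"
        using c p by (intro powr_mono2) auto
      moreover have "(c * t powr (- 1 / p)) powr p = c powr p * (1 / t)"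
        using c True p by (simp add: powr_mult powr_divide powr_powr powr_minus_divide)
      ultimately show ?thesis using True by simp
    qed simp
  qed
  also have "\<dots> = Lp_norm p ?G powr p" using p by (simp add: Lp_norm_powr)
  finally have "\<bar>B\<bar> powr p < Lp_norm p ?G powr p" .
  then have "\<bar>B\<bar> < Lp_norm p ?G"
    using powr_mono2[of p "Lp_norm p ?G" "\<bar>B\<bar>"] p by (meson Lp_norm_nonneg less_imp_le less_trans not_less zero_less_one)
  then show ?thesis using a by (intro exI[of _ a]) auto
qed

text \<open>For a fixed truncation the test functions satisfy the eigenvalue relation up to a term
  that does not depend on \<open>a\<close>, while their norms are unbounded; hence the truncated
  constant is at most \<open>M\<close>. The full kernel is recovered as the truncation is
  removed.\<close>

lemma dil_norm_le_bound:
  assumes \<alpha>: "\<alpha> \<ge> 0" and p: "p > 1"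
    and k: "dil_kernel p \<kappa>" and supp: "\<And>u. u \<notin> {0<..<1} \<Longrightarrow> \<kappa> u = 0" and pos: "\<And>u. \<kappa> u \<ge> 0"
    and M: "\<And>f. f \<in> Tspace \<alpha> p \<Longrightarrow> Tnorm \<alpha> p (dil \<kappa> f) \<le> M * Tnorm \<alpha> p f"
  shows "dil_norm p \<kappa> \<le> M"
proof -
  have G: "Gamma (\<alpha> + 1) > 0" using \<alpha> by (intro Gamma_real_pos) auto
  let ?g = "\<lambda>a t. complex_of_real (eigen_approx p \<alpha> a t)"
  let ?K = "\<lambda>\<epsilon>. dil_norm p (trunc_kernel \<kappa> \<epsilon>)"
  have trunc: "?K \<epsilon> \<le> M" if \<epsilon>: "0 < \<epsilon>" "\<epsilon> < 1" for \<epsilon>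
  proof (rule ccontr)
    assume "\<not> ?K \<epsilon> \<le> M"
    then have KM: "?K \<epsilon> - M > 0" by simp
    \<comment> \<open>The threshold is the upper bound for \<open>Lp_norm p (?g a)\<close> that the
      estimates below yield; going beyond it produces the contradiction.\<close>
    obtain a where a: "0 < a" "a < \<epsilon>" "Lp_norm p (?g a) > ?K \<epsilon> * Lp_norm p (?g \<epsilon>) / (?K \<epsilon> - M)"
      using eigen_approx_unbounded[OF \<alpha> p \<epsilon>(1)] by blast
    have ga: "?g a \<in> Lp_plus p" and ge: "?g \<epsilon> \<in> Lp_plus p" using a \<epsilon> \<alpha> p by (auto intro: eigen_approx_Lp)
    obtain f where f: "f \<in> Tspace \<alpha> p" "Tnorm \<alpha> p f = Lp_norm p (?g a) / Gamma (\<alpha> + 1)"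
      "Tnorm \<alpha> p (dil \<kappa> f) = Lp_norm p (dil \<kappa> (?g a)) / Gamma (\<alpha> + 1)"
      by (rule eigen_test_function[OF a(1) _ \<alpha> p k supp]) (use a \<epsilon> in auto)
    have "?K \<epsilon> * Lp_norm p (?g a) \<le> ?K \<epsilon> * (Lp_norm p (?g \<epsilon>) + Lp_norm p (\<lambda>t. ?g a t - ?g \<epsilon> t))"
      by (intro mult_left_mono Lp_norm_le_diff ga ge p dil_norm_nonneg)
    also have "\<dots> = ?K \<epsilon> * Lp_norm p (?g \<epsilon>) + Lp_norm p (\<lambda>t. ?K \<epsilon> *\<^sub>R (?g a t - ?g \<epsilon> t))"
      using p by (subst Lp_norm_cmult) (auto simp: dil_norm_nonneg distrib_left)
    also have "Lp_norm p (\<lambda>t. ?K \<epsilon> *\<^sub>R (?g a t - ?g \<epsilon> t)) \<le> Lp_norm p (dil \<kappa> (?g a))"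
    proof (rule Lp_bound(2)[OF Lp_plus_dil[OF p ga k]])
      show "(\<lambda>t. indicator {0<..} t *\<^sub>R ?K \<epsilon> *\<^sub>R (?g a t - ?g \<epsilon> t)) \<in> borel_measurable borel" by measurable
      have "norm (?K \<epsilon> *\<^sub>R (?g a t - ?g \<epsilon> t)) \<le> norm (dil \<kappa> (?g a) t)" if t: "t > 0" for t
      proof -
        have "eigen_approx p \<alpha> \<epsilon> t \<le> eigen_approx p \<alpha> a t"
          unfolding eigen_approx_def
          using a by (intro integral_mono eigen_approx_integrable t \<epsilon> mult_right_mono powr_exp_nonneg)
             (auto simp: eigen_kernel_def indicator_def)
        then have "norm (?g a t - ?g \<epsilon> t) = eigen_approx p \<alpha> a t - eigen_approx p \<alpha> \<epsilon> t"
          by (simp flip: of_real_diff)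
        then show ?thesis using dil_eigen_ge[OF a(1,2) \<epsilon>(2) \<alpha> p k supp pos t]
          by (simp add: dil_norm_nonneg)
      qed
      then show "AE t in lborel. 0 < t \<longrightarrow> norm (?K \<epsilon> *\<^sub>R (?g a t - ?g \<epsilon> t)) \<le> norm (dil \<kappa> (?g a) t)" by simp
    qed (use p in simp)
    also have "Lp_norm p (dil \<kappa> (?g a)) \<le> M * Lp_norm p (?g a)"
      using M[OF f(1)] G by (simp add: f(2,3) divide_le_cancel)
    finally have "(?K \<epsilon> - M) * Lp_norm p (?g a) \<le> ?K \<epsilon> * Lp_norm p (?g \<epsilon>)" by (simp add: left_diff_distrib)
    then have "Lp_norm p (?g a) \<le> ?K \<epsilon> * Lp_norm p (?g \<epsilon>) / (?K \<epsilon> - M)"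
      using KM by (simp add: pos_le_divide_eq mult.commute)
    with a(3) show False by simp
  qed
  \<comment> \<open>The triangle inequality splits \<open>\<kappa>\<close> into its truncation,
    already bounded by \<open>M\<close>, and a remainder whose \<open>dil_norm\<close> tends to
    0.\<close>
  have le: "dil_norm p \<kappa> \<le> M + dil_norm p (\<lambda>u. trunc_kernel \<kappa> (1 / (real n + 2)) u - \<kappa> u)" for n
  proof -
    let ?t = "trunc_kernel \<kappa> (1 / (real n + 2))"
    have abs: "set_integrable lborel {0<..} (\<lambda>u. \<bar>\<nu> u\<bar> * u powr (- 1 / p))" if "dil_kernel p \<nu>" for \<nu>
      using that set_integrable_abs[of lborel "{0<..}" "\<lambda>u. \<nu> u * u powr (- 1 / p)"] by (simp add: dil_kernel_def abs_mult)
    note kt = dil_kernel_trunc[OF k, of "1 / (real n + 2)"]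
    have "dil_norm p \<kappa> \<le> (LINT u:{0<..}|lborel. \<bar>?t u\<bar> * u powr (- 1 / p) + \<bar>?t u - \<kappa> u\<bar> * u powr (- 1 / p))"
      unfolding dil_norm_def
    proof (rule set_integral_mono)
      show "\<bar>\<kappa> u\<bar> * u powr (- 1 / p) \<le> \<bar>?t u\<bar> * u powr (- 1 / p) + \<bar>?t u - \<kappa> u\<bar> * u powr (- 1 / p)" for u
        unfolding distrib_right[symmetric] by (intro mult_right_mono) auto
    qed (intro abs k kt dil_kernel_diff set_integral_add(1))+
    also have "\<dots> = ?K (1 / (real n + 2)) + dil_norm p (\<lambda>u. ?t u - \<kappa> u)"
      unfolding dil_norm_def by (intro set_integral_add(2) abs k kt dil_kernel_diff)
    also have "?K (1 / (real n + 2)) \<le> M" by (rule trunc) auto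
    finally show ?thesis by simp
  qed
  have "(\<lambda>n. M + dil_norm p (\<lambda>u. trunc_kernel \<kappa> (1 / (real n + 2)) u - \<kappa> u)) \<longlonglongrightarrow> M + 0"
    by (intro tendsto_intros dil_norm_trunc_tendsto k)
  then show ?thesis using le by (intro LIMSEQ_le_const[of _ M]) auto
qed

theorem theorem3p3:
  fixes \<alpha> p \<beta> :: real
  assumes "\<alpha> \<ge> 0" and "p > 1" and "\<beta> > 0"
  shows "(\<forall>f\<in>Tspace \<alpha> p. cesaro \<beta> f \<in> Tspace \<alpha> p \<and>
            Tnorm \<alpha> p (cesaro \<beta> f)
              \<le> Gamma (\<beta> + 1) * Gamma (1 - 1 / p) / Gamma (\<beta> + 1 - 1 / p) * Tnorm \<alpha> p f)
       \<and> (\<forall>M. (\<forall>f\<in>Tspace \<alpha> p. Tnorm \<alpha> p (cesaro \<beta> f) \<le> M * Tnorm \<alpha> p f)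
              \<longrightarrow> Gamma (\<beta> + 1) * Gamma (1 - 1 / p) / Gamma (\<beta> + 1 - 1 / p) \<le> M)
       \<and> (\<forall>f\<in>Tspace \<alpha> p. \<forall>t>0.
            cesaro \<beta> f t = complex_of_real \<beta> *
              set_lebesgue_integral lborel {0<..}
                (\<lambda>r. complex_of_real ((1 - exp (- r)) powr (\<beta> - 1) * exp (- r * (1 - 1 / p)))
                     * T_rp r p f t))"
proof (intro conjI ballI allI impI)
  let ?\<kappa> = "cesaro_kernel \<beta>"
  note k = dil_kernel_cesaro[OF assms(3,2)]
  note norm = dil_norm_cesaro[OF assms(3,2), symmetric]
  fix f assume f: "f \<in> Tspace \<alpha> p"
  show "cesaro \<beta> f \<in> Tspace \<alpha> p"
    using Tspace_dil(1)[OF f assms(1,2) k cesaro_kernel_support] Tspace_cong(1)[of "cesaro \<beta> f" "dil ?\<kappa> f", OF cesaro_eq_dil] by simp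
  show "Tnorm \<alpha> p (cesaro \<beta> f) \<le> Gamma (\<beta> + 1) * Gamma (1 - 1 / p) / Gamma (\<beta> + 1 - 1 / p) * Tnorm \<alpha> p f"
    unfolding norm using Tspace_dil(2)[OF f assms(1,2) k cesaro_kernel_support] Tspace_cong(2)[of "cesaro \<beta> f" "dil ?\<kappa> f", OF cesaro_eq_dil] by simp
next
  fix M assume M: "\<forall>f\<in>Tspace \<alpha> p. Tnorm \<alpha> p (cesaro \<beta> f) \<le> M * Tnorm \<alpha> p f"
  have "Tnorm \<alpha> p (dil (cesaro_kernel \<beta>) f) \<le> M * Tnorm \<alpha> p f" if "f \<in> Tspace \<alpha> p" for f
    using M that Tspace_cong(2)[of "cesaro \<beta> f" "dil (cesaro_kernel \<beta>) f", OF cesaro_eq_dil] by auto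
  from dil_norm_le_bound[OF assms(1,2) dil_kernel_cesaro[OF assms(3,2)] cesaro_kernel_support cesaro_kernel_nonneg[OF assms(3)] this]
  show "Gamma (\<beta> + 1) * Gamma (1 - 1 / p) / Gamma (\<beta> + 1 - 1 / p) \<le> M"
    unfolding dil_norm_cesaro[OF assms(3,2)] .
next
  fix f and t :: real assume "f \<in> Tspace \<alpha> p" "t > 0"
  then show "cesaro \<beta> f t = complex_of_real \<beta> * set_lebesgue_integral lborel {0<..}
      (\<lambda>r. complex_of_real ((1 - exp (- r)) powr (\<beta> - 1) * exp (- r * (1 - 1 / p))) * T_rp r p f t)"
    by (intro cesaro_T_rp Tspace_imp_Lp_plus)
qed

end
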